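(* (i) Let $\phi$ be an inner function on the unit disc $\mathbb{D}$ that is not a finite Blaschke product. Then the semigroup $(U_t)_{t \ge 0}$ on the Hardy space $H^2 = H^2(\mathbb{D})$ consisting of the anti-analytic Toeplitz operators $U_t = T^*_{\phi_t}$, where $$\phi_t = \exp\left( t\, \frac{\phi+1}{\phi-1} \right), \qquad t \ge 0,$$ is universal for the class of $C_{0.}$ contraction semigroups. (ii) Moreover, if a semigroup $(U_t)_{t \ge 0}$ on $H^2$ has the form $U_t = T^*_{\phi_t}$, where $\phi_t = \exp(t\psi)$ is a singular inner function for each $t$, then $\phi := (\psi+1)/(\psi-1)$ is inner; and if $\phi$ is irrational (that is, not a finite Blaschke product), then $(U_t)_{t\ge0}$ is universal for the class of $C_{0.}$ contraction semigroups.
   Context: An inner function is a bounded holomorphic function on $\mathbb{D}$ with boundary values of modulus $1$ a.e. on the unit circle; unimodular constants count as finite Blaschke products (of degree $0$). A singular inner function is an inner function without zeros in $\mathbb{D}$ (for $t=0$ the function $\phi_0$ is the constant $1$). Here $\psi$ is a holomorphic function on $\mathbb{D}$. For $g \in H^\infty(\mathbb{D})$, $T_g$ is the analytic Toeplitz operator $f \mapsto g f$ on $H^2(\mathbb{D})$, and $T_g^*$ is its adjoint. A $C_{0.}$ contraction semigroup is a strongly continuous semigroup $(T(t))_{t \ge 0}$ of contractions on a separable infinite-dimensional complex Hilbert space $\mathcal{K}$ such that $\|T(t)x\| \to 0$ as $t \to \infty$ for all $x\in\mathcal{K}$. A semigroup $(U_t)_{t\ge 0}$ on $H^2$ is universal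 for the class of $C_{0.}$ contraction semigroups if, for every $C_{0.}$ contraction semigroup $(T(t))_{t\ge 0}$ on such a space $\mathcal{K}$, there are a closed subspace $\mathcal{M}$ of $H^2$ invariant for every $U_t$ and a bounded linear isomorphism $R : \mathcal{M} \to \mathcal{K}$ such that $T(t) = R\,(U_t)_{|\mathcal{M}}\, R^{-1}$ for all $t \ge 0$. *)

theory Defs
  imports "HOL-Complex_Analysis.Complex_Analysis"
begin

section \<open>Complex Hilbert spaces\<close>

text \<open>
  The real structure, norm and topology come from the library class \<^class>\<open>banach\<close>; the axioms
  say that the real scalar multiplication is the restriction of the complex one and that the norm
  is induced by the inner product, which is linear in its first argument. Positive definiteness
  follows from \<open>cinner_self\<close>.
\<close>

class complex_hilbert_space = banach +
  fixes scaleC :: "complex \<Rightarrow> 'a \<Rightarrow> 'a"  (infixr "*\<^sub>C" 75)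
    and cinner :: "'a \<Rightarrow> 'a \<Rightarrow> complex"
  assumes scaleC_add_right: "c *\<^sub>C (x + y) = c *\<^sub>C x + c *\<^sub>C y"
    and scaleC_add_left: "(c + d) *\<^sub>C x = c *\<^sub>C x + d *\<^sub>C x"
    and scaleC_scaleC: "c *\<^sub>C (d *\<^sub>C x) = (c * d) *\<^sub>C x"
    and scaleC_of_real: "complex_of_real r *\<^sub>C x = r *\<^sub>R x"
    and cinner_commute: "cinner x y = cnj (cinner y x)"
    and cinner_add_left: "cinner (x + y) z = cinner x z + cinner y z"
    and cinner_scaleC_left: "cinner (c *\<^sub>C x) y = c * cinner x y"
    and cinner_self: "cinner x x = complex_of_real ((norm x)\<^sup>2)"

global_interpretation complex_space:
  vector_space "scaleC :: complex \<Rightarrow> 'a \<Rightarrow> 'a::complex_hilbert_space"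
proof
  show "1 *\<^sub>C x = x" for x :: 'a
    using scaleC_of_real[of 1 x] by simp
qed (simp_all add: scaleC_add_right scaleC_add_left scaleC_scaleC)

definition separable_infinite_dimensional :: "'a::complex_hilbert_space itself \<Rightarrow> bool" where
  "separable_infinite_dimensional _ \<longleftrightarrow>
     separable_space (euclidean :: 'a topology) \<and>
     \<not> (\<exists>B. finite B \<and> complex_space.span B = (UNIV :: 'a set))"

definition bounded_clinear :: "('a::complex_hilbert_space \<Rightarrow> 'b::complex_hilbert_space) \<Rightarrow> bool" where
  "bounded_clinear A \<longleftrightarrow> bounded_linear A \<and> (\<forall>c x. A (c *\<^sub>C x) = c *\<^sub>C A x)"

definition hilbert_adjoint ::
    "('a::complex_hilbert_space \<Rightarrow> 'b::complex_hilbert_space) \<Rightarrow> 'b \<Rightarrow> 'a" where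
  "hilbert_adjoint A = (THE B. \<forall>x y. cinner (A x) y = cinner x (B y))"


section \<open>Semigroups and universality\<close>

text \<open>Semigroups are indexed by \<^typ>\<open>real\<close>; values at negative times are irrelevant.\<close>

definition operator_semigroup :: "(real \<Rightarrow> 'a \<Rightarrow> 'a::complex_hilbert_space) \<Rightarrow> bool" where
  "operator_semigroup T \<longleftrightarrow>
     (\<forall>t\<ge>0. bounded_clinear (T t)) \<and> T 0 = id \<and>
     (\<forall>s\<ge>0. \<forall>t\<ge>0. T (s + t) = T s \<circ> T t)"

definition C0dot_contraction_semigroup ::
    "(real \<Rightarrow> 'a \<Rightarrow> 'a::complex_hilbert_space) \<Rightarrow> bool" where
  "C0dot_contraction_semigroup T \<longleftrightarrow>
     operator_semigroup T \<and>
     (\<forall>x. continuous_on {0..} (\<lambda>t. T t x)) \<and>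
     (\<forall>t\<ge>0. \<forall>x. norm (T t x) \<le> norm x) \<and>
     (\<forall>x. ((\<lambda>t. norm (T t x)) \<longlongrightarrow> 0) at_top)"

definition bounded_isomorphism_on ::
    "'a set \<Rightarrow> ('a::complex_hilbert_space \<Rightarrow> 'b::complex_hilbert_space) \<Rightarrow> bool" where
  "bounded_isomorphism_on M R \<longleftrightarrow>
     (\<forall>x\<in>M. \<forall>y\<in>M. R (x + y) = R x + R y) \<and>
     (\<forall>c. \<forall>x\<in>M. R (c *\<^sub>C x) = c *\<^sub>C R x) \<and>
     bij_betw R M UNIV \<and>
     (\<exists>C. \<forall>x\<in>M. norm (R x) \<le> C * norm x) \<and>
     (\<exists>C. \<forall>y. norm (inv_into M R y) \<le> C * norm y)"

text \<open>
  HOL cannot quantify over types inside a formula, so the model space \<open>\<K>\<close> is passed as a type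
  argument. A theorem concluding \<open>universal_for_C0dot TYPE('k) U\<close> with a free type variable
  \<open>'k\<close> of class \<^class>\<open>complex_hilbert_space\<close> asserts the property for every separable
  infinite-dimensional complex Hilbert space.
\<close>

definition universal_for_C0dot ::
    "'k::complex_hilbert_space itself \<Rightarrow> (real \<Rightarrow> 'h \<Rightarrow> 'h::complex_hilbert_space) \<Rightarrow> bool" where
  "universal_for_C0dot _ U \<longleftrightarrow>
     operator_semigroup U \<and>
     (separable_infinite_dimensional TYPE('k) \<longrightarrow>
       (\<forall>T :: real \<Rightarrow> 'k \<Rightarrow> 'k. C0dot_contraction_semigroup T \<longrightarrow>
         (\<exists>(M :: 'h set) (R :: 'h \<Rightarrow> 'k).
            closed M \<and> complex_space.subspace M \<and>
            (\<forall>t\<ge>0. U t ` M \<subseteq> M) \<and>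
            bounded_isomorphism_on M R \<and>
            (\<forall>t\<ge>0. T t = R \<circ> U t \<circ> inv_into M R))))"


section \<open>The Hardy space of the unit disc\<close>

definition taylor_coeff :: "(complex \<Rightarrow> complex) \<Rightarrow> nat \<Rightarrow> complex" where
  "taylor_coeff f n = (deriv ^^ n) f 0 / fact n"

subsection \<open>Square-summable sequences\<close>

lemma l2_add:
  fixes a b :: "nat \<Rightarrow> complex"
  assumes "summable (\<lambda>n. (norm (a n))\<^sup>2)" "summable (\<lambda>n. (norm (b n))\<^sup>2)"
  shows "summable (\<lambda>n. (norm (a n + b n))\<^sup>2)"
proof (rule summable_comparison_test')
  show "summable (\<lambda>n. 2 * (norm (a n))\<^sup>2 + 2 * (norm (b n))\<^sup>2)"
    using assms by (intro summable_add summable_mult)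
  fix n
  have "(norm (a n + b n))\<^sup>2 \<le> (norm (a n) + norm (b n))\<^sup>2"
    by (intro power_mono norm_triangle_ineq) auto
  also have "\<dots> \<le> 2 * (norm (a n))\<^sup>2 + 2 * (norm (b n))\<^sup>2"
    using sum_squares_bound[of "norm (a n)" "norm (b n)"] by (simp add: power2_sum)
  finally show "norm ((norm (a n + b n))\<^sup>2) \<le> 2 * (norm (a n))\<^sup>2 + 2 * (norm (b n))\<^sup>2" by simp
qed

lemma l2_scale:
  fixes a :: "nat \<Rightarrow> complex"
  assumes "summable (\<lambda>n. (norm (a n))\<^sup>2)"
  shows "summable (\<lambda>n. (norm (c * a n))\<^sup>2)"
  using summable_mult[OF assms, of "(norm c)\<^sup>2"] by (simp add: norm_mult power_mult_distrib)

lemma l2_prod: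
  fixes a b :: "nat \<Rightarrow> complex"
  assumes "summable (\<lambda>n. (norm (a n))\<^sup>2)" "summable (\<lambda>n. (norm (b n))\<^sup>2)"
  shows "summable (\<lambda>n. a n * cnj (b n))"
proof (rule summable_norm_cancel, rule summable_comparison_test')
  show "summable (\<lambda>n. (norm (a n))\<^sup>2 + (norm (b n))\<^sup>2)"
    using assms by (intro summable_add)
  fix n
  have "0 \<le> norm (a n) * norm (b n)" by simp
  then show "norm (norm (a n * cnj (b n))) \<le> (norm (a n))\<^sup>2 + (norm (b n))\<^sup>2"
    using sum_squares_bound[of "norm (a n)" "norm (b n)"]
    unfolding real_norm_def abs_norm_cancel norm_mult complex_mod_cnj mult.assoc by linarith
qed

lemma l2_triangle:
  fixes a b :: "nat \<Rightarrow> complex"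
  assumes a: "summable (\<lambda>n. (norm (a n))\<^sup>2)" and b: "summable (\<lambda>n. (norm (b n))\<^sup>2)"
  shows "sqrt (\<Sum>n. (norm (a n + b n))\<^sup>2) \<le> sqrt (\<Sum>n. (norm (a n))\<^sup>2) + sqrt (\<Sum>n. (norm (b n))\<^sup>2)"
proof (rule LIMSEQ_le)
  show "(\<lambda>N. sqrt (\<Sum>n<N. (norm (a n + b n))\<^sup>2)) \<longlonglongrightarrow> sqrt (\<Sum>n. (norm (a n + b n))\<^sup>2)"
    by (intro tendsto_real_sqrt summable_LIMSEQ l2_add a b)
  show "(\<lambda>N. sqrt (\<Sum>n<N. (norm (a n))\<^sup>2) + sqrt (\<Sum>n<N. (norm (b n))\<^sup>2))
          \<longlonglongrightarrow> sqrt (\<Sum>n. (norm (a n))\<^sup>2) + sqrt (\<Sum>n. (norm (b n))\<^sup>2)"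
    by (intro tendsto_add tendsto_real_sqrt summable_LIMSEQ a b)
  have "sqrt (\<Sum>n<N. (norm (a n + b n))\<^sup>2)
          \<le> sqrt (\<Sum>n<N. (norm (a n))\<^sup>2) + sqrt (\<Sum>n<N. (norm (b n))\<^sup>2)" for N
  proof -
    have "L2_set (\<lambda>n. norm (a n + b n)) {..<N} \<le> L2_set (\<lambda>n. norm (a n) + norm (b n)) {..<N}"
      by (intro L2_set_mono norm_triangle_ineq) auto
    also have "\<dots> \<le> L2_set (\<lambda>n. norm (a n)) {..<N} + L2_set (\<lambda>n. norm (b n)) {..<N}"
      by (rule L2_set_triangle_ineq)
    finally show ?thesis by (simp add: L2_set_def)
  qed
  then show "\<exists>N0. \<forall>N\<ge>N0. sqrt (\<Sum>n<N. (norm (a n + b n))\<^sup>2)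
          \<le> sqrt (\<Sum>n<N. (norm (a n))\<^sup>2) + sqrt (\<Sum>n<N. (norm (b n))\<^sup>2)" by blast
qed

subsection \<open>Taylor coefficients\<close>

lemma taylor_coeff_add:
  assumes "f holomorphic_on ball 0 1" "g holomorphic_on ball 0 1"
  shows "taylor_coeff (\<lambda>z. f z + g z) n = taylor_coeff f n + taylor_coeff g n"
  using higher_deriv_add[OF assms, of 0 n] by (simp add: taylor_coeff_def add_divide_distrib)

lemma taylor_coeff_scale:
  assumes "f holomorphic_on ball 0 1"
  shows "taylor_coeff (\<lambda>z. c * f z) n = c * taylor_coeff f n"
  using higher_deriv_cmult[OF assms, of 0 n c] by (simp add: taylor_coeff_def)

lemma taylor_coeff_sums:
  assumes "f holomorphic_on ball 0 1" "norm z < 1"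
  shows "(\<lambda>n. taylor_coeff f n * z ^ n) sums f z"
  using holomorphic_power_series[OF assms(1), of z] assms(2) by (simp add: taylor_coeff_def)

lemma taylor_coeff_eqI:
  assumes s: "\<And>z. norm z < 1 \<Longrightarrow> (\<lambda>n. a n * z ^ n) sums f z"
  shows "f holomorphic_on ball 0 1" and "taylor_coeff f n = a n"
proof -
  show "f holomorphic_on ball 0 1"
    by (rule power_series_holomorphic[of 0 1 a]) (use s in auto)
  have "fps_conv_radius (Abs_fps a) \<ge> norm (1 / 2 :: complex)"
    unfolding fps_conv_radius_def
    by (rule conv_radius_geI) (use s[of "1 / 2"] in \<open>auto simp: sums_iff\<close>)
  then have "fps_conv_radius (Abs_fps a) > 0"
    by (rule less_le_trans[rotated]) auto
  moreover have "\<forall>\<^sub>F z in nhds 0. z \<in> ball 0 (1::real)"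
    by (rule eventually_nhds_in_open) auto
  then have "\<forall>\<^sub>F z in nhds 0. eval_fps (Abs_fps a) z = f z"
    by eventually_elim (use s in \<open>auto simp: eval_fps_def sums_iff\<close>)
  ultimately have "f has_fps_expansion Abs_fps a"
    by (simp add: has_fps_expansion_def)
  from fps_nth_fps_expansion[OF this, of n] show "taylor_coeff f n = a n"
    by (simp add: taylor_coeff_def)
qed

lemma taylor_coeff_cong:
  assumes "f holomorphic_on ball 0 1" "\<And>z. norm z < 1 \<Longrightarrow> g z = f z"
  shows "taylor_coeff g n = taylor_coeff f n"
  by (rule taylor_coeff_eqI(2)) (use assms taylor_coeff_sums[OF assms(1)] in auto)

subsection \<open>The Hilbert space\<close>

text \<open>
  \<open>H\<^sup>2\<close> consists of the holomorphic functions on the disc with square-summable Taylor coefficients,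
  with \<open>\<langle>f, g\<rangle> = (\<Sum>n. a\<^sub>n * cnj b\<^sub>n)\<close>; lemma \<open>hardy2_integral_means\<close> below is the equivalence with
  bounded integral means. Requiring \<open>f z = 0\<close> off the disc makes \<open>f\<close> determined by its restriction
  to the disc.
\<close>

typedef hardy2 = "{f :: complex \<Rightarrow> complex.
    f holomorphic_on ball 0 1 \<and> (\<forall>z. z \<notin> ball 0 1 \<longrightarrow> f z = 0) \<and>
    summable (\<lambda>n. (norm (taylor_coeff f n))\<^sup>2)}"
  morphisms hardy2_fun Abs_hardy2
proof
  show "(\<lambda>_. 0) \<in> {f :: complex \<Rightarrow> complex.
      f holomorphic_on ball 0 1 \<and> (\<forall>z. z \<notin> ball 0 1 \<longrightarrow> f z = 0) \<and>
      summable (\<lambda>n. (norm (taylor_coeff f n))\<^sup>2)}"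
    by (simp add: taylor_coeff_def)
qed

setup_lifting type_definition_hardy2

lift_definition hardy2_coeff :: "hardy2 \<Rightarrow> nat \<Rightarrow> complex" is taylor_coeff .

lemma hardy2_coeff_l2: "summable (\<lambda>n. (norm (hardy2_coeff f n))\<^sup>2)"
  by transfer auto

lemma hardy2_coeff_eqI:
  assumes "\<And>n. hardy2_coeff f n = hardy2_coeff g n"
  shows "f = g"
  using assms
proof (transfer, intro ext)
  fix f g :: "complex \<Rightarrow> complex" and z
  assume f: "f holomorphic_on ball 0 1 \<and> (\<forall>z. z \<notin> ball 0 1 \<longrightarrow> f z = 0) \<and>
      summable (\<lambda>n. (norm (taylor_coeff f n))\<^sup>2)"
    and g: "g holomorphic_on ball 0 1 \<and> (\<forall>z. z \<notin> ball 0 1 \<longrightarrow> g z = 0) \<and>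
      summable (\<lambda>n. (norm (taylor_coeff g n))\<^sup>2)"
    and eq: "\<And>n. taylor_coeff f n = taylor_coeff g n"
  show "f z = g z"
  proof (cases "norm z < 1")
    case True
    then show ?thesis
      using taylor_coeff_sums[of f z] taylor_coeff_sums[of g z] f g eq sums_unique2 by auto
  qed (use f g in auto)
qed

lemma hardy2_coeff_surj:
  assumes a: "summable (\<lambda>n. (norm (a n))\<^sup>2)"
  obtains f where "\<And>n. hardy2_coeff f n = a n"
proof -
  have sm: "summable (\<lambda>n. a n * z ^ n)" if z: "norm z < 1" for z
  proof -
    have "(\<lambda>n. (norm (a n))\<^sup>2) \<longlonglongrightarrow> 0" by (rule summable_LIMSEQ_zero[OF a])
    then have "(\<lambda>n. sqrt ((norm (a n))\<^sup>2)) \<longlonglongrightarrow> sqrt 0" by (rule tendsto_real_sqrt)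
    then have "Bseq (\<lambda>n. norm (a n))" by (intro convergent_imp_Bseq) (auto simp: convergent_def)
    then obtain K where K: "\<And>n. norm (a n) \<le> K" by (auto simp: Bseq_def)
    show ?thesis
    proof (rule summable_comparison_test')
      show "summable (\<lambda>n. K * norm z ^ n)" using z by (intro summable_mult summable_geometric) auto
      show "norm (a n * z ^ n) \<le> K * norm z ^ n" for n
        using K[of n] by (simp add: norm_mult norm_power mult_right_mono)
    qed
  qed
  define f where "f = (\<lambda>z. if norm z < 1 then \<Sum>n. a n * z ^ n else 0)"
  have s: "(\<lambda>n. a n * z ^ n) sums f z" if "norm z < 1" for z
    using sm[OF that] that by (simp add: f_def summable_sums)
  note * = taylor_coeff_eqI[of a f, OF s]
  have "hardy2_coeff (Abs_hardy2 f) n = a n" for n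
    unfolding hardy2_coeff.rep_eq
    by (subst Abs_hardy2_inverse) (use * a in \<open>auto simp: f_def\<close>)
  then show ?thesis using that by blast
qed

instantiation hardy2 :: real_normed_vector
begin

lift_definition zero_hardy2 :: hardy2 is "\<lambda>_. 0"
  by (simp add: taylor_coeff_def)

lift_definition plus_hardy2 :: "hardy2 \<Rightarrow> hardy2 \<Rightarrow> hardy2" is "\<lambda>f g z. f z + g z"
  by (auto simp: taylor_coeff_add intro!: holomorphic_intros l2_add)

lift_definition scaleR_hardy2 :: "real \<Rightarrow> hardy2 \<Rightarrow> hardy2" is "\<lambda>r f z. complex_of_real r * f z"
  by (auto simp: taylor_coeff_scale intro!: holomorphic_intros l2_scale)

definition uminus_hardy2 :: "hardy2 \<Rightarrow> hardy2" where
  "uminus_hardy2 f = (- 1) *\<^sub>R f"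

definition minus_hardy2 :: "hardy2 \<Rightarrow> hardy2 \<Rightarrow> hardy2" where
  "minus_hardy2 f g = f + - g"

definition norm_hardy2 :: "hardy2 \<Rightarrow> real" where
  "norm_hardy2 f = sqrt (\<Sum>n. (norm (hardy2_coeff f n))\<^sup>2)"

definition sgn_hardy2 :: "hardy2 \<Rightarrow> hardy2" where
  "sgn_hardy2 f = inverse (norm f) *\<^sub>R f"

definition dist_hardy2 :: "hardy2 \<Rightarrow> hardy2 \<Rightarrow> real" where
  "dist_hardy2 f g = norm (f - g)"

definition uniformity_hardy2 :: "(hardy2 \<times> hardy2) filter" where
  "uniformity_hardy2 = (INF e\<in>{0<..}. principal {(f, g). dist f g < e})"

definition open_hardy2 :: "hardy2 set \<Rightarrow> bool" where
  "open_hardy2 S \<longleftrightarrow> (\<forall>f\<in>S. \<forall>\<^sub>F (f', g) in uniformity. f' = f \<longrightarrow> g \<in> S)"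

lemma hardy2_coeff_simps:
  "hardy2_coeff 0 n = 0"
  "hardy2_coeff (f + g) n = hardy2_coeff f n + hardy2_coeff g n"
  "hardy2_coeff (r *\<^sub>R f) n = of_real r * hardy2_coeff f n"
  "hardy2_coeff (- f) n = - hardy2_coeff f n"
  "hardy2_coeff (f - g) n = hardy2_coeff f n - hardy2_coeff g n"
proof -
  show add: "hardy2_coeff (f + g) n = hardy2_coeff f n + hardy2_coeff g n" for f g
    by transfer (auto simp: taylor_coeff_add)
  show R: "hardy2_coeff (r *\<^sub>R f) n = of_real r * hardy2_coeff f n" for r f
    by transfer (auto simp: taylor_coeff_scale)
  show "hardy2_coeff 0 n = 0"
    by transfer (simp add: taylor_coeff_def)
  show "hardy2_coeff (- f) n = - hardy2_coeff f n" for f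
    by (simp add: uminus_hardy2_def R)
  then show "hardy2_coeff (f - g) n = hardy2_coeff f n - hardy2_coeff g n"
    by (simp add: minus_hardy2_def add)
qed

lemma norm_hardy2_le_iff:
  assumes "e \<ge> 0"
  shows "norm (f :: hardy2) \<le> e \<longleftrightarrow> (\<forall>N. (\<Sum>n<N. (norm (hardy2_coeff f n))\<^sup>2) \<le> e\<^sup>2)"
proof -
  have "norm f \<le> e \<longleftrightarrow> (\<Sum>n. (norm (hardy2_coeff f n))\<^sup>2) \<le> e\<^sup>2"
    unfolding norm_hardy2_def using assms by (auto intro: real_le_lsqrt suminf_nonneg hardy2_coeff_l2 dest: sqrt_le_D)
  also have "\<dots> \<longleftrightarrow> (\<forall>N. (\<Sum>n<N. (norm (hardy2_coeff f n))\<^sup>2) \<le> e\<^sup>2)"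
    using sum_le_suminf[OF hardy2_coeff_l2, of _ f] suminf_le_const[OF hardy2_coeff_l2, of f]
    by (meson finite_lessThan order_trans zero_le_power2)
  finally show ?thesis .
qed

instance
proof
  fix f g h :: hardy2 and r s :: real
  show "f + g + h = f + (g + h)" "f + g = g + f" "0 + f = f" "- f + f = 0" "f - g = f + - g"
    "r *\<^sub>R (f + g) = r *\<^sub>R f + r *\<^sub>R g" "(r + s) *\<^sub>R f = r *\<^sub>R f + s *\<^sub>R f"
    "r *\<^sub>R s *\<^sub>R f = (r * s) *\<^sub>R f" "1 *\<^sub>R f = f"
    by (rule hardy2_coeff_eqI, simp add: hardy2_coeff_simps algebra_simps)+
  show "sgn f = inverse (norm f) *\<^sub>R f" by (rule sgn_hardy2_def)
  show "dist f g = norm (f - g)" by (rule dist_hardy2_def)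
  show "(uniformity :: (hardy2 \<times> hardy2) filter) = (INF e\<in>{0<..}. principal {(x, y). dist x y < e})"
    by (rule uniformity_hardy2_def)
  show "open S \<longleftrightarrow> (\<forall>x\<in>S. \<forall>\<^sub>F (x', y) in uniformity. x' = x \<longrightarrow> y \<in> S)" for S :: "hardy2 set"
    by (rule open_hardy2_def)
  show "norm f = 0 \<longleftrightarrow> f = 0"
  proof -
    have "norm f = 0 \<longleftrightarrow> (\<forall>n. hardy2_coeff f n = 0)"
      unfolding norm_hardy2_def using suminf_eq_zero_iff[OF hardy2_coeff_l2[of f]] by simp
    also have "\<dots> \<longleftrightarrow> f = 0"
      by (metis hardy2_coeff_eqI hardy2_coeff_simps(1))
    finally show ?thesis .
  qed
  show "norm (f + g) \<le> norm f + norm g"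
    unfolding norm_hardy2_def hardy2_coeff_simps
    by (intro l2_triangle hardy2_coeff_l2)
  show "norm (r *\<^sub>R f) = \<bar>r\<bar> * norm f"
    by (simp add: norm_hardy2_def hardy2_coeff_simps norm_mult power_mult_distrib
        suminf_mult[OF hardy2_coeff_l2] real_sqrt_mult)
qed

end

instantiation hardy2 :: complex_hilbert_space
begin

lift_definition scaleC_hardy2 :: "complex \<Rightarrow> hardy2 \<Rightarrow> hardy2" is "\<lambda>c f z. c * f z"
  by (auto simp: taylor_coeff_scale intro!: holomorphic_intros l2_scale)

definition cinner_hardy2 :: "hardy2 \<Rightarrow> hardy2 \<Rightarrow> complex" where
  "cinner_hardy2 f g = (\<Sum>n. hardy2_coeff f n * cnj (hardy2_coeff g n))"

lemma hardy2_coeff_scaleC: "hardy2_coeff (c *\<^sub>C f) n = c * hardy2_coeff f n"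
  by transfer (auto simp: taylor_coeff_scale)

instance
proof
  fix f g h :: hardy2 and c d :: complex and r :: real
  show "c *\<^sub>C (f + g) = c *\<^sub>C f + c *\<^sub>C g" "(c + d) *\<^sub>C f = c *\<^sub>C f + d *\<^sub>C f"
    "c *\<^sub>C d *\<^sub>C f = (c * d) *\<^sub>C f" "complex_of_real r *\<^sub>C f = r *\<^sub>R f"
    by (rule hardy2_coeff_eqI, simp add: hardy2_coeff_simps hardy2_coeff_scaleC algebra_simps)+
  show "cinner f g = cnj (cinner g f)"
  proof -
    have "(\<lambda>n. hardy2_coeff g n * cnj (hardy2_coeff f n)) sums cinner g f"
      unfolding cinner_hardy2_def by (intro summable_sums l2_prod hardy2_coeff_l2)
    then have "(\<lambda>n. cnj (hardy2_coeff g n * cnj (hardy2_coeff f n))) sums cnj (cinner g f)"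
      by (simp only: sums_cnj)
    then show ?thesis
      unfolding cinner_hardy2_def[of f g] by (simp add: sums_iff mult.commute)
  qed
  show "cinner (f + g) h = cinner f h + cinner g h"
    unfolding cinner_hardy2_def hardy2_coeff_simps hardy2_coeff_scaleC
    by (subst suminf_add) (auto intro!: l2_prod hardy2_coeff_l2 simp: algebra_simps)
  show "cinner (c *\<^sub>C f) g = c * cinner f g"
    unfolding cinner_hardy2_def hardy2_coeff_simps hardy2_coeff_scaleC
    by (subst suminf_mult[symmetric]) (auto intro!: l2_prod hardy2_coeff_l2 simp: algebra_simps)
  show "cinner f f = complex_of_real ((norm f)\<^sup>2)"
  proof -
    have "(norm f)\<^sup>2 = (\<Sum>n. (norm (hardy2_coeff f n))\<^sup>2)"
      unfolding norm_hardy2_def by (intro real_sqrt_pow2 suminf_nonneg hardy2_coeff_l2) auto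
    then show ?thesis
      unfolding cinner_hardy2_def
      by (simp only: complex_norm_square[symmetric] suminf_of_real[OF hardy2_coeff_l2])
  qed
next
  fix X :: "nat \<Rightarrow> hardy2"
  assume "Cauchy X"
  then have cau: "\<exists>N. \<forall>k\<ge>N. \<forall>m\<ge>N. norm (X k - X m) < e" if "e > 0" for e
    using that unfolding Cauchy_def dist_norm by blast
  have coeff_le: "norm (hardy2_coeff f n) \<le> norm f" for f :: hardy2 and n
  proof -
    have "norm f \<ge> 0" by (simp add: norm_hardy2_def suminf_nonneg hardy2_coeff_l2)
    then have "(\<Sum>n<Suc n. (norm (hardy2_coeff f n))\<^sup>2) \<le> (norm f)\<^sup>2"
      using norm_hardy2_le_iff[of "norm f" f] by blast
    moreover have "(norm (hardy2_coeff f n))\<^sup>2 \<le> (\<Sum>n<Suc n. (norm (hardy2_coeff f n))\<^sup>2)"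
      by (simp add: sum_nonneg)
    ultimately show ?thesis using \<open>norm f \<ge> 0\<close> by (meson order_trans power2_le_imp_le)
  qed
  have "convergent (\<lambda>k. hardy2_coeff (X k) n)" for n
    unfolding Cauchy_convergent_iff[symmetric] Cauchy_def dist_norm
    using cau coeff_le[of "X _ - X _" n] unfolding hardy2_coeff_simps by (meson le_less_trans)
  then obtain a where a: "\<And>n. (\<lambda>k. hardy2_coeff (X k) n) \<longlonglongrightarrow> a n"
    unfolding convergent_def by metis
  have tail: "\<exists>N. \<forall>k\<ge>N. \<forall>p. (\<Sum>n<p. (norm (hardy2_coeff (X k) n - a n))\<^sup>2) \<le> e\<^sup>2" if e: "e > 0" for e
  proof -
    obtain N where N: "\<And>k m. k \<ge> N \<Longrightarrow> m \<ge> N \<Longrightarrow> norm (X k - X m) < e" using cau[OF e] by blast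
    have "(\<Sum>n<p. (norm (hardy2_coeff (X k) n - a n))\<^sup>2) \<le> e\<^sup>2" if "k \<ge> N" for k p
    proof (rule LIMSEQ_le_const2)
      show "(\<lambda>m. \<Sum>n<p. (norm (hardy2_coeff (X k) n - hardy2_coeff (X m) n))\<^sup>2)
          \<longlonglongrightarrow> (\<Sum>n<p. (norm (hardy2_coeff (X k) n - a n))\<^sup>2)"
        by (intro tendsto_intros a)
      show "\<exists>M. \<forall>m\<ge>M. (\<Sum>n<p. (norm (hardy2_coeff (X k) n - hardy2_coeff (X m) n))\<^sup>2) \<le> e\<^sup>2"
        using N[OF that] norm_hardy2_le_iff[of e "X k - X _"] \<open>e > 0\<close>
        unfolding hardy2_coeff_simps by (meson less_imp_le)
    qed
    then show ?thesis by blast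
  qed
  obtain N where N: "\<And>p. (\<Sum>n<p. (norm (hardy2_coeff (X N) n - a n))\<^sup>2) \<le> 1\<^sup>2"
    using tail[of 1] by auto
  have "summable (\<lambda>n. (norm (hardy2_coeff (X N) n - a n))\<^sup>2)"
    by (rule bounded_imp_summable[of _ "1\<^sup>2"]) (use N[of "Suc _"] in \<open>auto simp: lessThan_Suc_atMost\<close>)
  from l2_add[OF hardy2_coeff_l2[of "X N"] l2_scale[OF this, of "- 1"]]
  have "summable (\<lambda>n. (norm (a n))\<^sup>2)" by simp
  then obtain f where f: "\<And>n. hardy2_coeff f n = a n" using hardy2_coeff_surj by blast
  have "X \<longlonglongrightarrow> f"
  proof (rule metric_LIMSEQ_I)
    fix e :: real assume "e > 0"
    then obtain N where "\<forall>k\<ge>N. \<forall>p. (\<Sum>n<p. (norm (hardy2_coeff (X k) n - a n))\<^sup>2) \<le> (e / 2)\<^sup>2"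
      using tail[of "e / 2"] by auto
    then have "norm (X k - f) \<le> e / 2" if "k \<ge> N" for k
      using that \<open>e > 0\<close> by (subst norm_hardy2_le_iff) (auto simp: hardy2_coeff_simps f)
    then show "\<exists>N. \<forall>k\<ge>N. dist (X k) f < e"
      using \<open>e > 0\<close> unfolding dist_norm by (intro exI[of _ N]) force
  qed
  then show "convergent X" by (auto simp: convergent_def)
qed

end

subsection \<open>Integral means\<close>

lemma integral_cis:
  fixes k :: int
  shows "((\<lambda>\<theta>. cis (of_int k * \<theta>)) has_integral (if k = 0 then 2 * pi else 0)) {0..2 * pi}"
proof (cases "k = 0")
  case True
  then show ?thesis
    using has_integral_const_real[of "1 :: complex" 0 "2 * pi"] by (simp add: scaleR_conv_of_real)
next
  case False
  let ?F = "\<lambda>\<theta>. cis (of_int k * \<theta>) / (\<i> * of_int k)"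
  have "((\<lambda>\<theta>. cis (of_int k * \<theta>)) has_integral (?F (2 * pi) - ?F 0)) {0..2 * pi}"
  proof (rule fundamental_theorem_of_calculus)
    fix \<theta> :: real
    have "((\<lambda>z. exp (\<i> * of_int k * z) / (\<i> * of_int k)) has_field_derivative
        exp (\<i> * of_int k * of_real \<theta>)) (at (of_real \<theta>))"
      using False by (auto intro!: derivative_eq_intros)
    from has_vector_derivative_real_field[OF this]
    show "(?F has_vector_derivative cis (of_int k * \<theta>)) (at \<theta> within {0..2 * pi})"
      by (simp add: cis_conv_exp mult.assoc)
  qed simp
  moreover have "cis (of_int k * (2 * pi)) = 1"
    using cis_multiple_2pi[of "of_int k"] by (simp add: mult_ac)
  ultimately show ?thesis using False by simp
qed

lemma trig_polynomial_parseval: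
  fixes b :: "nat \<Rightarrow> complex"
  shows "((\<lambda>\<theta>. (norm (\<Sum>n<N. b n * cis (real n * \<theta>)))\<^sup>2)
      has_integral 2 * pi * (\<Sum>n<N. (norm (b n))\<^sup>2)) {0..2 * pi}"
proof -
  let ?p = "\<lambda>\<theta>. \<Sum>n<N. b n * cis (real n * \<theta>)"
  have "((\<lambda>\<theta>. \<Sum>n<N. \<Sum>m<N. (b n * cnj (b m)) * cis (of_int (int n - int m) * \<theta>)) has_integral
      (\<Sum>n<N. \<Sum>m<N. (b n * cnj (b m)) * (if int n - int m = 0 then 2 * pi else 0))) {0..2 * pi}"
    by (intro has_integral_sum has_integral_mult_right integral_cis) auto
  also have "(\<Sum>n<N. \<Sum>m<N. (b n * cnj (b m)) * (if int n - int m = 0 then 2 * pi else 0))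
      = (\<Sum>n<N. \<Sum>m<N. if n = m then 2 * pi * (b n * cnj (b m)) else 0)"
    by (intro sum.cong refl) auto
  also have "\<dots> = complex_of_real (2 * pi * (\<Sum>n<N. (norm (b n))\<^sup>2))"
    by (simp add: sum.delta' sum_distrib_left flip: complex_norm_square)
  also have "(\<lambda>\<theta>. \<Sum>n<N. \<Sum>m<N. (b n * cnj (b m)) * cis (of_int (int n - int m) * \<theta>))
      = (\<lambda>\<theta>. complex_of_real ((norm (?p \<theta>))\<^sup>2))"
  proof
    fix \<theta> :: real
    have "(\<Sum>n<N. \<Sum>m<N. (b n * cnj (b m)) * cis (of_int (int n - int m) * \<theta>))
        = (\<Sum>n<N. \<Sum>m<N. (b n * cis (real n * \<theta>)) * cnj (b m * cis (real m * \<theta>)))"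
      by (intro sum.cong refl) (simp add: cis_cnj cis_mult algebra_simps)
    also have "\<dots> = ?p \<theta> * cnj (?p \<theta>)"
      by (simp add: sum_product)
    also have "\<dots> = complex_of_real ((norm (?p \<theta>))\<^sup>2)"
      by (rule complex_norm_square[symmetric])
    finally show "(\<Sum>n<N. \<Sum>m<N. (b n * cnj (b m)) * cis (of_int (int n - int m) * \<theta>))
      = complex_of_real ((norm (?p \<theta>))\<^sup>2)" .
  qed
  finally show ?thesis
    by (drule_tac has_integral_Re) simp
qed

lemma circle_parseval:
  assumes f: "f holomorphic_on ball 0 1" and r: "0 \<le> r" "r < 1"
  shows "summable (\<lambda>n. (norm (taylor_coeff f n))\<^sup>2 * r ^ (2 * n))"
    and "((\<lambda>\<theta>. (norm (f (of_real r * cis \<theta>)))\<^sup>2)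
      has_integral 2 * pi * (\<Sum>n. (norm (taylor_coeff f n))\<^sup>2 * r ^ (2 * n))) {0..2 * pi}"
proof -
  define b where "b n = taylor_coeff f n * of_real r ^ n" for n
  define s where "s = (r + 1) / 2"
  have s: "r < s" "s < 1" using r by (auto simp: s_def field_simps)
  have "summable (\<lambda>n. taylor_coeff f n * of_real s ^ n)"
    using taylor_coeff_sums[OF f, of "of_real s"] r s by (auto simp: sums_iff)
  then have "summable (\<lambda>n. norm (taylor_coeff f n * of_real r ^ n))"
    by (rule powser_insidea) (use r s in auto)
  then have nb: "summable (\<lambda>n. norm (b n))" by (simp add: b_def)
  have b2: "(norm (b n))\<^sup>2 = (norm (taylor_coeff f n))\<^sup>2 * r ^ (2 * n)" for n
    using r by (simp add: b_def norm_mult norm_power power_mult_distrib power_mult[symmetric] mult.commute)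
  have fs: "(\<lambda>n. b n * cis (real n * \<theta>)) sums f (of_real r * cis \<theta>)" for \<theta>
  proof -
    have "(\<lambda>n. taylor_coeff f n * (of_real r * cis \<theta>) ^ n) sums f (of_real r * cis \<theta>)"
      by (rule taylor_coeff_sums[OF f]) (use r in \<open>simp add: norm_mult\<close>)
    then show ?thesis
      by (simp only: b_def power_mult_distrib Complex.DeMoivre mult.assoc)
  qed
  have u0: "uniform_limit {0..2 * pi} (\<lambda>N \<theta>. \<Sum>n<N. b n * cis (real n * \<theta>))
      (\<lambda>\<theta>. \<Sum>n. b n * cis (real n * \<theta>)) sequentially"
    by (rule Weierstrass_m_test[OF _ nb]) (simp add: norm_mult)
  then have u0: "uniform_limit {0..2 * pi} (\<lambda>N \<theta>. \<Sum>n<N. b n * cis (real n * \<theta>))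
      (\<lambda>\<theta>. f (of_real r * cis \<theta>)) sequentially"
    using fs by (simp add: sums_iff)
  have fbd: "norm (f (of_real r * cis \<theta>)) \<le> (\<Sum>n. norm (b n))" for \<theta>
    using fs[of \<theta>] summable_norm[of "\<lambda>n. b n * cis (real n * \<theta>)"] nb
    by (simp add: sums_iff norm_mult)
  have u: "uniform_limit {0..2 * pi} (\<lambda>N \<theta>. (norm (\<Sum>n<N. b n * cis (real n * \<theta>)))\<^sup>2)
      (\<lambda>\<theta>. (norm (f (of_real r * cis \<theta>)))\<^sup>2) sequentially"
    unfolding power2_eq_square
    by (intro uniform_lim_mult uniform_limit_norm u0)
      (auto intro!: boundedI[of _ "\<Sum>n. norm (b n)"] simp: fbd)
  have c: "continuous_on {0..2 * pi} (\<lambda>\<theta>. (norm (\<Sum>n<N. b n * cis (real n * \<theta>)))\<^sup>2)" for N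
    by (intro continuous_intros)
  obtain I J where I: "\<And>N. ((\<lambda>\<theta>. (norm (\<Sum>n<N. b n * cis (real n * \<theta>)))\<^sup>2) has_integral I N) {0..2 * pi}"
    and J: "((\<lambda>\<theta>. (norm (f (of_real r * cis \<theta>)))\<^sup>2) has_integral J) {0..2 * pi}" and IJ: "I \<longlonglongrightarrow> J"
    by (rule uniform_limit_integral[OF u c sequentially_bot]) (rule that, blast+)
  have "I = (\<lambda>N. 2 * pi * (\<Sum>n<N. (norm (b n))\<^sup>2))"
    using has_integral_unique[OF I trig_polynomial_parseval] by (rule ext)
  with IJ have "(\<lambda>N. 2 * pi * (\<Sum>n<N. (norm (b n))\<^sup>2) / (2 * pi)) \<longlonglongrightarrow> J / (2 * pi)"
    by (intro tendsto_divide tendsto_const) simp_all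
  then have "(\<lambda>n. (norm (b n))\<^sup>2) sums (J / (2 * pi))"
    by (simp add: sums_def)
  then show "summable (\<lambda>n. (norm (taylor_coeff f n))\<^sup>2 * r ^ (2 * n))"
    and "((\<lambda>\<theta>. (norm (f (of_real r * cis \<theta>)))\<^sup>2)
      has_integral 2 * pi * (\<Sum>n. (norm (taylor_coeff f n))\<^sup>2 * r ^ (2 * n))) {0..2 * pi}"
    using J by (auto simp: b2 sums_iff)
qed

lemma hardy2_integral_means:
  assumes f: "f holomorphic_on ball 0 1"
  shows "summable (\<lambda>n. (norm (taylor_coeff f n))\<^sup>2) \<longleftrightarrow>
    (\<exists>C. \<forall>r\<in>{0..<1}. integral {0..2 * pi} (\<lambda>\<theta>. (norm (f (of_real r * cis \<theta>)))\<^sup>2) / (2 * pi) \<le> C)"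
    (is "?S \<longleftrightarrow> (\<exists>C. \<forall>r\<in>{0..<1}. ?m r \<le> C)")
proof
  have m: "?m r = (\<Sum>n. (norm (taylor_coeff f n))\<^sup>2 * r ^ (2 * n))" if "r \<in> {0..<1}" for r
    using integral_unique[OF circle_parseval(2)[OF f, of r]] that by simp
  {
    assume S: ?S
    have "?m r \<le> (\<Sum>n. (norm (taylor_coeff f n))\<^sup>2)" if "r \<in> {0..<1}" for r
      unfolding m[OF that] using that
      by (intro suminf_le circle_parseval(1)[OF f] S mult_left_le power_le_one) auto
    then show "\<exists>C. \<forall>r\<in>{0..<1}. ?m r \<le> C" by blast
  next
    assume "\<exists>C. \<forall>r\<in>{0..<1}. ?m r \<le> C"
    then obtain C where C: "\<And>r. r \<in> {0..<1} \<Longrightarrow> ?m r \<le> C" by blast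
    have "(\<Sum>n<N. (norm (taylor_coeff f n))\<^sup>2) \<le> C" for N
    proof (rule tendsto_upperbound)
      have "((\<lambda>r. \<Sum>n<N. (norm (taylor_coeff f n))\<^sup>2 * r ^ (2 * n)) \<longlongrightarrow>
          (\<Sum>n<N. (norm (taylor_coeff f n))\<^sup>2 * 1 ^ (2 * n))) (at_left (1 :: real))"
        by (intro tendsto_intros)
      then show "((\<lambda>r. \<Sum>n<N. (norm (taylor_coeff f n))\<^sup>2 * r ^ (2 * n)) \<longlongrightarrow>
          (\<Sum>n<N. (norm (taylor_coeff f n))\<^sup>2)) (at_left (1 :: real))" by simp
      have "\<forall>\<^sub>F r in at_left (1 :: real). r \<in> {0<..<1}"
        by (rule eventually_at_left_real) simp
      then show "\<forall>\<^sub>F r in at_left (1 :: real). (\<Sum>n<N. (norm (taylor_coeff f n))\<^sup>2 * r ^ (2 * n)) \<le> C"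
      proof eventually_elim
        case (elim r)
        then have "(\<Sum>n<N. (norm (taylor_coeff f n))\<^sup>2 * r ^ (2 * n))
            \<le> (\<Sum>n. (norm (taylor_coeff f n))\<^sup>2 * r ^ (2 * n))"
          by (intro sum_le_suminf circle_parseval(1)[OF f]) auto
        with C[of r] m[of r] elim show ?case by auto
      qed
    qed auto
    then show ?S
      by (intro bounded_imp_summable[of _ C]) (simp_all only: zero_le_power2 flip: lessThan_Suc_atMost)
  }
qed

section \<open>Analytic Toeplitz operators and inner functions\<close>

definition bounded_holomorphic :: "(complex \<Rightarrow> complex) \<Rightarrow> bool" where
  "bounded_holomorphic g \<longleftrightarrow> g holomorphic_on ball 0 1 \<and> bounded (g ` ball 0 1)"

definition analytic_toeplitz :: "(complex \<Rightarrow> complex) \<Rightarrow> hardy2 \<Rightarrow> hardy2" where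
  "analytic_toeplitz g f = Abs_hardy2 (\<lambda>z. if z \<in> ball 0 1 then g z * hardy2_fun f z else 0)"

lemma analytic_toeplitz_apply:
  assumes g: "bounded_holomorphic g" and z: "z \<in> ball 0 1"
  shows "hardy2_fun (analytic_toeplitz g f) z = g z * hardy2_fun f z"
proof -
  let ?f = "hardy2_fun f"
  let ?h = "\<lambda>z. if z \<in> ball 0 1 then g z * ?f z else 0"
  have f: "?f holomorphic_on ball 0 1" "summable (\<lambda>n. (norm (taylor_coeff ?f n))\<^sup>2)"
    using hardy2_fun[of f] by auto
  obtain B where B: "\<And>z. z \<in> ball 0 1 \<Longrightarrow> norm (g z) \<le> B"
    using g unfolding bounded_holomorphic_def bounded_iff by blast
  have B0: "B \<ge> 0" using order_trans[OF norm_ge_zero B[of 0]] by simp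
  obtain C where C: "\<And>r. r \<in> {0..<1} \<Longrightarrow>
      integral {0..2 * pi} (\<lambda>\<theta>. (norm (?f (of_real r * cis \<theta>)))\<^sup>2) / (2 * pi) \<le> C"
    using f hardy2_integral_means by blast
  have h: "?h holomorphic_on ball 0 1"
    by (rule holomorphic_transform[of "\<lambda>z. g z * ?f z"])
      (use g f in \<open>auto simp: bounded_holomorphic_def intro!: holomorphic_intros\<close>)
  have "integral {0..2 * pi} (\<lambda>\<theta>. (norm (?h (of_real r * cis \<theta>)))\<^sup>2) / (2 * pi) \<le> B\<^sup>2 * C"
    if r: "r \<in> {0..<1}" for r
  proof -
    have in_ball: "of_real r * cis \<theta> \<in> ball 0 1" for \<theta> using r by (simp add: norm_mult)
    have "integral {0..2 * pi} (\<lambda>\<theta>. (norm (?h (of_real r * cis \<theta>)))\<^sup>2)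
        \<le> integral {0..2 * pi} (\<lambda>\<theta>. B\<^sup>2 * (norm (?f (of_real r * cis \<theta>)))\<^sup>2)"
    proof (rule integral_le)
      show "(\<lambda>\<theta>. (norm (?h (of_real r * cis \<theta>)))\<^sup>2) integrable_on {0..2 * pi}"
        using circle_parseval(2)[OF h, of r] r by (auto simp: integrable_on_def)
      show "(\<lambda>\<theta>. B\<^sup>2 * (norm (?f (of_real r * cis \<theta>)))\<^sup>2) integrable_on {0..2 * pi}"
        using circle_parseval(2)[OF f(1), of r] r
        by (intro integrable_on_mult_right) (auto simp: integrable_on_def)
      show "(norm (?h (of_real r * cis \<theta>)))\<^sup>2 \<le> B\<^sup>2 * (norm (?f (of_real r * cis \<theta>)))\<^sup>2" for \<theta>
        using B[OF in_ball] in_ball[of \<theta>]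
        by (auto simp: norm_mult power_mult_distrib intro!: mult_right_mono power_mono)
    qed
    also have "\<dots> = B\<^sup>2 * integral {0..2 * pi} (\<lambda>\<theta>. (norm (?f (of_real r * cis \<theta>)))\<^sup>2)"
      by simp
    also have "\<dots> / (2 * pi) \<le> B\<^sup>2 * C"
      using mult_left_mono[OF C[OF r], of "B\<^sup>2"] by simp
    finally show ?thesis by (simp add: divide_right_mono)
  qed
  then have "summable (\<lambda>n. (norm (taylor_coeff ?h n))\<^sup>2)"
    using hardy2_integral_means[OF h] by blast
  then show ?thesis
    unfolding analytic_toeplitz_def using h z by (subst Abs_hardy2_inverse) auto
qed

text \<open>Boundary values are radial limits; only values on the open disc matter.\<close>

definition inner_function :: "(complex \<Rightarrow> complex) \<Rightarrow> bool" where
  "inner_function \<phi> \<longleftrightarrow>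
     bounded_holomorphic \<phi> \<and>
     (AE \<theta> in lebesgue_on {0..2 * pi}.
        \<exists>w. ((\<lambda>r. \<phi> (of_real r * cis \<theta>)) \<longlongrightarrow> w) (at_left (1 :: real)) \<and> norm w = 1)"

definition singular_inner_function :: "(complex \<Rightarrow> complex) \<Rightarrow> bool" where
  "singular_inner_function \<phi> \<longleftrightarrow> inner_function \<phi> \<and> (\<forall>z\<in>ball 0 1. \<phi> z \<noteq> 0)"

text \<open>
  \<open>Moebius_function 0 a z = (z - a) / (1 - cnj a * z)\<close>; the empty list gives the unimodular
  constants.
\<close>

definition finite_blaschke_product :: "(complex \<Rightarrow> complex) \<Rightarrow> bool" where
  "finite_blaschke_product \<phi> \<longleftrightarrow>
     (\<exists>c as. norm c = 1 \<and> (\<forall>a\<in>set as. norm a < 1) \<and>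
        (\<forall>z\<in>ball 0 1. \<phi> z = c * (\<Prod>a\<leftarrow>as. Moebius_function 0 a z)))"

end

theory Submission
  imports Defs
begin

text \<open>
  Let \<open>T\<close> be a \<open>C\<^sub>0\<close>-dot contraction semigroup with generator \<open>A\<close>, and let
  \<open>V = (A + 1) (A - 1)\<^sup>-\<^sup>1\<close> be its cogenerator. Two facts reduce the universality of the semigroup
  of anti-analytic Toeplitz operators to a statement about single operators.

  First, \<open>V\<close> is a contraction whose powers tend strongly to \<open>0\<close>
  (\<open>cogenerator_contraction\<close>, \<open>cogenerator_power_lim\<close>). On a separable space every such
  contraction is unitarily equivalent to the restriction of the adjoint of an isometry \<open>S\<close> to an
  invariant subspace, as soon as the kernel of that adjoint is infinite-dimensional: writing
  \<open>\<parallel>x\<parallel>\<^sup>2 - \<parallel>V x\<parallel>\<^sup>2 = \<parallel>L x\<parallel>\<^sup>2\<close> with \<open>L\<close> mapping into that kernel, the map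
  \<open>W x = (\<Sum>n. S\<^sup>n L V\<^sup>n x)\<close> is isometric and intertwines \<open>V\<close> with the adjoint of \<open>S\<close>
  (\<open>contraction_model\<close>).

  Second, for an inner function \<open>\<phi>\<close> multiplication by \<open>\<phi>\<close> is an isometry of the Hardy space
  (\<open>norm_toeplitz_inner\<close>), and the kernel of its adjoint contains all backward shifts of \<open>\<phi>\<close>. A linear
  relation between these shifts is a recurrence for the Taylor coefficients of \<open>\<phi>\<close>, hence makes \<open>\<phi>\<close>
  rational, and a rational inner function is a finite Blaschke product
  (\<open>rational_inner_function_imp_blaschke\<close>). So the kernel is infinite-dimensional unless \<open>\<phi>\<close> is a
  finite Blaschke product (\<open>toeplitz_adjoint_kernel_infinite\<close>).

  The adjoint of multiplication by \<open>\<phi>\<close> is the cogenerator of the semigroup with symbols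
  \<open>exp (t (\<phi> + 1) / (\<phi> - 1))\<close>, because the Cayley transform is an involution. A map that intertwines
  two cogenerators intertwines the semigroups (\<open>intertwining\<close>), so the range of \<open>W\<close> is the subspace
  sought. The unbounded generator never appears: the cogenerator is \<open>1 - 2 R\<close> with
  \<open>R = (\<integral>s\<ge>0. exp (- s) T(s))\<close>, and the generator equation takes the form
  \<open>(R T(t) x)' = R T(t) x - T(t) x\<close>.

  For the second claim, if \<open>exp \<psi>\<close> is inner then \<open>Re \<psi> \<le> 0\<close>, and the radial limits of \<open>exp \<psi>\<close> lift to
  radial limits of \<open>\<psi>\<close> since \<open>exp\<close> is a covering map. They are purely imaginary, so the Cayley transform
  \<open>\<phi>\<close> of \<open>\<psi>\<close> is inner, and \<open>\<psi>\<close> is in turn the Cayley transform of \<open>\<phi>\<close>.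
\<close>

section \<open>Geometry of complex Hilbert spaces\<close>

lemma scaleC_minus1: "(- 1) *\<^sub>C x = - (x :: 'a::complex_hilbert_space)"
  using complex_space.scale_minus_left[of 1 x] by simp

lemma cinner_add_right: "cinner x (y + z) = cinner x y + cinner x z"
  by (metis cinner_add_left cinner_commute complex_cnj_add)

lemma cinner_scaleC_right: "cinner x (c *\<^sub>C y) = cnj c * cinner x y"
  by (metis cinner_commute cinner_scaleC_left complex_cnj_mult)

lemma cinner_zero_left [simp]: "cinner 0 y = 0"
  using cinner_scaleC_left[of 0 0 y] by simp

lemma cinner_zero_right [simp]: "cinner x 0 = 0"
  by (metis cinner_zero_left cinner_commute complex_cnj_zero)

lemma cinner_minus_left: "cinner (- x) y = - cinner x y"
  using cinner_scaleC_left[of "-1" x y] by (simp add: scaleC_minus1)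

lemma cinner_minus_right: "cinner x (- y) = - cinner x y"
  using cinner_scaleC_right[of x "-1" y] by (simp add: scaleC_minus1)

lemma cinner_diff_left: "cinner (x - y) z = cinner x z - cinner y z"
  by (simp only: diff_conv_add_uminus cinner_add_left cinner_minus_left)

lemma cinner_diff_right: "cinner x (y - z) = cinner x y - cinner x z"
  by (simp only: diff_conv_add_uminus cinner_add_right cinner_minus_right)

lemma cinner_scaleR_left: "cinner (r *\<^sub>R x) y = of_real r * cinner x y"
  using cinner_scaleC_left[of "of_real r" x y] by (simp add: scaleC_of_real)

lemma cinner_scaleR_right: "cinner x (r *\<^sub>R y) = of_real r * cinner x y"
  using cinner_scaleC_right[of x "of_real r" y] by (simp add: scaleC_of_real)

lemma cinner_sum_left: "cinner (\<Sum>i\<in>F. u i) y = (\<Sum>i\<in>F. cinner (u i) y)"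
  by (induction F rule: infinite_finite_induct) (auto simp: cinner_add_left)

lemma cinner_sum_right: "cinner x (\<Sum>i\<in>F. u i) = (\<Sum>i\<in>F. cinner x (u i))"
  by (induction F rule: infinite_finite_induct) (auto simp: cinner_add_right)

lemmas cinner_simps = cinner_add_left cinner_add_right cinner_diff_left cinner_diff_right
  cinner_scaleC_left cinner_scaleC_right cinner_scaleR_left cinner_scaleR_right

lemma Re_cinner_commute: "Re (cinner x y) = Re (cinner y x)"
  by (metis cinner_commute cnj.simps(1))

lemma norm_sq_cinner: "(norm x)\<^sup>2 = Re (cinner x x)"
  by (simp add: cinner_self)

lemma norm_diff_sq:
  "(norm (x - y))\<^sup>2 = (norm x)\<^sup>2 - 2 * Re (cinner x y) + (norm (y :: 'a::complex_hilbert_space))\<^sup>2"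
  by (simp add: norm_sq_cinner cinner_simps Re_cinner_commute[of y x])

lemma cinner_eq_0_imp_0: "(\<And>y. cinner y x = 0) \<Longrightarrow> x = 0"
  using cinner_self[of x] by simp

text \<open>
  Definiteness would be too much to ask: the form of interest is \<open>\<langle>x, y\<rangle> - \<langle>V x, V y\<rangle>\<close> for a
  contraction \<open>V\<close>, whose quadratic form vanishes where \<open>V\<close> preserves the norm.
\<close>
definition psd_form :: "('a::complex_hilbert_space \<Rightarrow> 'a \<Rightarrow> complex) \<Rightarrow> bool" where
  "psd_form B \<longleftrightarrow> (\<forall>x y z. B (x + y) z = B x z + B y z) \<and> (\<forall>c x y. B (c *\<^sub>C x) y = c * B x y) \<and>
     (\<forall>x y. B x y = cnj (B y x)) \<and> (\<forall>x. 0 \<le> Re (B x x))"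

lemma psd_formD:
  assumes "psd_form B"
  shows "B (x + y) z = B x z + B y z" "B (c *\<^sub>C x) y = c * B x y" "B x y = cnj (B y x)"
    "0 \<le> Re (B x x)" "B x (y + z) = B x y + B x z" "B x (c *\<^sub>C y) = cnj c * B x y"
    "B (x - y) z = B x z - B y z" "B x (y - z) = B x y - B x z" "B x x = of_real (Re (B x x))"
proof -
  show a: "B (x + y) z = B x z + B y z" for x y z using assms unfolding psd_form_def by blast
  show s: "B (c *\<^sub>C x) y = c * B x y" for c x y using assms unfolding psd_form_def by blast
  show h: "B x y = cnj (B y x)" for x y using assms unfolding psd_form_def by blast
  show "0 \<le> Re (B x x)" using assms unfolding psd_form_def by blast
  show a2: "B x (y + z) = B x y + B x z" for x y z
    by (metis a h complex_cnj_add)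
  show s2: "B x (c *\<^sub>C y) = cnj c * B x y" for c x y
    by (metis s h complex_cnj_mult)
  have "B (- y) z = - B y z" for y z using s[of "-1" y z] by (simp add: scaleC_minus1)
  then show "B (x - y) z = B x z - B y z" by (simp only: diff_conv_add_uminus a)
  have "B z (- y) = - B z y" for y z using s2[of z "-1" y] by (simp add: scaleC_minus1)
  then show "B x (y - z) = B x y - B x z" by (simp only: diff_conv_add_uminus a2)
  show "B x x = of_real (Re (B x x))" using h[of x x] by (simp add: complex_eq_iff)
qed

lemma psd_form_cinner: "psd_form cinner"
  unfolding psd_form_def norm_sq_cinner[symmetric]
  by (intro conjI allI cinner_add_left cinner_scaleC_left cinner_commute zero_le_power2)

lemma psd_form_Cauchy_Schwarz:
  assumes B: "psd_form B"
  shows "(cmod (B x y))\<^sup>2 \<le> Re (B x x) * Re (B y y)"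
proof -
  note D = psd_formD[OF B]
  \<comment> \<open>Positivity at \<open>x - c y\<close>; the optimal \<open>c\<close> is \<open>B x y / B y y\<close>, and if \<open>B y y = 0\<close> then \<open>c\<close> may be large.\<close>
  have q: "0 \<le> Re (B x x) - 2 * Re (cnj c * B x y) + (cmod c)\<^sup>2 * Re (B y y)" for c
  proof -
    have "Re (B (x - c *\<^sub>C y) (x - c *\<^sub>C y))
        = Re (B x x) - Re (cnj c * B x y) - Re (c * B y x) + Re (c * cnj c * B y y)"
      by (simp add: D(2,6,7,8) algebra_simps)
    also have "Re (c * B y x) = Re (cnj c * B x y)"
      by (subst D(3)) simp
    also have "Re (c * cnj c * B y y) = (cmod c)\<^sup>2 * Re (B y y)"
      by (subst D(9)) (simp add: complex_mult_cnj cmod_power2)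
    finally show ?thesis using D(4)[of "x - c *\<^sub>C y"] by simp
  qed
  have c: "Re (cnj (of_real t * B x y) * B x y) = t * (cmod (B x y))\<^sup>2" for t
    by (simp add: cmod_power2 algebra_simps) (simp add: power2_eq_square)
  show ?thesis
  proof (cases "Re (B y y) = 0")
    case False
    then have p: "Re (B y y) > 0" using D(4)[of y] by simp
    have "0 \<le> Re (B x x) - (cmod (B x y))\<^sup>2 / Re (B y y)"
      using q[of "of_real (1 / Re (B y y)) * B x y"] p unfolding c
      by (simp add: norm_mult norm_divide power_mult_distrib power_divide power2_eq_square field_simps)
    with p show ?thesis by (simp add: field_simps)
  next
    case True
    have "B x y = 0"
    proof (rule ccontr)
      assume "B x y \<noteq> 0"
      then have "(cmod (B x y))\<^sup>2 > 0" by simp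
      then show False
        using q[of "of_real ((Re (B x x) + 1) / (cmod (B x y))\<^sup>2) * B x y"] True D(4)[of x] unfolding c
        by simp
    qed
    then show ?thesis using True by simp
  qed
qed

lemma cinner_Cauchy_Schwarz: "cmod (cinner x y) \<le> norm x * norm y"
proof (rule power2_le_imp_le)
  show "(cmod (cinner x y))\<^sup>2 \<le> (norm x * norm y)\<^sup>2"
    using psd_form_Cauchy_Schwarz[OF psd_form_cinner, of x y]
    by (simp only: norm_sq_cinner power_mult_distrib)
qed simp

lemma bounded_bilinear_cinner: "bounded_bilinear (cinner :: 'a::complex_hilbert_space \<Rightarrow> _)"
proof
  show "\<exists>K. \<forall>x y :: 'a. norm (cinner x y) \<le> norm x * norm y * K"
    using cinner_Cauchy_Schwarz by (intro exI[of _ 1] allI) simp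
qed (simp_all add: cinner_simps scaleR_conv_of_real)

lemma norm_scaleC: "norm (c *\<^sub>C (x :: 'a::complex_hilbert_space)) = cmod c * norm x"
proof (rule power2_eq_imp_eq)
  have "cinner (c *\<^sub>C x) (c *\<^sub>C x) = (c * cnj c) * cinner x x"
    by (simp only: cinner_scaleC_left cinner_scaleC_right mult_ac)
  also have "\<dots> = complex_of_real ((cmod c * norm x)\<^sup>2)"
    by (simp only: cinner_self complex_norm_square[symmetric] power_mult_distrib of_real_mult)
  finally show "(norm (c *\<^sub>C x))\<^sup>2 = (cmod c * norm x)\<^sup>2"
    by (simp only: norm_sq_cinner Re_complex_of_real)
qed auto

lemma bounded_linear_scaleC: "bounded_linear (\<lambda>x :: 'a::complex_hilbert_space. c *\<^sub>C x)"
proof (rule bounded_linear_intro[of _ "cmod c"])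
  show "c *\<^sub>C (r *\<^sub>R x) = r *\<^sub>R (c *\<^sub>C x)" for r and x :: 'a
    by (simp only: scaleC_of_real[symmetric] scaleC_scaleC mult.commute)
qed (simp_all add: scaleC_add_right norm_scaleC)

lemma norm_sum_orthogonal_sq:
  fixes u :: "'i \<Rightarrow> 'a::complex_hilbert_space"
  assumes o: "\<And>m n. m \<noteq> n \<Longrightarrow> cinner (u m) (u n) = 0" and F: "finite F"
  shows "(norm (\<Sum>i\<in>F. u i))\<^sup>2 = (\<Sum>i\<in>F. (norm (u i))\<^sup>2)"
  using F
proof (induction F rule: finite_induct)
  case (insert i F)
  have "cinner (u i) (\<Sum>i\<in>F. u i) = 0"
    unfolding cinner_sum_right by (intro sum.neutral ballI o) (use insert in auto)
  then have "(norm (u i + (\<Sum>i\<in>F. u i)))\<^sup>2 = (norm (u i))\<^sup>2 + (norm (\<Sum>i\<in>F. u i))\<^sup>2"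
    by (simp add: norm_sq_cinner cinner_simps Re_cinner_commute[of "\<Sum>i\<in>F. u i" "u i"])
  with insert show ?case by simp
qed simp

lemma orthogonal_series:
  fixes u :: "nat \<Rightarrow> 'a::complex_hilbert_space"
  assumes o: "\<And>m n. m \<noteq> n \<Longrightarrow> cinner (u m) (u n) = 0" and s: "(\<lambda>n. (norm (u n))\<^sup>2) sums s"
  shows "summable u" "(norm (suminf u))\<^sup>2 = s"
proof -
  show sm: "summable u"
    unfolding summable_Cauchy
  proof (intro allI impI)
    fix e :: real assume e: "e > 0"
    have "summable (\<lambda>n. (norm (u n))\<^sup>2)" using s by (simp add: sums_iff)
    then obtain N where N: "\<And>m n. m \<ge> N \<Longrightarrow> norm (\<Sum>n\<in>{m..<n}. (norm (u n))\<^sup>2) < e\<^sup>2"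
      using e unfolding summable_Cauchy by (metis zero_less_power)
    have "norm (sum u {m..<n}) < e" if "m \<ge> N" for m n
    proof (rule power2_less_imp_less)
      show "(norm (sum u {m..<n}))\<^sup>2 < e\<^sup>2"
        using N[OF that, of n] by (simp add: norm_sum_orthogonal_sq[OF o])
    qed (use e in simp)
    then show "\<exists>N. \<forall>m\<ge>N. \<forall>n. norm (sum u {m..<n}) < e" by blast
  qed
  have "(\<lambda>N. (norm (sum u {..<N}))\<^sup>2) \<longlonglongrightarrow> (norm (suminf u))\<^sup>2"
    by (intro tendsto_intros summable_LIMSEQ sm)
  moreover have "(\<lambda>N. (norm (sum u {..<N}))\<^sup>2) \<longlonglongrightarrow> s"
    using s by (simp add: norm_sum_orthogonal_sq[OF o] sums_def)
  ultimately show "(norm (suminf u))\<^sup>2 = s" by (rule LIMSEQ_unique)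
qed

fun gram_schmidt :: "(nat \<Rightarrow> 'a::complex_hilbert_space) \<Rightarrow> nat \<Rightarrow> 'a" where
  "gram_schmidt s n = (let v = s n - (\<Sum>k<n. cinner (s n) (gram_schmidt s k) *\<^sub>C gram_schmidt s k)
     in v /\<^sub>R norm v)"

declare gram_schmidt.simps [simp del]

lemma gram_schmidt_orthonormal:
  assumes s: "\<And>n. s n \<notin> complex_space.span (s ` {..<n})"
  shows "gram_schmidt s n \<in> complex_space.span (s ` {..n})"
    and "cinner (gram_schmidt s m) (gram_schmidt s n) = (if m = n then 1 else 0)"
proof -
  let ?g = "gram_schmidt s"
  let ?v = "\<lambda>n. s n - (\<Sum>k<n. cinner (s n) (?g k) *\<^sub>C ?g k)"
  have g: "?g n = complex_of_real (inverse (norm (?v n))) *\<^sub>C ?v n" for n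
    by (subst gram_schmidt.simps) (simp add: scaleC_of_real Let_def del: of_real_inverse)
  have sp: "?g n \<in> complex_space.span (s ` {..n})" for n
  proof (induction n rule: less_induct)
    case (less n)
    have "?g k \<in> complex_space.span (s ` {..n})" if "k < n" for k
    proof -
      have "s ` {..k} \<subseteq> s ` {..n}" using that by auto
      then show ?thesis using less[OF that] complex_space.span_mono by blast
    qed
    moreover have "s n \<in> complex_space.span (s ` {..n})" by (simp add: complex_space.span_base)
    ultimately have "?v n \<in> complex_space.span (s ` {..n})"
      by (blast intro: complex_space.span_scale complex_space.span_diff complex_space.span_sum)
    then show ?case
      unfolding g[of n] by (rule complex_space.span_scale)
  qed
  then show "?g n \<in> complex_space.span (s ` {..n})" .
  have v0: "?v n \<noteq> 0" for n
  proof
    assume "?v n = 0"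
    then have "s n = (\<Sum>k<n. cinner (s n) (?g k) *\<^sub>C ?g k)" by simp
    moreover have "(\<Sum>k<n. cinner (s n) (?g k) *\<^sub>C ?g k) \<in> complex_space.span (s ` {..<n})"
    proof (intro complex_space.span_sum complex_space.span_scale)
      fix k assume "k \<in> {..<n}"
      then have "s ` {..k} \<subseteq> s ` {..<n}" by auto
      then show "?g k \<in> complex_space.span (s ` {..<n})"
        using sp[of k] complex_space.span_mono by blast
    qed
    ultimately show False using s[of n] by simp
  qed
  have on: "cinner (?g n) (?g n) = 1" for n
  proof -
    have "norm (?g n) = 1" using v0[of n] by (subst gram_schmidt.simps) (simp add: Let_def)
    then show ?thesis by (simp add: cinner_self)
  qed
  have og: "\<forall>m<n. cinner (?g n) (?g m) = 0" for n
  proof (induction n rule: less_induct)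
    case (less n)
    have z: "cinner (?g k) (?g m) = (if k = m then 1 else 0)" if "k < n" "m < n" for k m
    proof (cases k m rule: linorder_cases)
      case less' : less
      then have "cinner (?g m) (?g k) = 0" using less that by blast
      then show ?thesis using less' by (subst cinner_commute) simp
    next
      case greater
      then show ?thesis using less that by auto
    qed (simp add: on)
    show ?case
    proof (intro allI impI)
      fix m assume m: "m < n"
      have "cinner (?v n) (?g m) = cinner (s n) (?g m)
          - (\<Sum>k<n. cinner (s n) (?g k) * (if k = m then 1 else 0))"
        using m by (simp add: cinner_simps cinner_sum_left z)
      also have "(\<Sum>k<n. cinner (s n) (?g k) * (if k = m then 1 else 0)) = cinner (s n) (?g m)"
        using m by (simp add: if_distrib[of "\<lambda>t. _ * t"] sum.delta cong: if_cong)
      finally have "cinner (?v n) (?g m) = 0" by simp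
      then show "cinner (?g n) (?g m) = 0" by (simp only: g[of n] cinner_scaleC_left) simp
    qed
  qed
  show "cinner (?g m) (?g n) = (if m = n then 1 else 0)"
  proof (cases m n rule: linorder_cases)
    case less
    then show ?thesis using og[of n] by (subst cinner_commute) simp
  next
    case greater
    then show ?thesis using og by simp
  qed (simp add: on)
qed

section \<open>Positive semidefinite forms as sums of squares\<close>

definition pivot :: "('a::complex_hilbert_space \<Rightarrow> 'a \<Rightarrow> complex) \<Rightarrow> 'a \<Rightarrow> 'a \<Rightarrow> complex" where
  "pivot B d x = B x d / complex_of_real (sqrt (Re (B d d)))"

text \<open>
  Cholesky elimination: step \<open>k\<close> subtracts the rank-one form that removes the vector \<open>d k\<close>. If \<open>d k\<close> is
  already isotropic, division by zero makes the pivot \<open>0\<close> and the step changes nothing.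
\<close>
primrec schur_complement ::
    "(nat \<Rightarrow> 'a) \<Rightarrow> ('a::complex_hilbert_space \<Rightarrow> 'a \<Rightarrow> complex) \<Rightarrow> nat \<Rightarrow> 'a \<Rightarrow> 'a \<Rightarrow> complex" where
  "schur_complement d B 0 = B"
| "schur_complement d B (Suc k) = (\<lambda>x y. schur_complement d B k x y -
      pivot (schur_complement d B k) (d k) x * cnj (pivot (schur_complement d B k) (d k) y))"

lemma cmod_pivot_sq:
  assumes "psd_form B"
  shows "(cmod (pivot B d x))\<^sup>2 = (cmod (B x d))\<^sup>2 / Re (B d d)"
  using psd_formD(4)[OF assms, of d] by (simp add: pivot_def norm_divide power_divide)

lemma psd_form_schur_complement:
  assumes "psd_form B"
  shows "psd_form (schur_complement d B k)"
proof (induction k)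
  case (Suc k)
  let ?B = "schur_complement d B k"
  note D = psd_formD[OF Suc]
  have p: "pivot ?B (d k) (x + y) = pivot ?B (d k) x + pivot ?B (d k) y"
    "pivot ?B (d k) (c *\<^sub>C x) = c * pivot ?B (d k) x" for x y c
    by (simp_all add: pivot_def D(1,2) add_divide_distrib)
  show ?case
    unfolding psd_form_def schur_complement.simps p
  proof (intro conjI allI)
    fix x y
    show "?B x y - pivot ?B (d k) x * cnj (pivot ?B (d k) y) =
      cnj (?B y x - pivot ?B (d k) y * cnj (pivot ?B (d k) x))"
      using D(3)[of x y] by simp
  next
    fix x
    have "Re (pivot ?B (d k) x * cnj (pivot ?B (d k) x)) = (cmod (pivot ?B (d k) x))\<^sup>2"
      by (simp add: complex_mult_cnj cmod_power2)
    also have "\<dots> \<le> Re (?B x x)"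
      using psd_form_Cauchy_Schwarz[OF Suc, of x "d k"] D(4)[of "d k"] D(4)[of x]
      by (cases "Re (?B (d k) (d k)) = 0") (auto simp: cmod_pivot_sq[OF Suc] field_simps)
    finally show "0 \<le> Re (?B x x - pivot ?B (d k) x * cnj (pivot ?B (d k) x))" by simp
  qed (simp_all add: D(1,2) algebra_simps)
qed (simp add: assms)

text \<open>
  Eliminate along a dense sequence. After step \<open>k\<close> the remaining form vanishes at the \<open>k\<close>-th vector, and
  it only decreases afterwards; being bounded by the norm, it tends to \<open>0\<close> at every vector. This
  replaces the square root of a positive operator followed by an expansion in an orthonormal basis.
\<close>
lemma psd_form_sum_of_squares:
  fixes B :: "'a::complex_hilbert_space \<Rightarrow> 'a \<Rightarrow> complex"
  assumes B: "psd_form B" and le: "\<And>x. Re (B x x) \<le> (norm x)\<^sup>2"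
    and sep: "separable_space (euclidean :: 'a topology)"
  obtains D :: "nat \<Rightarrow> 'a \<Rightarrow> complex" where
    "\<And>k x y. D k (x + y) = D k x + D k y" "\<And>k c x. D k (c *\<^sub>C x) = c * D k x"
    "\<And>x. (\<lambda>k. (cmod (D k x))\<^sup>2) sums Re (B x x)"
proof -
  obtain C :: "'a set" where C: "countable C" "closure C = UNIV"
    using sep by (auto simp: separable_space_def)
  then have "C \<noteq> {}" by auto
  define d where "d = from_nat_into C"
  let ?B = "schur_complement d B"
  define D where "D k = pivot (?B k) (d k)" for k
  note psd = psd_form_schur_complement[OF B, of d]
  note F = psd_formD[OF psd]
  have step: "Re (?B (Suc k) x x) = Re (?B k x x) - (cmod (D k x))\<^sup>2" for k x
    by (simp add: D_def complex_mult_cnj cmod_power2)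
  have tele: "(\<Sum>k<n. (cmod (D k x))\<^sup>2) = Re (B x x) - Re (?B n x x)" for n x
    by (induction n) (simp_all only: step sum.lessThan_Suc schur_complement.simps(1), simp_all)
  have anti: "Re (?B n x x) \<le> Re (?B m x x)" if "m \<le> n" for m n x
    using that by (induction n rule: dec_induct) (simp_all only: step, smt (verit) zero_le_power2)
  have kill: "Re (?B (Suc k) (d k) (d k)) = 0" for k
    unfolding step D_def cmod_pivot_sq[OF psd]
    by (subst (2) F(9)) (simp add: power2_eq_square)
  have lim: "(\<lambda>n. Re (?B n x x)) \<longlonglongrightarrow> 0" for x
  proof (rule LIMSEQ_I)
    fix e :: real assume e: "e > 0"
    define r where "r = sqrt (e / 4)"
    have r: "r > 0" "r\<^sup>2 = e / 4" using e by (auto simp: r_def)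
    have "x \<in> closure C" using C by simp
    then obtain y where y: "y \<in> C" "dist y x < r"
      using r unfolding closure_approachable by blast
    then obtain j where j: "d j = y"
      unfolding d_def using C \<open>C \<noteq> {}\<close> by (metis from_nat_into_surj)
    have "norm (Re (?B n x x) - 0) < e" if n: "n \<ge> Suc j" for n
    proof -
      have "Re (?B n x x) \<le> 2 * Re (?B n (x - y) (x - y)) + 2 * Re (?B n y y)"
        using F(4)[of n "x - y - y"] F(4)[of n "x - y + y"] by (simp add: F(1,5,7,8))
      also have "Re (?B n y y) \<le> 0"
        using anti[OF n, of y] kill[of j] j by simp
      also have "Re (?B n (x - y) (x - y)) \<le> (norm (x - y))\<^sup>2"
        using anti[of 0 n "x - y"] le[of "x - y"] by simp
      also have "(norm (x - y))\<^sup>2 \<le> r\<^sup>2"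
        using y by (intro power_mono) (auto simp: dist_norm norm_minus_commute)
      finally show ?thesis using r e F(4)[of n x] by simp
    qed
    then show "\<exists>N. \<forall>n\<ge>N. norm (Re (?B n x x) - 0) < e" by blast
  qed
  show ?thesis
  proof (rule that[of D])
    show "(\<lambda>k. (cmod (D k x))\<^sup>2) sums Re (B x x)" for x
      unfolding sums_def tele using tendsto_diff[OF tendsto_const lim, of "Re (B x x)"] by simp
  qed (simp_all only: D_def pivot_def F(1,2) add_divide_distrib times_divide_eq_right)
qed

section \<open>Contraction semigroups and their cogenerators\<close>

lemma bounded_clinearD:
  assumes "bounded_clinear A"
  shows "bounded_linear A" "A (x + y) = A x + A y" "A (x - y) = A x - A y" "A (c *\<^sub>C x) = c *\<^sub>C A x"
    "A (r *\<^sub>R x) = r *\<^sub>R A x" "A 0 = 0"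
  using assms linear_add linear_diff linear_scale linear_0 bounded_linear.linear
  unfolding bounded_clinear_def by blast+

lemma bounded_clinearI:
  assumes "\<And>x y. A (x + y) = A x + A y" "\<And>c x. A (c *\<^sub>C x) = c *\<^sub>C A x"
    "\<And>x. norm (A x) \<le> K * norm x"
  shows "bounded_clinear A"
  unfolding bounded_clinear_def
proof
  show "bounded_linear A"
  proof (rule bounded_linear_intro[of _ K])
    show "A (r *\<^sub>R x) = r *\<^sub>R A x" for r x
      using assms(2)[of "of_real r" x] by (simp add: scaleC_of_real)
  qed (use assms in \<open>simp_all add: mult.commute\<close>)
qed (use assms in simp)

lemma bounded_clinear_compose:
  assumes "bounded_clinear A" "bounded_clinear B"
  shows "bounded_clinear (\<lambda>x. A (B x))"
  using assms unfolding bounded_clinear_def by (auto intro: bounded_linear_compose)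

lemma bounded_clinear_ident: "bounded_clinear (\<lambda>x. x)"
  by (rule bounded_clinearI[of _ 1]) auto

locale c0dot_semigroup =
  fixes T :: "real \<Rightarrow> 'a \<Rightarrow> 'a::complex_hilbert_space"
  assumes semigroup: "C0dot_contraction_semigroup T"
begin

lemma clinear: "t \<ge> 0 \<Longrightarrow> bounded_clinear (T t)"
  and T_0: "T 0 x = x"
  and T_add: "s \<ge> 0 \<Longrightarrow> t \<ge> 0 \<Longrightarrow> T (s + t) x = T s (T t x)"
  and cont: "continuous_on {0..} (\<lambda>t. T t x)"
  and contraction: "t \<ge> 0 \<Longrightarrow> norm (T t x) \<le> norm x"
  and stable: "((\<lambda>t. norm (T t x)) \<longlongrightarrow> 0) at_top"
  using semigroup unfolding C0dot_contraction_semigroup_def operator_semigroup_def by auto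

lemmas linear = bounded_clinearD[OF clinear]

text \<open>
  The substitution \<open>u = exp (- s)\<close> turns \<open>\<integral>s\<ge>0. exp (- s) T(s) x\<close> into the integral of \<open>T(- ln u) x\<close> over
  \<open>{0..1}\<close>. By stability the integrand is continuous up to \<open>u = 0\<close>, with value \<open>0\<close> there, so no improper
  integral is needed.
\<close>
definition orbit :: "'a \<Rightarrow> real \<Rightarrow> 'a" where
  "orbit x u = (if u \<le> 0 then 0 else T (- ln u) x)"

definition resolvent :: "'a \<Rightarrow> 'a" where
  "resolvent x = integral {0..1} (orbit x)"

lemma continuous_on_orbit: "continuous_on {0..1} (orbit x)"
  unfolding continuous_on_eq_continuous_within
proof
  fix u :: real assume u: "u \<in> {0..1}"
  show "continuous (at u within {0..1}) (orbit x)"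
  proof (cases "u = 0")
    case True
    have "((\<lambda>u. T (- ln u) x) \<longlongrightarrow> 0) (at_right 0)"
    proof (rule tendsto_norm_zero_cancel)
      have "filterlim (\<lambda>u. - ln u) at_top (at_right (0::real))"
        by (simp add: filterlim_uminus_at_top ln_at_0)
      from filterlim_compose[OF stable this]
      show "((\<lambda>u. norm (T (- ln u) x)) \<longlongrightarrow> 0) (at_right 0)" .
    qed
    moreover have "\<forall>\<^sub>F u in at_right (0::real). T (- ln u) x = orbit x u"
      by (auto simp: orbit_def eventually_at_filter)
    ultimately have "(orbit x \<longlongrightarrow> 0) (at_right 0)" by (rule Lim_transform_eventually)
    then show ?thesis
      unfolding continuous_within True by (simp add: orbit_def at_within_Icc_at_right)
  next
    case False
    with u have u: "u \<in> {0<..1}" by auto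
    have "continuous_on {0<..1} (\<lambda>u. T (- ln u) x)"
      by (rule continuous_on_compose2[OF cont]) (auto intro!: continuous_intros)
    then have "continuous_on {0<..1} (orbit x)"
      by (rule continuous_on_eq) (auto simp: orbit_def)
    then have "continuous (at u within {0<..1}) (orbit x)"
      using u by (simp add: continuous_on_eq_continuous_within)
    moreover have "at u within {0<..1} = at u within {0..1}"
      using u by (intro at_within_nhd[of _ "{0<..}"]) auto
    ultimately show ?thesis by (simp add: continuous_within)
  qed
qed

lemma orbit_integrable: "0 \<le> b \<Longrightarrow> b \<le> 1 \<Longrightarrow> orbit x integrable_on {0..b}"
  by (rule integrable_continuous_real, rule continuous_on_subset[OF continuous_on_orbit]) auto

lemma resolvent_contraction: "norm (resolvent x) \<le> norm x"
proof -
  have "norm (orbit x u) \<le> norm x" if "u \<in> {0..1}" for u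
    using that contraction[of "- ln u" x] by (auto simp: orbit_def)
  then show ?thesis
    using integral_bound[OF zero_le_one continuous_on_orbit[of x]] unfolding resolvent_def by fastforce
qed

lemma clinear_resolvent: "bounded_clinear resolvent"
proof (rule bounded_clinearI[of _ 1])
  note i = orbit_integrable[OF zero_le_one order_refl]
  have orb: "orbit (x + y) u = orbit x u + orbit y u" "orbit (c *\<^sub>C x) u = c *\<^sub>C orbit x u"
    if "u \<in> {0..1}" for x y c u
    using that by (auto simp: orbit_def linear)
  show "resolvent (x + y) = resolvent x + resolvent y" for x y
    unfolding resolvent_def using i
    by (subst integral_add[symmetric]) (auto intro!: integral_cong orb)
  show "resolvent (c *\<^sub>C x) = c *\<^sub>C resolvent x" for c x
  proof -
    have "resolvent (c *\<^sub>C x) = integral {0..1} (\<lambda>u. c *\<^sub>C orbit x u)"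
      unfolding resolvent_def by (rule integral_cong) (rule orb)
    also have "\<dots> = c *\<^sub>C resolvent x"
      unfolding resolvent_def using integral_linear[OF i[of x] bounded_linear_scaleC[of c]]
      by (simp only: o_def)
    finally show ?thesis .
  qed
  show "norm (resolvent x) \<le> 1 * norm x" for x
    using resolvent_contraction by simp
qed

lemmas resolvent_linear = bounded_clinearD[OF clinear_resolvent]

lemma T_commute: "s \<ge> 0 \<Longrightarrow> t \<ge> 0 \<Longrightarrow> T s (T t x) = T t (T s x)"
  by (metis T_add add.commute)

lemma resolvent_commute:
  assumes t: "t \<ge> 0"
  shows "resolvent (T t x) = T t (resolvent x)"
proof -
  have "T t (resolvent x) = integral {0..1} (\<lambda>u. T t (orbit x u))"
    unfolding resolvent_def
    using integral_linear[OF orbit_integrable linear(1)[OF t], of 1 x] by (simp add: o_def)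
  also have "\<dots> = resolvent (T t x)"
    unfolding resolvent_def using t
    by (intro integral_cong) (auto simp: orbit_def linear T_commute)
  finally show ?thesis by simp
qed

lemma resolvent_shift:
  assumes t: "t \<ge> 0"
  shows "resolvent (T t x) = exp t *\<^sub>R integral {0..exp (- t)} (orbit x)"
proof -
  have "resolvent (T t x) = integral {0..1} (\<lambda>u. orbit x (exp (- t) * u))"
    unfolding resolvent_def
  proof (rule integral_cong)
    fix u :: real assume "u \<in> {0..1}"
    then show "orbit (T t x) u = orbit x (exp (- t) * u)"
      using t by (auto simp: orbit_def ln_mult mult_le_0_iff T_add[symmetric])
  qed
  also have "{0..1} = (\<lambda>u. u / exp (- t)) ` {0..exp (- t)}"
    by (simp add: image_divide_atLeastAtMost)
  also have "integral \<dots> (\<lambda>u. orbit x (exp (- t) * u)) = exp t *\<^sub>R integral {0..exp (- t)} (orbit x)"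
    by (subst integral_stretch_real) (auto simp: exp_minus field_simps)
  finally show ?thesis .
qed

text \<open>
  This is the generator equation \<open>A R = R - 1\<close>. Scaling \<open>u\<close> by \<open>exp (- t)\<close> moves the dependence on \<open>t\<close>
  into the upper limit of the integral, where the fundamental theorem of calculus applies.
\<close>
lemma resolvent_derivative:
  assumes t: "t \<ge> 0"
  shows "((\<lambda>t. resolvent (T t x)) has_vector_derivative resolvent (T t x) - T t x) (at t within {0..})"
proof -
  let ?I = "\<lambda>u. integral {0..u} (orbit x)"
  have "(?I has_vector_derivative orbit x (exp (- t))) (at (exp (- t)) within {0..1})"
    using integral_has_vector_derivative[OF continuous_on_orbit, of "exp (- t)"] t by simp
  then have I: "(?I has_vector_derivative orbit x (exp (- t))) (at (exp (- t)) within (\<lambda>t. exp (- t)) ` {0..})"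
    by (rule has_vector_derivative_within_subset) auto
  have e: "((\<lambda>t. exp (- t)) has_real_derivative - exp (- t)) (at t within {0..})"
    by (auto intro!: derivative_eq_intros)
  have "((\<lambda>t. ?I (exp (- t))) has_vector_derivative (- exp (- t)) *\<^sub>R orbit x (exp (- t))) (at t within {0..})"
    using vector_diff_chain_within[OF e[unfolded has_real_derivative_iff_has_vector_derivative] I]
    by (simp add: o_def)
  then have "((\<lambda>t. exp t *\<^sub>R ?I (exp (- t))) has_vector_derivative
      exp t *\<^sub>R ((- exp (- t)) *\<^sub>R orbit x (exp (- t))) + exp t *\<^sub>R ?I (exp (- t))) (at t within {0..})"
    by (intro has_vector_derivative_scaleR) (auto intro!: derivative_eq_intros)
  also have "exp t *\<^sub>R ((- exp (- t)) *\<^sub>R orbit x (exp (- t))) + exp t *\<^sub>R ?I (exp (- t)) = resolvent (T t x) - T t x"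
    using t by (simp add: resolvent_shift orbit_def) (simp add: exp_minus)
  finally show ?thesis
    by (rule has_vector_derivative_transform[rotated 2]) (use t resolvent_shift in auto)
qed

text \<open>
  Integrating the preceding derivative over \<open>{0..h}\<close> exhibits the integral of an orbit as a value of the
  resolvent. Its averages converge to the initial vector, so the range of the resolvent is dense.
\<close>
lemma resolvent_average:
  assumes h: "h \<ge> 0"
  shows "integral {0..h} (\<lambda>s. T s x) = resolvent (integral {0..h} (\<lambda>s. T s x) - T h x + x)"
proof -
  let ?z = "integral {0..h} (\<lambda>s. T s x)"
  have c: "continuous_on {0..h} (\<lambda>s. T s x)"
    by (rule continuous_on_subset[OF cont]) auto
  then have i: "(\<lambda>s. T s x) integrable_on {0..h}" by (rule integrable_continuous_real)
  have "((\<lambda>s. resolvent (T s x) - T s x) has_integral resolvent (T h x) - resolvent (T 0 x)) {0..h}"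
    by (rule fundamental_theorem_of_calculus[OF h])
      (auto intro: has_vector_derivative_within_subset[OF resolvent_derivative])
  moreover have "((\<lambda>s. resolvent (T s x) - T s x) has_integral resolvent ?z - ?z) {0..h}"
    using has_integral_linear[OF integrable_integral[OF i] resolvent_linear(1)]
    by (intro has_integral_diff integrable_integral i) (simp add: o_def)
  ultimately have "resolvent (T h x) - resolvent x = resolvent ?z - ?z"
    by (simp add: has_integral_unique T_0)
  then show ?thesis by (simp add: resolvent_linear algebra_simps)
qed

lemma dense_range_resolvent:
  assumes e: "e > 0"
  obtains y where "norm (resolvent y - x) < e"
proof -
  have "((\<lambda>u. integral {0..u} (\<lambda>s. T s x)) has_vector_derivative T 0 x) (at 0 within {0..1})"
    by (rule integral_has_vector_derivative) (auto intro: continuous_on_subset[OF cont])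
  then have "\<forall>e>0. \<exists>d>0. \<forall>h\<in>{0..1}. 0 < h \<and> h < d \<longrightarrow>
      norm (integral {0..h} (\<lambda>s. T s x) - h *\<^sub>R x) / h < e"
    by (simp add: has_vector_derivative_def has_derivative_within' T_0)
  then obtain d where d: "d > 0" "\<And>h. h \<in> {0..1} \<Longrightarrow> 0 < h \<Longrightarrow> h < d \<Longrightarrow>
      norm (integral {0..h} (\<lambda>s. T s x) - h *\<^sub>R x) / h < e"
    using e by meson
  define h where "h = min 1 (d / 2)"
  have h: "h \<in> {0..1}" "0 < h" "h < d" using d(1) by (auto simp: h_def)
  let ?z = "integral {0..h} (\<lambda>s. T s x)"
  let ?w = "(1 / h) *\<^sub>R (?z - T h x + x)"
  have "resolvent ?w - x = (1 / h) *\<^sub>R (?z - h *\<^sub>R x)"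
    unfolding resolvent_linear(5) using h resolvent_average[of h x, symmetric]
    by (simp add: scaleR_right_diff_distrib)
  then have "norm (resolvent ?w - x) < e"
    using d(2)[OF h] h by simp
  then show ?thesis by (rule that)
qed

definition cogenerator :: "'a \<Rightarrow> 'a" where
  "cogenerator x = x - 2 *\<^sub>R resolvent x"

text \<open>
  With \<open>y = T(t) x\<close> and \<open>z = R y\<close> the derivative is \<open>2 Re \<langle>P (z - y), P z\<rangle>\<close>, and
  \<open>\<parallel>P (y - 2 z)\<parallel>\<^sup>2 = \<parallel>P y\<parallel>\<^sup>2 - 4 Re \<langle>P y, P z\<rangle> + 4 \<parallel>P z\<parallel>\<^sup>2\<close> converts it into a defect of the
  cogenerator. The operator \<open>P\<close> will be a power of the cogenerator.
\<close>
lemma norm_resolvent_derivative: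
  assumes P: "bounded_linear (P :: 'a \<Rightarrow> 'a)" and t: "t \<ge> 0"
  shows "((\<lambda>t. (norm (P (resolvent (T t x))))\<^sup>2) has_real_derivative
     ((norm (P (cogenerator (T t x))))\<^sup>2 - (norm (P (T t x)))\<^sup>2) / 2) (at t within {0..})"
proof -
  let ?f = "\<lambda>t. P (resolvent (T t x))"
  have d: "(?f has_vector_derivative P (resolvent (T t x) - T t x)) (at t within {0..})"
    by (rule bounded_linear.has_vector_derivative[OF P resolvent_derivative[OF t]])
  have "((\<lambda>t. Re (cinner (?f t) (?f t))) has_vector_derivative
      Re (cinner (?f t) (P (resolvent (T t x) - T t x)) + cinner (P (resolvent (T t x) - T t x)) (?f t))) (at t within {0..})"
    by (intro bounded_linear.has_vector_derivative[OF bounded_linear_Re]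
        bounded_bilinear.has_vector_derivative[OF bounded_bilinear_cinner] d)
  also have "Re (cinner (?f t) (P (resolvent (T t x) - T t x)) + cinner (P (resolvent (T t x) - T t x)) (?f t))
      = ((norm (P (cogenerator (T t x))))\<^sup>2 - (norm (P (T t x)))\<^sup>2) / 2"
    using linear_diff[OF bounded_linear.linear[OF P]] linear_scale[OF bounded_linear.linear[OF P]]
    by (simp add: cogenerator_def norm_diff_sq cinner_simps Re_cinner_commute[of "?f t" "P (T t x)"]
        power_mult_distrib) (simp add: norm_sq_cinner)
  finally show ?thesis
    by (simp only: norm_sq_cinner has_real_derivative_iff_has_vector_derivative)
qed

lemma clinear_cogenerator: "bounded_clinear cogenerator"
proof (rule bounded_clinearI[of _ 3])
  fix x
  have "norm (cogenerator x) \<le> norm x + 2 * norm (resolvent x)"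
    unfolding cogenerator_def using norm_triangle_ineq4[of x "2 *\<^sub>R resolvent x"] by simp
  also have "norm (resolvent x) \<le> norm x"
    by (rule resolvent_contraction)
  finally show "norm (cogenerator x) \<le> 3 * norm x" by simp
next
  fix c x
  have "2 *\<^sub>R (c *\<^sub>C resolvent x) = c *\<^sub>C (2 *\<^sub>R resolvent x)"
    by (metis bounded_clinear_ident bounded_linear_scaleC linear_scale bounded_linear.linear)
  then show "cogenerator (c *\<^sub>C x) = c *\<^sub>C cogenerator x"
    by (simp add: cogenerator_def resolvent_linear complex_space.scale_right_diff_distrib)
qed (simp add: cogenerator_def resolvent_linear algebra_simps)

text \<open>
  The function \<open>\<parallel>R T(t) x\<parallel> = \<parallel>T(t) R x\<parallel>\<close> is nonincreasing, so the derivative computed above is not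
  positive at \<open>0\<close>.
\<close>
lemma cogenerator_contraction: "norm (cogenerator x) \<le> norm x"
proof -
  let ?F = "\<lambda>t. (norm (resolvent (T t x)))\<^sup>2"
  let ?l = "((norm (cogenerator x))\<^sup>2 - (norm x)\<^sup>2) / 2"
  have d: "(?F has_real_derivative ?l) (at 0 within {0..})"
    using norm_resolvent_derivative[OF bounded_linear_ident, of 0 x] by (simp add: T_0)
  have "\<not> ?l > 0"
  proof
    assume "?l > 0"
    from has_real_derivative_pos_inc_right[OF d this]
    obtain \<delta> where \<delta>: "\<delta> > 0" "\<And>h. h > 0 \<Longrightarrow> h < \<delta> \<Longrightarrow> ?F 0 < ?F h" by auto
    have "?F (\<delta> / 2) \<le> ?F 0"
      using \<delta>(1) contraction[of "\<delta> / 2" "resolvent x"]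
      by (intro power_mono) (auto simp: resolvent_commute T_0)
    with \<delta>(2)[of "\<delta> / 2"] \<delta>(1) show False by simp
  qed
  then show ?thesis by (simp add: not_less power2_le_iff_abs_le)
qed

lemma clinear_cogenerator_power: "bounded_clinear (cogenerator ^^ n)"
  by (induction n)
    (auto simp: o_def id_def intro: bounded_clinear_ident bounded_clinear_compose clinear_cogenerator)

lemma cogenerator_power_contraction: "norm ((cogenerator ^^ n) x) \<le> norm x"
  by (induction n) (auto intro: order_trans[OF cogenerator_contraction])

lemma cogenerator_commute: "t \<ge> 0 \<Longrightarrow> cogenerator (T t x) = T t (cogenerator x)"
  by (simp add: cogenerator_def resolvent_commute linear)

lemma cogenerator_power_commute: "t \<ge> 0 \<Longrightarrow> (cogenerator ^^ n) (T t x) = T t ((cogenerator ^^ n) x)"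
  by (induction n) (auto simp: cogenerator_commute)

text \<open>
  Let \<open>F\<^sub>n(t) = \<parallel>V\<^sup>n R T(t) x\<parallel>\<^sup>2\<close>. The derivatives of the \<open>F\<^sub>n\<close> telescope, so the nonnegative drops
  \<open>F\<^sub>n(0) - F\<^sub>n(t)\<close> have a sum bounded by \<open>t \<parallel>x\<parallel>\<^sup>2 / 2\<close> and tend to \<open>0\<close> for fixed \<open>t\<close>. As
  \<open>F\<^sub>n(t) \<le> \<parallel>T(t) R x\<parallel>\<^sup>2\<close> is small for large \<open>t\<close>, uniformly in \<open>n\<close>, also \<open>F\<^sub>n(0)\<close> tends to \<open>0\<close>.
\<close>
lemma cogenerator_power_resolvent_lim: "(\<lambda>n. (norm ((cogenerator ^^ n) (resolvent x)))\<^sup>2) \<longlonglongrightarrow> 0"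
proof -
  define F where "F n t = (norm ((cogenerator ^^ n) (resolvent (T t x))))\<^sup>2" for n t
  have F0: "F n t \<ge> 0" for n t by (simp add: F_def)
  have Vn: "norm ((cogenerator ^^ n) (T t y)) \<le> norm ((cogenerator ^^ n) y)" if "t \<ge> 0" for n t y
    using that by (simp add: cogenerator_power_commute contraction)
  have F_t: "F n t \<le> F n 0" if "t \<ge> 0" for n t
    using that Vn[OF that, of n "resolvent x"] by (auto simp: F_def T_0 resolvent_commute intro!: power_mono)
  have d: "(F n has_real_derivative ((norm ((cogenerator ^^ Suc n) (T t x)))\<^sup>2
      - (norm ((cogenerator ^^ n) (T t x)))\<^sup>2) / 2) (at t within {0..})" if "t \<ge> 0" for n t
    using norm_resolvent_derivative[OF bounded_clinearD(1)[OF clinear_cogenerator_power] that, of n x]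
    unfolding F_def by (simp add: funpow_swap1)
  have sum_le: "(\<Sum>n<N. F n 0 - F n t) \<le> t * (norm x)\<^sup>2 / 2" if t: "t \<ge> 0" for N t
  proof -
    let ?S = "\<lambda>t. \<Sum>n<N. F n t"
    let ?S' = "\<lambda>t. ((norm ((cogenerator ^^ N) (T t x)))\<^sup>2 - (norm (T t x))\<^sup>2) / 2"
    have "(?S has_real_derivative ?S' s) (at s within {0..t})" if "0 \<le> s" for s
    proof -
      have "(?S has_real_derivative (\<Sum>n<N. ((norm ((cogenerator ^^ Suc n) (T s x)))\<^sup>2
          - (norm ((cogenerator ^^ n) (T s x)))\<^sup>2) / 2)) (at s within {0..})"
        by (intro DERIV_sum d that)
      also have "(\<Sum>n<N. ((norm ((cogenerator ^^ Suc n) (T s x)))\<^sup>2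
          - (norm ((cogenerator ^^ n) (T s x)))\<^sup>2) / 2) = ?S' s"
        by (simp only: sum_divide_distrib[symmetric]
            sum_lessThan_telescope[of "\<lambda>n. (norm ((cogenerator ^^ n) (T s x)))\<^sup>2"]) simp
      finally show ?thesis by (rule DERIV_subset) auto
    qed
    then obtain s where s: "s \<in> {0..t}" "?S t - ?S 0 = ?S' s * (t - 0)"
      using mvt_very_simple[OF t, of ?S "\<lambda>s. (*) (?S' s)"] unfolding has_field_derivative_def by blast
    have "- ?S' s \<le> (norm x)\<^sup>2 / 2"
    proof -
      have "(norm (T s x))\<^sup>2 \<le> (norm x)\<^sup>2"
        using s(1) contraction[of s x] by (intro power_mono) auto
      then have "(norm (T s x))\<^sup>2 - (norm ((cogenerator ^^ N) (T s x)))\<^sup>2 \<le> (norm x)\<^sup>2"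
        by (rule order_trans[rotated]) simp
      then show ?thesis
        by (simp only: minus_divide_left minus_diff_eq divide_right_mono zero_le_numeral)
    qed
    then have "- ?S' s * t \<le> (norm x)\<^sup>2 / 2 * t" using t by (rule mult_right_mono)
    then show ?thesis using s(2) by (simp add: sum_subtractf mult.commute)
  qed
  have lim: "(\<lambda>n. F n 0 - F n t) \<longlonglongrightarrow> 0" if t: "t \<ge> 0" for t
  proof (rule summable_LIMSEQ_zero, rule bounded_imp_summable)
    show "0 \<le> F n 0 - F n t" for n using F_t[OF t] by simp
    show "(\<Sum>n\<le>N. F n 0 - F n t) \<le> t * (norm x)\<^sup>2 / 2" for N
      using sum_le[OF t, of "Suc N"] by (simp add: lessThan_Suc_atMost)
  qed
  have "(\<lambda>n. F n 0) \<longlonglongrightarrow> 0"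
  proof (rule LIMSEQ_I)
    fix e :: real assume e: "e > 0"
    have "((\<lambda>t. (norm (T t (resolvent x)))\<^sup>2) \<longlongrightarrow> 0\<^sup>2) at_top"
      by (intro tendsto_power stable)
    then have "\<forall>\<^sub>F t in at_top. (norm (T t (resolvent x)))\<^sup>2 < e / 2"
      by (rule order_tendstoD(2)) (use e in simp)
    then obtain t where t: "t \<ge> 0" "(norm (T t (resolvent x)))\<^sup>2 < e / 2"
      using eventually_conj[OF _ eventually_ge_at_top[of 0]] eventually_happens by fastforce
    have Ft: "F n t < e / 2" for n
    proof (rule le_less_trans[OF _ t(2)])
      show "F n t \<le> (norm (T t (resolvent x)))\<^sup>2"
        unfolding F_def resolvent_commute[OF t(1)]
        by (intro power_mono cogenerator_power_contraction) simp
    qed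
    obtain N where "\<And>n. n \<ge> N \<Longrightarrow> norm (F n 0 - F n t - 0) < e / 2"
      using LIMSEQ_D[OF lim[OF t(1)], of "e / 2"] e by auto
    then have "norm (F n 0 - 0) < e" if "n \<ge> N" for n
      using that Ft[of n] F0[of n 0] F_t[OF t(1), of n] by force
    then show "\<exists>N. \<forall>n\<ge>N. norm (F n 0 - 0) < e" by blast
  qed
  then show ?thesis by (simp add: F_def T_0)
qed

lemma cogenerator_power_lim: "(\<lambda>n. norm ((cogenerator ^^ n) x)) \<longlonglongrightarrow> 0"
proof (rule LIMSEQ_I)
  fix e :: real assume e: "e > 0"
  obtain y where y: "norm (resolvent y - x) < e / 2"
    using dense_range_resolvent[of "e / 2" x] e by auto
  have "(\<lambda>n. sqrt ((norm ((cogenerator ^^ n) (resolvent y)))\<^sup>2)) \<longlonglongrightarrow> sqrt 0"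
    by (intro tendsto_real_sqrt cogenerator_power_resolvent_lim)
  then have "(\<lambda>n. norm ((cogenerator ^^ n) (resolvent y))) \<longlonglongrightarrow> 0" by simp
  then obtain N where N: "\<And>n. n \<ge> N \<Longrightarrow> norm ((cogenerator ^^ n) (resolvent y)) < e / 2"
    using LIMSEQ_D[of "\<lambda>n. norm ((cogenerator ^^ n) (resolvent y))" 0 "e / 2"] e by auto
  have "norm ((cogenerator ^^ n) x) < e" if "n \<ge> N" for n
  proof -
    have "(cogenerator ^^ n) x = (cogenerator ^^ n) (resolvent y) - (cogenerator ^^ n) (resolvent y - x)"
      by (simp add: bounded_clinearD(3)[OF clinear_cogenerator_power])
    also have "norm \<dots> \<le> norm ((cogenerator ^^ n) (resolvent y)) + norm ((cogenerator ^^ n) (resolvent y - x))"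
      by (rule norm_triangle_ineq4)
    also have "\<dots> < e"
      using N[OF that] y cogenerator_power_contraction[of n "resolvent y - x"] by simp
    finally show ?thesis .
  qed
  then show "\<exists>N. \<forall>n\<ge>N. norm (norm ((cogenerator ^^ n) x) - 0) < e" by auto
qed

end

section \<open>The Hardy space and its Toeplitz operators\<close>

lemma hardy2_fun_holomorphic: "hardy2_fun f holomorphic_on ball 0 1"
  using hardy2_fun[of f] by auto

lemma hardy2_fun_sums: "norm z < 1 \<Longrightarrow> (\<lambda>n. hardy2_coeff f n * z ^ n) sums hardy2_fun f z"
  unfolding hardy2_coeff.rep_eq by (rule taylor_coeff_sums[OF hardy2_fun_holomorphic])

lemma hardy2_eqI:
  assumes "\<And>z. norm z < 1 \<Longrightarrow> hardy2_fun f z = hardy2_fun g z"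
  shows "f = g"
proof -
  have "hardy2_fun f z = hardy2_fun g z" for z
    using assms[of z] hardy2_fun[of f] hardy2_fun[of g] by (cases "norm z < 1") auto
  then show ?thesis by (simp add: hardy2_fun_inject[symmetric] fun_eq_iff)
qed

lemma hardy2_fun_simps:
  "hardy2_fun 0 z = 0" "hardy2_fun (f + g) z = hardy2_fun f z + hardy2_fun g z"
  "hardy2_fun (c *\<^sub>C f) z = c * hardy2_fun f z" "hardy2_fun (r *\<^sub>R f) z = of_real r * hardy2_fun f z"
  "hardy2_fun (f - g) z = hardy2_fun f z - hardy2_fun g z"
proof -
  show "hardy2_fun (f - g) z = hardy2_fun f z - hardy2_fun g z"
    unfolding minus_hardy2_def uminus_hardy2_def plus_hardy2.rep_eq scaleR_hardy2.rep_eq by simp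
qed (simp_all add: zero_hardy2.rep_eq plus_hardy2.rep_eq scaleC_hardy2.rep_eq scaleR_hardy2.rep_eq)

lemma hardy2_norm_sums: "(\<lambda>n. (cmod (hardy2_coeff f n))\<^sup>2) sums (norm f)\<^sup>2"
proof -
  have "(norm f)\<^sup>2 = (\<Sum>n. (cmod (hardy2_coeff f n))\<^sup>2)"
    unfolding norm_hardy2_def by (intro real_sqrt_pow2 suminf_nonneg hardy2_coeff_l2) auto
  then show ?thesis using hardy2_coeff_l2[of f] by (simp add: sums_iff)
qed

lemma hardy2_cinner_sums: "(\<lambda>n. hardy2_coeff f n * cnj (hardy2_coeff g n)) sums cinner f g"
  unfolding cinner_hardy2_def by (intro summable_sums l2_prod hardy2_coeff_l2)

lemma hardy2_reproducing_kernel: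
  assumes z: "norm z < 1"
  obtains k where "\<And>f. hardy2_fun f z = cinner f k"
proof -
  have "summable (\<lambda>n. (cmod (cnj z ^ n))\<^sup>2)"
    using z by (simp add: norm_power power_mult[symmetric] mult.commute[of _ 2])
      (simp add: power_mult summable_geometric power_less_one_iff)
  then obtain k where k: "\<And>n. hardy2_coeff k n = cnj z ^ n" using hardy2_coeff_surj by blast
  have "hardy2_fun f z = cinner f k" for f
    using hardy2_fun_sums[OF z, of f] hardy2_cinner_sums[of f k] by (simp add: k sums_unique2)
  then show ?thesis by (rule that)
qed

definition monomial :: "nat \<Rightarrow> hardy2" where
  "monomial n = (SOME f. \<forall>m. hardy2_coeff f m = (if m = n then 1 else 0))"

lemma hardy2_coeff_monomial: "hardy2_coeff (monomial n) m = (if m = n then 1 else 0)"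
proof -
  have "summable (\<lambda>m. (cmod (if m = n then 1 else 0))\<^sup>2)"
    by (rule summable_finite[of "{n}"]) auto
  then obtain f where "\<forall>m. hardy2_coeff f m = (if m = n then 1 else 0)"
    by (rule hardy2_coeff_surj) blast
  then have "\<forall>m. hardy2_coeff (monomial n) m = (if m = n then 1 else 0)"
    unfolding monomial_def by (rule someI)
  then show ?thesis by blast
qed

lemma hardy2_fun_monomial: "norm z < 1 \<Longrightarrow> hardy2_fun (monomial n) z = z ^ n"
  using hardy2_fun_sums[of z "monomial n"] sums_single[of n "\<lambda>m. z ^ m"]
  by (simp add: hardy2_coeff_monomial if_distrib[of "\<lambda>t. t * _"] sums_unique2 cong: if_cong)

lemma cinner_monomial: "cinner f (monomial n) = hardy2_coeff f n"
  using hardy2_cinner_sums[of f "monomial n"] sums_single[of n "\<lambda>m. hardy2_coeff f m"]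
  by (simp add: hardy2_coeff_monomial if_distrib[of cnj] if_distrib[of "\<lambda>t. _ * t"] sums_unique2 cong: if_cong)

lemma norm_monomial: "norm (monomial n) = 1"
proof -
  have "(norm (monomial n))\<^sup>2 = 1"
    unfolding norm_sq_cinner cinner_monomial hardy2_coeff_monomial by simp
  then show ?thesis using norm_ge_zero[of "monomial n"] by (simp add: power2_eq_1_iff)
qed

lemma monomial_orthogonal: "m \<noteq> n \<Longrightarrow> cinner (c *\<^sub>C monomial m) (d *\<^sub>C monomial n) = 0"
  by (simp add: cinner_simps cinner_monomial hardy2_coeff_monomial hardy2_coeff_scaleC)

lemma norm_polynomial_sq: "(norm (\<Sum>n<N. c n *\<^sub>C monomial n))\<^sup>2 = (\<Sum>n<N. (cmod (c n))\<^sup>2)"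
  by (subst norm_sum_orthogonal_sq) (auto simp: monomial_orthogonal norm_scaleC norm_monomial)

lemma hardy2_expansion: "(\<lambda>n. hardy2_coeff f n *\<^sub>C monomial n) sums f"
proof -
  let ?u = "\<lambda>n. hardy2_coeff f n *\<^sub>C monomial n"
  have n: "(\<lambda>n. (norm (?u n))\<^sup>2) sums (norm f)\<^sup>2"
    using hardy2_norm_sums by (simp add: norm_scaleC norm_monomial)
  have "cinner (?u m) (?u n) = 0" if "m \<noteq> n" for m n
    using that by (simp add: cinner_simps cinner_monomial hardy2_coeff_monomial hardy2_coeff_scaleC)
  from orthogonal_series(1)[OF this n] have s: "?u sums suminf ?u" by (simp add: summable_sums)
  have "hardy2_coeff (suminf ?u) m = hardy2_coeff f m" for m
  proof -
    have "(\<lambda>n. cinner (?u n) (monomial m)) sums cinner (suminf ?u) (monomial m)"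
      by (rule bounded_linear.sums[OF bounded_bilinear.bounded_linear_left[OF bounded_bilinear_cinner] s])
    moreover have "(\<lambda>n. cinner (?u n) (monomial m)) = (\<lambda>n. if n = m then hardy2_coeff f n else 0)"
      by (auto simp: cinner_monomial hardy2_coeff_monomial hardy2_coeff_scaleC)
    ultimately show ?thesis
      using sums_single[of m "hardy2_coeff f"] by (simp add: sums_unique2 cinner_monomial)
  qed
  then have "suminf ?u = f" by (rule hardy2_coeff_eqI)
  with s show ?thesis by simp
qed

definition circle_mean :: "(complex \<Rightarrow> complex) \<Rightarrow> real \<Rightarrow> real" where
  "circle_mean f r = integral {0..2 * pi} (\<lambda>\<theta>. (cmod (f (of_real r * cis \<theta>)))\<^sup>2) / (2 * pi)"

lemma circle_mean_hardy2:
  assumes "0 \<le> r" "r < 1"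
  shows "circle_mean (hardy2_fun f) r = (\<Sum>n. (cmod (hardy2_coeff f n))\<^sup>2 * r ^ (2 * n))"
    and "summable (\<lambda>n. (cmod (hardy2_coeff f n))\<^sup>2 * r ^ (2 * n))"
    and "(\<lambda>\<theta>. (cmod (hardy2_fun f (of_real r * cis \<theta>)))\<^sup>2) integrable_on {0..2 * pi}"
  using circle_parseval[OF hardy2_fun_holomorphic assms, of f]
  by (auto simp: circle_mean_def hardy2_coeff.rep_eq integrable_on_def dest: integral_unique)

lemma circle_mean_le:
  assumes "0 \<le> r" "r < 1"
  shows "circle_mean (hardy2_fun f) r \<le> (norm f)\<^sup>2"
  unfolding circle_mean_hardy2(1)[OF assms] sums_unique[OF hardy2_norm_sums]
  using assms
  by (intro suminf_le circle_mean_hardy2(2) hardy2_coeff_l2 mult_left_le power_le_one) auto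

text \<open>
  A concrete sequence of radii increasing to \<open>1\<close>, since dominated convergence is about sequences.
\<close>
definition radius :: "nat \<Rightarrow> real" where "radius k = 1 - 1 / real (Suc k)"

lemma radius: "0 \<le> radius k" "radius k < 1" "filterlim radius (at_left 1) sequentially" "radius \<longlonglongrightarrow> 1"
proof -
  show *: "0 \<le> radius k" "radius k < 1" for k by (auto simp: radius_def divide_simps)
  have "(\<lambda>k. 1 - 1 / real (Suc k)) \<longlonglongrightarrow> 1 - 0"
    by (intro tendsto_diff tendsto_const) (use LIMSEQ_inverse_real_of_nat in \<open>simp add: inverse_eq_divide\<close>)
  then show l: "radius \<longlonglongrightarrow> 1" by (simp add: radius_def[abs_def])
  show "filterlim radius (at_left 1) sequentially"
    unfolding filterlim_at using l * by (auto simp: less_imp_neq)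
qed

lemma circle_mean_tendsto: "(\<lambda>k. circle_mean (hardy2_fun f) (radius k)) \<longlonglongrightarrow> (norm f)\<^sup>2"
proof -
  have "(\<lambda>k. \<Sum>n. (cmod (hardy2_coeff f n))\<^sup>2 * radius k ^ (2 * n)) \<longlonglongrightarrow> (\<Sum>n. (cmod (hardy2_coeff f n))\<^sup>2)"
  proof (rule tannerys_theorem[THEN conjunct2, THEN conjunct2])
    show "(\<lambda>k. (cmod (hardy2_coeff f n))\<^sup>2 * radius k ^ (2 * n)) \<longlonglongrightarrow> (cmod (hardy2_coeff f n))\<^sup>2" for n
      using tendsto_mult[OF tendsto_const tendsto_power[OF radius(4)]] by simp
    show "\<forall>\<^sub>F (n, k) in sequentially \<times>\<^sub>F sequentially.
        norm ((cmod (hardy2_coeff f n))\<^sup>2 * radius k ^ (2 * n)) \<le> (cmod (hardy2_coeff f n))\<^sup>2"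
    proof (rule always_eventually, clarify)
      fix n k
      have "\<bar>radius k ^ (2 * n)\<bar> \<le> 1" using radius(1,2)[of k] by (simp add: power_le_one less_imp_le)
      then show "norm ((cmod (hardy2_coeff f n))\<^sup>2 * radius k ^ (2 * n)) \<le> (cmod (hardy2_coeff f n))\<^sup>2"
        by (simp add: abs_mult mult_left_le)
    qed
  qed (use hardy2_coeff_l2 in auto)
  then show ?thesis
    using circle_mean_hardy2(1)[OF radius(1,2)] by (simp add: sums_unique[OF hardy2_norm_sums])
qed

lemma bounded_holomorphicI:
  assumes "g holomorphic_on ball 0 1" "\<And>z. norm z < 1 \<Longrightarrow> cmod (g z) \<le> B"
  shows "bounded_holomorphic g"
  unfolding bounded_holomorphic_def bounded_iff using assms by (auto intro!: exI[of _ B])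

lemma bounded_holomorphicD:
  assumes "bounded_holomorphic g"
  obtains B where "B \<ge> 0" "\<And>z. norm z < 1 \<Longrightarrow> cmod (g z) \<le> B"
proof -
  obtain B where B: "\<And>z. norm z < 1 \<Longrightarrow> cmod (g z) \<le> B"
    using assms unfolding bounded_holomorphic_def bounded_iff by (metis imageI mem_ball_0)
  then have "B \<ge> 0" using order_trans[OF norm_ge_zero B[of 0]] by simp
  with B show ?thesis using that by blast
qed

lemma bounded_holomorphic_mult:
  assumes "bounded_holomorphic g" "bounded_holomorphic h"
  shows "bounded_holomorphic (\<lambda>z. g z * h z)"
proof -
  obtain B where B: "B \<ge> 0" "\<And>z. norm z < 1 \<Longrightarrow> cmod (g z) \<le> B"
    using bounded_holomorphicD[OF assms(1)] by blast
  obtain C where C: "C \<ge> 0" "\<And>z. norm z < 1 \<Longrightarrow> cmod (h z) \<le> C"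
    using bounded_holomorphicD[OF assms(2)] by blast
  show ?thesis
  proof (rule bounded_holomorphicI)
    show "cmod (g z * h z) \<le> B * C" if "norm z < 1" for z
      unfolding norm_mult using B C that by (intro mult_mono) auto
  qed (use assms in \<open>auto simp: bounded_holomorphic_def intro!: holomorphic_intros\<close>)
qed

lemma toeplitz_apply:
  "bounded_holomorphic g \<Longrightarrow> norm z < 1 \<Longrightarrow> hardy2_fun (analytic_toeplitz g f) z = g z * hardy2_fun f z"
  by (simp add: analytic_toeplitz_apply)

text \<open>
  The bound holds for the integral means over each circle of radius less than \<open>1\<close>, and these converge to
  the squared norm.
\<close>
lemma norm_toeplitz_le:
  assumes g: "g holomorphic_on ball 0 1" and B: "\<And>z. norm z < 1 \<Longrightarrow> cmod (g z) \<le> B"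
  shows "norm (analytic_toeplitz g f) \<le> B * norm f"
proof -
  have bh: "bounded_holomorphic g" using bounded_holomorphicI[OF g] B by blast
  have B0: "B \<ge> 0" using order_trans[OF norm_ge_zero B[of 0]] by simp
  have "circle_mean (hardy2_fun (analytic_toeplitz g f)) (radius k) \<le> (B * norm f)\<^sup>2" for k
  proof -
    note r = radius(1,2)[of k]
    have ib: "norm (of_real (radius k) * cis \<theta>) < 1" for \<theta> using r by (simp add: norm_mult)
    have "circle_mean (hardy2_fun (analytic_toeplitz g f)) (radius k)
        \<le> integral {0..2 * pi} (\<lambda>\<theta>. B\<^sup>2 * (cmod (hardy2_fun f (of_real (radius k) * cis \<theta>)))\<^sup>2) / (2 * pi)"
      unfolding circle_mean_def
    proof (intro divide_right_mono integral_le circle_mean_hardy2(3)[OF r] integrable_on_mult_right)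
      show "(cmod (hardy2_fun (analytic_toeplitz g f) (of_real (radius k) * cis \<theta>)))\<^sup>2
          \<le> B\<^sup>2 * (cmod (hardy2_fun f (of_real (radius k) * cis \<theta>)))\<^sup>2" for \<theta>
        unfolding toeplitz_apply[OF bh ib] norm_mult power_mult_distrib
        by (intro mult_right_mono power_mono B ib) auto
    qed auto
    also have "\<dots> = B\<^sup>2 * circle_mean (hardy2_fun f) (radius k)"
      by (simp add: circle_mean_def)
    also have "\<dots> \<le> B\<^sup>2 * (norm f)\<^sup>2"
      by (intro mult_left_mono circle_mean_le r) auto
    finally show ?thesis by (simp add: power_mult_distrib)
  qed
  then have "(norm (analytic_toeplitz g f))\<^sup>2 \<le> (B * norm f)\<^sup>2"
    by (intro LIMSEQ_le_const2[OF circle_mean_tendsto]) auto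
  then show ?thesis by (rule power2_le_imp_le) (use B0 in simp)
qed

lemma clinear_toeplitz:
  assumes "bounded_holomorphic g"
  shows "bounded_clinear (analytic_toeplitz g)"
proof -
  obtain B where B: "\<And>z. norm z < 1 \<Longrightarrow> cmod (g z) \<le> B" using bounded_holomorphicD[OF assms] by blast
  show ?thesis
  proof (rule bounded_clinearI[of _ B])
    show "norm (analytic_toeplitz g f) \<le> B * norm f" for f
      using assms B by (intro norm_toeplitz_le) (auto simp: bounded_holomorphic_def)
  qed (auto intro!: hardy2_eqI simp: toeplitz_apply[OF assms] hardy2_fun_simps algebra_simps)
qed

lemma toeplitz_mult:
  assumes "bounded_holomorphic g" "bounded_holomorphic h"
  shows "analytic_toeplitz g (analytic_toeplitz h f) = analytic_toeplitz (\<lambda>z. g z * h z) f"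
  using assms by (intro hardy2_eqI) (simp add: toeplitz_apply bounded_holomorphic_mult)

lemma hilbert_adjoint_eqI:
  assumes "\<And>x y. cinner (A x) y = cinner x (B y)"
  shows "hilbert_adjoint A = B"
  unfolding hilbert_adjoint_def
proof (rule the_equality)
  fix C assume C: "\<forall>x y. cinner (A x) y = cinner x (C y)"
  have "C y - B y = 0" for y
    by (rule cinner_eq_0_imp_0) (use C assms in \<open>simp add: cinner_simps\<close>)
  then show "C = B" by (simp add: fun_eq_iff)
qed (use assms in blast)

text \<open>
  The coefficients of the adjoint at \<open>y\<close> have to be the conjugates \<open>c n\<close> of \<open>\<langle>A z\<^sup>n, y\<rangle>\<close>. They are square-summable
  because \<open>(\<Sum>n<N. \<bar>c n\<bar>\<^sup>2) = \<langle>A p, y\<rangle>\<close> for the polynomial \<open>p\<close> with coefficients \<open>c n\<close>, whose squared norm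
  is the same sum.
\<close>
lemma hilbert_adjoint:
  fixes A :: "hardy2 \<Rightarrow> hardy2"
  assumes A: "bounded_clinear A"
  shows "cinner (A x) y = cinner x (hilbert_adjoint A y)"
proof -
  obtain K where K: "K > 0" "\<And>x. norm (A x) \<le> norm x * K"
    using bounded_linear.pos_bounded[OF bounded_clinearD(1)[OF A]] by blast
  note L = bounded_linear_compose[OF bounded_bilinear.bounded_linear_left[OF bounded_bilinear_cinner]
      bounded_clinearD(1)[OF A]]
  have "\<exists>b. \<forall>x. cinner (A x) y = cinner x b" for y
  proof -
    define c where "c n = cnj (cinner (A (monomial n)) y)" for n
    have Ac: "cinner (A (\<Sum>n<N. c n *\<^sub>C monomial n)) y = (\<Sum>n<N. c n * cnj (c n))" for N
      using linear_sum[OF bounded_linear.linear[OF L[of y]], of "\<lambda>n. c n *\<^sub>C monomial n" "{..<N}"]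
      by (simp add: bounded_clinearD(4)[OF A] cinner_simps c_def)
    have "(\<Sum>n<N. (cmod (c n))\<^sup>2) \<le> (K * norm y)\<^sup>2" for N
    proof -
      let ?v = "\<Sum>n<N. c n *\<^sub>C monomial n" and ?s = "\<Sum>n<N. (cmod (c n))\<^sup>2"
      have "complex_of_real ?s = cinner (A ?v) y"
        unfolding Ac by (simp add: complex_norm_square[symmetric])
      then have "\<bar>?s\<bar> = cmod (cinner (A ?v) y)" by (metis norm_of_real)
      also have "\<dots> \<le> norm (A ?v) * norm y" by (rule cinner_Cauchy_Schwarz)
      also have "\<dots> \<le> norm ?v * K * norm y" by (intro mult_right_mono K) auto
      finally have 1: "?s \<le> norm ?v * (K * norm y)" by (simp add: mult.assoc)
      have 2: "(norm ?v)\<^sup>2 = ?s" by (rule norm_polynomial_sq)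
      have "norm ?v \<le> K * norm y"
      proof (cases "norm ?v = 0")
        case False
        then have "norm ?v > 0" by simp
        moreover have "norm ?v * norm ?v \<le> norm ?v * (K * norm y)"
          using 1 2 by (simp only: power2_eq_square)
        ultimately show ?thesis by (simp only: mult_le_cancel_left_pos)
      qed (use K in simp)
      then show ?thesis unfolding 2[symmetric] by (rule power_mono) simp
    qed
    then have "summable (\<lambda>n. (cmod (c n))\<^sup>2)"
      by (intro bounded_imp_summable[of _ "(K * norm y)\<^sup>2"]) (simp_all only: zero_le_power2 flip: lessThan_Suc_atMost)
    then obtain b where b: "\<And>n. hardy2_coeff b n = c n" using hardy2_coeff_surj by blast
    have "cinner (A x) y = cinner x b" for x
    proof -
      have "(\<lambda>n. cinner (A (hardy2_coeff x n *\<^sub>C monomial n)) y) sums cinner (A x) y"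
        by (rule bounded_linear.sums[OF L hardy2_expansion])
      moreover have "(\<lambda>n. cinner (A (hardy2_coeff x n *\<^sub>C monomial n)) y)
          = (\<lambda>n. hardy2_coeff x n * cnj (hardy2_coeff b n))"
        by (simp add: bounded_clinearD(4)[OF A] cinner_simps b c_def)
      ultimately show ?thesis using hardy2_cinner_sums[of x b] by (simp add: sums_unique2)
    qed
    then show ?thesis by blast
  qed
  then obtain B where B: "\<And>x y. cinner (A x) y = cinner x (B y)" by metis
  then show ?thesis using hilbert_adjoint_eqI[of A B] by simp
qed

lemma clinear_hilbert_adjoint:
  fixes A :: "hardy2 \<Rightarrow> hardy2"
  assumes A: "bounded_clinear A" and K: "\<And>x. norm (A x) \<le> K * norm x"
  shows "bounded_clinear (hilbert_adjoint A)" and "norm (hilbert_adjoint A y) \<le> K * norm y"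
proof -
  note adj = hilbert_adjoint[OF A]
  show n: "norm (hilbert_adjoint A y) \<le> K * norm y" for y
  proof (cases "norm (hilbert_adjoint A y) = 0")
    case True
    have "0 \<le> K * norm y" by (rule order_trans[OF norm_ge_zero K])
    then show ?thesis using True by simp
  next
    case False
    let ?b = "hilbert_adjoint A y"
    have "(norm ?b)\<^sup>2 = Re (cinner (A ?b) y)" by (simp add: adj norm_sq_cinner)
    also have "\<dots> \<le> norm (A ?b) * norm y"
      using complex_Re_le_cmod cinner_Cauchy_Schwarz order_trans by blast
    also have "\<dots> \<le> K * norm ?b * norm y" by (intro mult_right_mono K) auto
    finally have "norm ?b * norm ?b \<le> norm ?b * (K * norm y)" by (simp only: power2_eq_square mult_ac)
    then show ?thesis using False by (simp add: mult_le_cancel_left_pos)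
  qed
  have eq: "u = v" if "\<And>x. cinner x u = cinner x v" for u v :: hardy2
    using cinner_eq_0_imp_0[of "u - v"] that by (simp add: cinner_simps)
  show "bounded_clinear (hilbert_adjoint A)"
    by (rule bounded_clinearI[OF _ _ n]) (rule eq, simp add: adj[symmetric] cinner_simps)+
qed

section \<open>Inner functions as isometric multipliers\<close>

lemma isometry_cinner:
  assumes A: "bounded_clinear A" and n: "\<And>x. norm (A x) = norm x"
  shows "cinner (A x) (A y) = cinner x y"
proof -
  have R: "Re (cinner (A x) (A y)) = Re (cinner x y)" for x y
    using norm_diff_sq[of "A x" "A y"] norm_diff_sq[of x y]
    by (simp add: bounded_clinearD(3)[OF A, symmetric] n)
  have "Im (cinner (A x) (A y)) = Im (cinner x y)"
    using R[of "\<i> *\<^sub>C x" y] by (simp add: bounded_clinearD(4)[OF A] cinner_simps)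
  with R show ?thesis by (simp add: complex_eq_iff)
qed

lemma inner_function_radial_limit:
  assumes "inner_function \<phi>"
  obtains N where "negligible N" "\<And>\<theta>. \<theta> \<in> {0..2 * pi} - N \<Longrightarrow>
    \<exists>w. ((\<lambda>r. \<phi> (of_real r * cis \<theta>)) \<longlongrightarrow> w) (at_left (1 :: real)) \<and> norm w = 1"
proof -
  have "AE \<theta> in lebesgue. \<theta> \<in> {0..2 * pi} \<longrightarrow>
      (\<exists>w. ((\<lambda>r. \<phi> (of_real r * cis \<theta>)) \<longlongrightarrow> w) (at_left (1 :: real)) \<and> norm w = 1)"
    using assms unfolding inner_function_def by (subst AE_restrict_space_iff[symmetric]) auto
  then obtain N where "N \<in> null_sets lebesgue" "{\<theta> \<in> space lebesgue. \<not> (\<theta> \<in> {0..2 * pi} \<longrightarrow>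
      (\<exists>w. ((\<lambda>r. \<phi> (of_real r * cis \<theta>)) \<longlongrightarrow> w) (at_left (1 :: real)) \<and> norm w = 1))} \<subseteq> N"
    unfolding eventually_ae_filter by blast
  note N = this
  show ?thesis
  proof (rule that[of N])
    show "negligible N" using N(1) by (simp add: negligible_iff_null_sets)
  qed (use N(2) in auto)
qed

text \<open>
  For a polynomial \<open>p\<close> the integral means of \<open>\<phi> p\<close> converge to the squared norm of \<open>\<phi> p\<close>; by dominated
  convergence they also converge to the mean of \<open>\<bar>p\<bar>\<^sup>2\<close> over the unit circle, as \<open>\<phi>\<close> has boundary values of
  modulus \<open>1\<close>. Polynomials are dense.
\<close>
lemma norm_toeplitz_inner:
  assumes \<phi>: "inner_function \<phi>"
  shows "norm (analytic_toeplitz \<phi> f) = norm f"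
proof -
  have bh: "bounded_holomorphic \<phi>" using \<phi> by (simp add: inner_function_def)
  obtain B where B: "B \<ge> 0" "\<And>z. norm z < 1 \<Longrightarrow> cmod (\<phi> z) \<le> B" using bounded_holomorphicD[OF bh] by blast
  obtain N where N: "negligible N" "\<And>\<theta>. \<theta> \<in> {0..2 * pi} - N \<Longrightarrow>
      \<exists>w. ((\<lambda>r. \<phi> (of_real r * cis \<theta>)) \<longlongrightarrow> w) (at_left (1 :: real)) \<and> norm w = 1"
    by (rule inner_function_radial_limit[OF \<phi>]) blast
  let ?p = "\<lambda>n f. \<Sum>i<n. hardy2_coeff f i *\<^sub>C monomial i"
  have poly: "norm (analytic_toeplitz \<phi> (?p n f)) = norm (?p n f)" for n f
  proof -
    define p where "p z = (\<Sum>i<n. hardy2_coeff f i * z ^ i)" for z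
    have p: "hardy2_fun (?p n f) z = p z" if "norm z < 1" for z
      unfolding p_def by (induction n) (simp_all add: hardy2_fun_simps hardy2_fun_monomial that)
    have cp: "continuous_on UNIV p" unfolding p_def by (intro continuous_intros)
    have "compact (p ` cball 0 1)"
      by (intro compact_continuous_image continuous_on_subset[OF cp]) auto
    from compact_imp_bounded[OF this] obtain P where "\<forall>x\<in>p ` cball 0 1. norm x \<le> P"
      unfolding bounded_iff by blast
    then have P: "cmod (p z) \<le> P" if "norm z \<le> 1" for z using that by simp
    have P0: "P \<ge> 0" using order_trans[OF norm_ge_zero P[of 0]] by simp
    have ib: "norm (of_real (radius k) * cis \<theta>) < 1" for \<theta> k using radius(1,2) by (simp add: norm_mult)
    let ?f = "analytic_toeplitz \<phi> (?p n f)"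
    \<comment> \<open>Zero on the exceptional set, so that the convergence becomes pointwise everywhere.\<close>
    let ?F = "\<lambda>k \<theta>. if \<theta> \<in> N then 0 else (cmod (hardy2_fun ?f (of_real (radius k) * cis \<theta>)))\<^sup>2"
    let ?g = "\<lambda>\<theta>. if \<theta> \<in> N then 0 else (cmod (p (cis \<theta>)))\<^sup>2"
    have 1: "(?F k has_integral 2 * pi * circle_mean (hardy2_fun ?f) (radius k)) {0..2 * pi}" for k
    proof (rule has_integral_spike[OF N(1)])
      show "((\<lambda>\<theta>. (cmod (hardy2_fun ?f (of_real (radius k) * cis \<theta>)))\<^sup>2) has_integral
          2 * pi * circle_mean (hardy2_fun ?f) (radius k)) {0..2 * pi}"
        using integrable_integral[OF circle_mean_hardy2(3)[OF radius(1,2)]] by (simp add: circle_mean_def)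
    qed auto
    have 2: "(?g has_integral 2 * pi * (norm ?f)\<^sup>2) {0..2 * pi}"
    proof (rule has_integral_dominated_convergence[OF 1])
      show "(\<lambda>_. (B * P)\<^sup>2) integrable_on {0..2 * pi}" by (rule integrable_const_ivl)
      show "\<forall>\<theta>\<in>{0..2 * pi}. norm (?F k \<theta>) \<le> (B * P)\<^sup>2" for k
      proof
        fix \<theta>
        have "cmod (\<phi> (of_real (radius k) * cis \<theta>) * p (of_real (radius k) * cis \<theta>)) \<le> B * P"
          unfolding norm_mult using ib by (intro mult_mono B P less_imp_le[OF ib]) (auto intro: B)
        then show "norm (?F k \<theta>) \<le> (B * P)\<^sup>2"
          by (auto simp: toeplitz_apply[OF bh ib] p[OF ib] intro!: power_mono)
      qed
      show "\<forall>\<theta>\<in>{0..2 * pi}. (\<lambda>k. ?F k \<theta>) \<longlonglongrightarrow> ?g \<theta>"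
      proof
        fix \<theta> assume \<theta>: "\<theta> \<in> {0..2 * pi}"
        show "(\<lambda>k. ?F k \<theta>) \<longlonglongrightarrow> ?g \<theta>"
        proof (cases "\<theta> \<in> N")
          case False
          then obtain w where w: "((\<lambda>r. \<phi> (of_real r * cis \<theta>)) \<longlongrightarrow> w) (at_left 1)" "norm w = 1"
            using N(2)[of \<theta>] \<theta> by blast
          have "(\<lambda>k. \<phi> (of_real (radius k) * cis \<theta>)) \<longlonglongrightarrow> w"
            by (rule filterlim_compose[OF w(1) radius(3)])
          moreover have "(\<lambda>k. p (of_real (radius k) * cis \<theta>)) \<longlonglongrightarrow> p (of_real 1 * cis \<theta>)"
            by (intro continuous_on_tendsto_compose[OF cp] tendsto_intros radius(4)) auto
          ultimately have "(\<lambda>k. (cmod (\<phi> (of_real (radius k) * cis \<theta>) * p (of_real (radius k) * cis \<theta>)))\<^sup>2)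
              \<longlonglongrightarrow> (cmod (w * p (of_real 1 * cis \<theta>)))\<^sup>2"
            by (intro tendsto_intros)
          then show ?thesis
            using False w(2) by (simp add: toeplitz_apply[OF bh ib] p[OF ib] norm_mult)
        qed simp
      qed
      show "(\<lambda>k. 2 * pi * circle_mean (hardy2_fun ?f) (radius k)) \<longlonglongrightarrow> 2 * pi * (norm ?f)\<^sup>2"
        by (intro tendsto_intros circle_mean_tendsto)
    qed
    have 3: "((\<lambda>\<theta>. (cmod (p (cis \<theta>)))\<^sup>2) has_integral 2 * pi * (norm ?f)\<^sup>2) {0..2 * pi}"
      by (rule has_integral_spike[OF N(1) _ 2]) auto
    have "((\<lambda>\<theta>. (cmod (p (cis \<theta>)))\<^sup>2) has_integral 2 * pi * (\<Sum>i<n. (cmod (hardy2_coeff f i))\<^sup>2)) {0..2 * pi}"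
      using trig_polynomial_parseval[where b = "hardy2_coeff f" and N = n] by (simp add: p_def Complex.DeMoivre)
    from has_integral_unique[OF 3 this] have "(norm ?f)\<^sup>2 = (\<Sum>i<n. (cmod (hardy2_coeff f i))\<^sup>2)" by simp
    also have "\<dots> = (norm (?p n f))\<^sup>2" by (rule norm_polynomial_sq[symmetric])
    finally show ?thesis by simp
  qed
  have l: "(\<lambda>n. ?p n f) \<longlonglongrightarrow> f" using hardy2_expansion by (simp add: sums_def)
  have "(\<lambda>n. norm (analytic_toeplitz \<phi> (?p n f))) \<longlonglongrightarrow> norm (analytic_toeplitz \<phi> f)"
    by (intro tendsto_norm bounded_linear.tendsto[OF bounded_clinearD(1)[OF clinear_toeplitz[OF bh]]] l)
  moreover have "(\<lambda>n. norm (?p n f)) \<longlonglongrightarrow> norm f" by (intro tendsto_norm l)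
  ultimately show ?thesis unfolding poly by (rule LIMSEQ_unique)
qed

text \<open>
  The powers \<open>\<phi>\<^sup>n\<close> all have norm \<open>1\<close> in the Hardy space, where evaluation at \<open>z\<close> is bounded, so the numbers
  \<open>\<phi>(z)\<^sup>n\<close> stay bounded.
\<close>
lemma inner_function_le_1:
  assumes \<phi>: "inner_function \<phi>" and z: "norm z < 1"
  shows "cmod (\<phi> z) \<le> 1"
proof (rule ccontr)
  assume "\<not> cmod (\<phi> z) \<le> 1"
  then have gt: "cmod (\<phi> z) > 1" by simp
  have bh: "bounded_holomorphic \<phi>" using \<phi> by (simp add: inner_function_def)
  obtain k where k: "\<And>f. hardy2_fun f z = cinner f k" by (rule hardy2_reproducing_kernel[OF z]) blast
  have "norm ((analytic_toeplitz \<phi> ^^ n) (monomial 0)) = norm (monomial 0)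
      \<and> hardy2_fun ((analytic_toeplitz \<phi> ^^ n) (monomial 0)) z = \<phi> z ^ n" for n
    by (induction n) (simp_all add: norm_toeplitz_inner[OF \<phi>] toeplitz_apply[OF bh z] hardy2_fun_monomial[OF z])
  then have "cmod (\<phi> z) ^ n \<le> norm (monomial 0) * norm k" for n
    using cinner_Cauchy_Schwarz[of "(analytic_toeplitz \<phi> ^^ n) (monomial 0)" k]
    by (simp add: k[symmetric] norm_power)
  moreover obtain n where "norm (monomial 0) * norm k < cmod (\<phi> z) ^ n"
    using real_arch_pow[OF gt] by blast
  ultimately show False by (meson not_le)
qed

section \<open>Rational inner functions\<close>

lemma poly_prod_list_roots: "poly (\<Prod>a\<leftarrow>as. [:- a, 1:]) z = (\<Prod>a\<leftarrow>as. z - a)"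
  for z :: "'a::comm_ring_1"
  by (induction as) (auto simp: algebra_simps)

lemma poly_extract_disc_roots:
  fixes p :: "complex poly"
  assumes "p \<noteq> 0"
  obtains as p0 where "p = (\<Prod>a\<leftarrow>as. [:- a, 1:]) * p0" "\<And>a. a \<in> set as \<Longrightarrow> norm a < 1"
    "\<And>z. norm z < 1 \<Longrightarrow> poly p0 z \<noteq> 0"
proof -
  have "\<exists>as p0. p = (\<Prod>a\<leftarrow>as. [:- a, 1:]) * p0 \<and> (\<forall>a\<in>set as. norm a < 1) \<and>
      (\<forall>z. norm z < 1 \<longrightarrow> poly p0 z \<noteq> 0)"
    using assms
  proof (induction "degree p" arbitrary: p rule: less_induct)
    case less
    show ?case
    proof (cases "\<exists>a. norm a < 1 \<and> poly p a = 0")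
      case True
      then obtain a where a: "norm a < 1" "poly p a = 0" by blast
      then obtain q where q: "p = [:- a, 1:] * q" by (auto simp: poly_eq_0_iff_dvd elim: dvdE)
      have "q \<noteq> 0" using q less.prems by auto
      then have "degree q < degree p" unfolding q by (subst degree_mult_eq) auto
      from less.hyps[OF this \<open>q \<noteq> 0\<close>] obtain as p0 where
        "q = (\<Prod>a\<leftarrow>as. [:- a, 1:]) * p0" "\<forall>a\<in>set as. norm a < 1" "\<forall>z. norm z < 1 \<longrightarrow> poly p0 z \<noteq> 0"
        by blast
      then show ?thesis
        unfolding q using a
        by (intro exI[of _ "a # as"] exI[of _ p0]) (simp only: list.map prod_list.Cons mult.assoc, simp)
    next
      case False
      then show ?thesis by (intro exI[of _ "[]"] exI[of _ p]) auto
    qed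
  qed
  then show ?thesis using that by blast
qed

text \<open>
  A root of \<open>q\<close> in the closed disc is also a root of \<open>p\<close>, because \<open>\<bar>p\<bar> \<le> \<bar>q\<bar>\<close> there, and the common factor can be
  divided out.
\<close>
lemma rational_cancel_disc_poles:
  fixes p q :: "complex poly"
  assumes hol: "\<phi> holomorphic_on ball 0 1" and le: "\<And>z. norm z < 1 \<Longrightarrow> cmod (\<phi> z) \<le> 1"
    and "q \<noteq> 0" and "\<And>z. norm z < 1 \<Longrightarrow> poly q z * \<phi> z = poly p z"
  shows "\<exists>p' q'. (\<forall>z. norm z \<le> 1 \<longrightarrow> poly q' z \<noteq> 0) \<and> (\<forall>z. norm z < 1 \<longrightarrow> poly q' z * \<phi> z = poly p' z)"
  using assms(3,4)
proof (induction "degree q" arbitrary: p q rule: less_induct)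
  case less
  show ?case
  proof (cases "\<exists>a. norm a \<le> 1 \<and> poly q a = 0")
    case True
    then obtain a where a: "norm a \<le> 1" "poly q a = 0" by blast
    have "closed {z. cmod (poly p z) \<le> cmod (poly q z)}"
      by (intro closed_Collect_le continuous_intros)
    moreover have "ball 0 1 \<subseteq> {z. cmod (poly p z) \<le> cmod (poly q z)}"
    proof
      fix z :: complex assume "z \<in> ball 0 1"
      then have z: "norm z < 1" by simp
      then show "z \<in> {z. cmod (poly p z) \<le> cmod (poly q z)}"
        by (simp add: less.prems(2)[OF z, symmetric] norm_mult mult_left_le le)
    qed
    ultimately have "closure (ball 0 1) \<subseteq> {z. cmod (poly p z) \<le> cmod (poly q z)}"
      by (rule closure_minimal[rotated])
    moreover have "a \<in> closure (ball 0 1)" using a by simp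
    ultimately have "cmod (poly p a) \<le> cmod (poly q a)" by blast
    then have "poly p a = 0" using a by simp
    then obtain p1 where p1: "p = [:- a, 1:] * p1" by (auto simp: poly_eq_0_iff_dvd elim: dvdE)
    obtain q1 where q1: "q = [:- a, 1:] * q1" using a by (auto simp: poly_eq_0_iff_dvd elim: dvdE)
    have "q1 \<noteq> 0" using q1 less.prems by auto
    then have "degree q1 < degree q" unfolding q1 by (subst degree_mult_eq) auto
    moreover have ne: "poly q1 z * \<phi> z = poly p1 z" if "norm z < 1" "z \<noteq> a" for z
    proof -
      have "(z - a) * (poly q1 z * \<phi> z) = (z - a) * poly p1 z"
        using less.prems(2)[OF that(1)] by (simp add: p1 q1 algebra_simps)
      then show ?thesis using that(2) by simp
    qed
    have "poly q1 z * \<phi> z = poly p1 z" if z: "norm z < 1" for z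
    proof (cases "z = a")
      case True
      let ?h = "\<lambda>z. poly q1 z * \<phi> z - poly p1 z"
      have "continuous_on (ball 0 1) ?h"
        by (intro continuous_intros holomorphic_on_imp_continuous_on[OF hol])
      then have "isCont ?h z" using z by (simp add: continuous_on_eq_continuous_at)
      then have "(?h \<longlongrightarrow> ?h z) (at z)" by (simp add: isCont_def)
      moreover have "\<forall>\<^sub>F w in at z. w \<in> ball 0 1 - {z}"
        using z by (intro eventually_at_in_open) auto
      then have "\<forall>\<^sub>F w in at z. 0 = ?h w"
        by eventually_elim (use ne True in auto)
      then have "(?h \<longlongrightarrow> 0) (at z)" by (rule Lim_transform_eventually[OF tendsto_const])
      ultimately have "?h z = 0" by (intro tendsto_unique[of "at z" ?h]) auto
      then show ?thesis by simp
    qed (use ne z in blast)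
    ultimately show ?thesis using less.hyps[of q1 p1] \<open>q1 \<noteq> 0\<close> by blast
  next
    case False
    then show ?thesis using less.prems by blast
  qed
qed

text \<open>
  After cancellation \<open>p / q\<close> extends \<open>\<phi>\<close> continuously to the closed disc, and \<open>\<bar>p\<bar> = \<bar>q\<bar>\<close> holds on the whole
  circle since it holds on a dense subset. Dividing \<open>\<phi>\<close> by the Blaschke factors of the roots of \<open>p\<close> leaves
  a zero-free function \<open>g\<close> of modulus \<open>1\<close> on the circle; the maximum principle for \<open>g\<close> and \<open>1 / g\<close> makes it
  constant.
\<close>
lemma rational_inner_function_imp_blaschke:
  fixes p q :: "complex poly"
  assumes \<phi>: "inner_function \<phi>" and "q \<noteq> 0" and "\<And>z. norm z < 1 \<Longrightarrow> poly q z * \<phi> z = poly p z"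
  shows "finite_blaschke_product \<phi>"
proof -
  have hol: "\<phi> holomorphic_on ball 0 1" using \<phi> by (simp add: inner_function_def bounded_holomorphic_def)
  obtain p q where q: "\<And>z. norm z \<le> 1 \<Longrightarrow> poly q z \<noteq> 0"
    and pq: "\<And>z. norm z < 1 \<Longrightarrow> poly q z * \<phi> z = poly p z"
    using rational_cancel_disc_poles[OF hol inner_function_le_1[OF \<phi>] assms(2,3)] by metis
  obtain N where N: "negligible N" "\<And>\<theta>. \<theta> \<in> {0..2 * pi} - N \<Longrightarrow>
      \<exists>w. ((\<lambda>r. \<phi> (of_real r * cis \<theta>)) \<longlongrightarrow> w) (at_left (1 :: real)) \<and> norm w = 1"
    by (rule inner_function_radial_limit[OF \<phi>]) blast
  have ae: "cmod (poly p (cis \<theta>)) = cmod (poly q (cis \<theta>))" if \<theta>: "\<theta> \<in> {0..2 * pi} - N" for \<theta>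
  proof -
    obtain w where w: "((\<lambda>r. \<phi> (of_real r * cis \<theta>)) \<longlongrightarrow> w) (at_left 1)" "norm w = 1"
      using N(2)[OF \<theta>] by blast
    have c: "((\<lambda>r. poly f (of_real r * cis \<theta>)) \<longlongrightarrow> poly f (of_real 1 * cis \<theta>)) (at_left (1 :: real))" for f
      by (intro tendsto_intros)
    have "((\<lambda>r. poly q (of_real r * cis \<theta>) * \<phi> (of_real r * cis \<theta>)) \<longlongrightarrow> poly q (of_real 1 * cis \<theta>) * w) (at_left 1)"
      by (intro tendsto_mult c w)
    moreover have "\<forall>\<^sub>F r in at_left (1 :: real). r \<in> {0<..<1}"
      by (rule eventually_at_left_real) simp
    then have "\<forall>\<^sub>F r in at_left 1. poly q (of_real r * cis \<theta>) * \<phi> (of_real r * cis \<theta>) = poly p (of_real r * cis \<theta>)"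
      by eventually_elim (simp add: pq norm_mult)
    ultimately have "((\<lambda>r. poly p (of_real r * cis \<theta>)) \<longlongrightarrow> poly q (of_real 1 * cis \<theta>) * w) (at_left 1)"
      by (rule Lim_transform_eventually)
    from tendsto_unique[OF _ c this] show ?thesis by (simp add: norm_mult w)
  qed
  have circle: "cmod (poly p z) = cmod (poly q z)" if z: "norm z = 1" for z
  proof -
    let ?C = "{\<theta>. cmod (poly p (cis \<theta>)) = cmod (poly q (cis \<theta>))}"
    have C: "closed ?C" by (intro closed_Collect_eq continuous_intros)
    have "{0<..<2 * pi} - ?C \<subseteq> N" using ae by force
    then have "negligible ({0<..<2 * pi} - ?C)" by (rule negligible_subset[OF N(1)])
    moreover have "open ({0<..<2 * pi} - ?C)" using C by (intro open_Diff) auto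
    ultimately have "{0<..<2 * pi} \<subseteq> ?C" using open_not_negligible by blast
    then have "closure {0<..<2 * pi} \<subseteq> ?C" using C by (rule closure_minimal)
    moreover have "Arg2pi z \<in> closure {0<..<2 * pi}"
      using Arg2pi_ge_0[of z] Arg2pi_lt_2pi[of z] by simp
    moreover have "z = cis (Arg2pi z)" using Arg2pi_eq[of z] z by (simp add: cis_conv_exp)
    ultimately show ?thesis by (metis (mono_tags) mem_Collect_eq subsetD)
  qed
  have "poly p 1 \<noteq> 0" using circle[of 1] q[of 1] by force
  then have "p \<noteq> 0" by auto
  then obtain as p0 where p: "p = (\<Prod>a\<leftarrow>as. [:- a, 1:]) * p0"
    and as: "\<And>a. a \<in> set as \<Longrightarrow> norm a < 1" and p0: "\<And>z. norm z < 1 \<Longrightarrow> poly p0 z \<noteq> 0"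
    by (rule poly_extract_disc_roots) blast
  define d where "d z = (\<Prod>a\<leftarrow>as. 1 - cnj a * z)" for z
  define g where "g z = d z * poly p0 z / poly q z" for z
  have d0: "d z \<noteq> 0" if "norm z \<le> 1" for z
  proof
    assume "d z = 0"
    then obtain a where a: "a \<in> set as" "cnj a * z = 1" unfolding d_def by (auto simp: prod_list_zero_iff)
    have "cmod (cnj a * z) \<le> cmod a * 1" using that by (simp add: norm_mult mult_left_le)
    with a as[of a] show False by simp
  qed
  have d1: "cmod (d z) = cmod (\<Prod>a\<leftarrow>as. z - a)" if "norm z = 1" for z
  proof -
    have "cmod (1 - cnj a * z) = cmod (z - a)" for a
    proof -
      have "1 - cnj a * z = cnj (z - a) * z"
        using that by (simp add: algebra_simps) (simp add: complex_mult_cnj cmod_def)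
      then show ?thesis using that by (simp add: norm_mult del: complex_cnj_diff)
    qed
    then show ?thesis unfolding d_def by (induction as) (auto simp: norm_mult)
  qed
  have hd: "d holomorphic_on UNIV" unfolding d_def by (induction as) (auto intro!: holomorphic_intros)
  have g0: "g z \<noteq> 0" if "norm z \<le> 1" for z
  proof (cases "norm z < 1")
    case True
    then show ?thesis using p0[OF True] q[OF that] d0[OF that] by (simp add: g_def)
  next
    case False
    then have z: "norm z = 1" using that by simp
    then have "poly p z \<noteq> 0" using circle[OF z] q[OF that] by force
    then have "poly p0 z \<noteq> 0" by (simp add: p)
    then show ?thesis using q[OF that] d0[OF that] by (simp add: g_def)
  qed
  have hg: "g holomorphic_on cball 0 1"
    unfolding g_def by (intro holomorphic_intros holomorphic_on_subset[OF hd]) (use q in auto)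
  then have hg': "(\<lambda>z. inverse (g z)) holomorphic_on cball 0 1"
    by (intro holomorphic_intros) (use g0 in auto)
  have g1: "cmod (g z) = 1" if "norm z = 1" for z
    using circle[OF that] q[of z] that unfolding g_def norm_divide norm_mult d1[OF that]
    by (simp add: p poly_prod_list_roots norm_mult)
  have gb: "cmod (g z) = 1" if z: "norm z < 1" for z
  proof (rule antisym)
    show "cmod (g z) \<le> 1"
      by (rule maximum_modulus_frontier[of g "cball 0 1"])
        (use z g1 in \<open>auto intro: holomorphic_on_subset[OF hg] holomorphic_on_imp_continuous_on[OF hg]\<close>)
    have "cmod (inverse (g z)) \<le> 1"
      by (rule maximum_modulus_frontier[of "\<lambda>z. inverse (g z)" "cball 0 1"])
        (use z g1 in \<open>auto simp: norm_inverse intro: holomorphic_on_subset[OF hg'] holomorphic_on_imp_continuous_on[OF hg']\<close>)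
    then show "1 \<le> cmod (g z)"
      using g0[of z] z unfolding norm_inverse by (simp add: inverse_le_1_iff)
  qed
  have "g constant_on ball 0 1"
    by (rule maximum_modulus_principle[of _ _ "ball 0 1" 0])
      (use gb in \<open>auto intro: holomorphic_on_subset[OF hg]\<close>)
  then obtain c where c: "\<And>z. norm z < 1 \<Longrightarrow> g z = c" unfolding constant_on_def by auto
  have "\<phi> z = c * (\<Prod>a\<leftarrow>as. Moebius_function 0 a z)" if z: "norm z < 1" for z
  proof -
    have M: "d z * (\<Prod>a\<leftarrow>as. Moebius_function 0 a z) = (\<Prod>a\<leftarrow>as. z - a)"
    proof -
      have "(\<Prod>a\<leftarrow>bs. 1 - cnj a * z) * (\<Prod>a\<leftarrow>bs. Moebius_function 0 a z) = (\<Prod>a\<leftarrow>bs. z - a)"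
        if "set bs \<subseteq> set as" for bs
        using that
      proof (induction bs)
        case (Cons a bs)
        have "cmod (cnj a * z) \<le> cmod a * 1" unfolding norm_mult using z by (intro mult_mono) auto
        then have "1 - cnj a * z \<noteq> 0" using as[of a] Cons.prems by force
        then have "(1 - cnj a * z) * Moebius_function 0 a z = z - a" by (simp add: Moebius_function_def)
        with Cons show ?case by (simp add: mult_ac)
      qed simp
      then show ?thesis by (simp add: d_def)
    qed
    have "\<phi> z = poly p z / poly q z" using pq[OF z] q[of z] z by (simp add: field_simps)
    also have "\<dots> = g z * (\<Prod>a\<leftarrow>as. Moebius_function 0 a z)"
      unfolding g_def p poly_mult poly_prod_list_roots M[symmetric] by simp
    finally show ?thesis by (simp add: c[OF z])
  qed
  moreover have "cmod c = 1" using gb[of 0] c[of 0] by simp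
  ultimately show ?thesis unfolding finite_blaschke_product_def using as by (intro exI[of _ c] exI[of _ as]) auto
qed

section \<open>The kernel of the adjoint of an inner multiplier\<close>

lemma span_image_lessThan:
  assumes "x \<in> complex_space.span (s ` {..<n::nat})"
  obtains c where "x = (\<Sum>j<n. c j *\<^sub>C s j)"
proof -
  let ?S = "range (\<lambda>c. \<Sum>j<n. c j *\<^sub>C s j)"
  have "s i \<in> ?S" if "i < n" for i
    using that
    by (intro range_eqI[of _ _ "\<lambda>j. if j = i then 1 else 0"])
      (simp add: if_distrib[of "\<lambda>t. t *\<^sub>C _"] cong: if_cong)
  then have "s ` {..<n} \<subseteq> ?S" by blast
  moreover have "complex_space.subspace ?S"
  proof (rule complex_space.subspaceI)
    show "0 \<in> ?S" by (rule range_eqI[of _ _ "\<lambda>_. 0"]) simp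
    fix x y assume "x \<in> ?S" "y \<in> ?S"
    then obtain c d where "x = (\<Sum>j<n. c j *\<^sub>C s j)" "y = (\<Sum>j<n. d j *\<^sub>C s j)" by blast
    then show "x + y \<in> ?S"
      by (intro range_eqI[of _ _ "\<lambda>j. c j + d j"]) (simp add: scaleC_add_left sum.distrib)
  next
    fix c x assume "x \<in> ?S"
    then obtain d where "x = (\<Sum>j<n. d j *\<^sub>C s j)" by blast
    then show "c *\<^sub>C x \<in> ?S"
      by (intro range_eqI[of _ _ "\<lambda>j. c * d j"]) (simp add: complex_space.scale_sum_right)
  qed
  ultimately have "complex_space.span (s ` {..<n}) \<subseteq> ?S" by (rule complex_space.span_minimal)
  then show ?thesis using assms that by blast
qed

lemma bounded_holomorphic_power: "bounded_holomorphic (\<lambda>z. z ^ n)"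
  by (rule bounded_holomorphicI[of _ 1]) (auto intro!: holomorphic_intros simp: norm_power power_le_one)

lemma toeplitz_power_monomial: "analytic_toeplitz (\<lambda>z. z ^ n) (monomial m) = monomial (n + m)"
  by (rule hardy2_eqI) (simp add: toeplitz_apply bounded_holomorphic_power hardy2_fun_monomial power_add)

lemma hardy2_fun_0: "hardy2_fun f 0 = hardy2_coeff f 0"
  using hardy2_fun_sums[of 0 f] by (simp add: powser_sums_zero_iff)

text \<open>
  The vectors \<open>s j\<close> are the iterated backward shifts of \<open>\<phi>\<close>, with coefficients \<open>a\<^sub>n\<^sub>+\<^sub>j\<^sub>+\<^sub>1\<close>. They lie in the
  kernel since \<open>\<langle>\<phi> f, s j\<rangle> = \<langle>\<phi> z\<^bsup>j+1\<^esup> f, \<phi>\<rangle> = \<langle>z\<^bsup>j+1\<^esup> f, 1\<rangle> = 0\<close>. If they are linearly independent, the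
  Gram-Schmidt process yields the orthonormal sequence.
\<close>
lemma toeplitz_adjoint_kernel_infinite:
  assumes \<phi>: "inner_function \<phi>" and nb: "\<not> finite_blaschke_product \<phi>"
  obtains g where "\<And>k. hilbert_adjoint (analytic_toeplitz \<phi>) (g k) = 0"
    "\<And>m n :: nat. cinner (g m) (g n) = (if m = n then 1 else 0)"
proof -
  have bh: "bounded_holomorphic \<phi>" using \<phi> by (simp add: inner_function_def)
  let ?F = "analytic_toeplitz \<phi> (monomial 0)"
  let ?a = "hardy2_coeff ?F"
  define s where "s j = hilbert_adjoint (analytic_toeplitz (\<lambda>z. z ^ Suc j)) ?F" for j
  note adjz = hilbert_adjoint[OF clinear_toeplitz[OF bounded_holomorphic_power]]
  note adj = hilbert_adjoint[OF clinear_toeplitz[OF bh]]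
  have F: "hardy2_fun ?F z = \<phi> z" if "norm z < 1" for z
    using that by (simp add: toeplitz_apply bh hardy2_fun_monomial)
  have ker: "hilbert_adjoint (analytic_toeplitz \<phi>) (s j) = 0" for j
  proof (rule cinner_eq_0_imp_0)
    fix x
    have "analytic_toeplitz (\<lambda>z. z ^ Suc j) (analytic_toeplitz \<phi> x)
        = analytic_toeplitz \<phi> (analytic_toeplitz (\<lambda>z. z ^ Suc j) x)"
      unfolding toeplitz_mult[OF bounded_holomorphic_power bh] toeplitz_mult[OF bh bounded_holomorphic_power]
      by (simp only: mult.commute)
    then have "cinner x (hilbert_adjoint (analytic_toeplitz \<phi>) (s j))
        = cinner (analytic_toeplitz \<phi> (analytic_toeplitz (\<lambda>z. z ^ Suc j) x)) ?F"
      unfolding s_def adj[symmetric] adjz[symmetric] by simp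
    also have "\<dots> = cinner (analytic_toeplitz (\<lambda>z. z ^ Suc j) x) (monomial 0)"
      by (rule isometry_cinner[OF clinear_toeplitz[OF bh] norm_toeplitz_inner[OF \<phi>]])
    also have "\<dots> = 0"
      unfolding cinner_monomial hardy2_fun_0[symmetric]
      by (subst toeplitz_apply[OF bounded_holomorphic_power]) auto
    finally show "cinner x (hilbert_adjoint (analytic_toeplitz \<phi>) (s j)) = 0" .
  qed
  have coeff: "hardy2_coeff (s j) n = ?a (n + Suc j)" for j n
  proof -
    have "cinner (monomial n) (s j) = cinner (monomial (Suc j + n)) ?F"
      unfolding s_def adjz[symmetric] toeplitz_power_monomial ..
    then have "cinner (s j) (monomial n) = cinner ?F (monomial (Suc j + n))"
      by (metis cinner_commute)
    then show ?thesis by (simp add: cinner_monomial add.commute)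
  qed
  have split: "z ^ Suc j * hardy2_fun (s j) z = \<phi> z - (\<Sum>m<Suc j. ?a m * z ^ m)" if z: "norm z < 1" for z j
  proof -
    have "(\<lambda>n. z ^ Suc j * (hardy2_coeff (s j) n * z ^ n)) sums (z ^ Suc j * hardy2_fun (s j) z)"
      by (intro sums_mult hardy2_fun_sums z)
    moreover have "(\<lambda>n. z ^ Suc j * (hardy2_coeff (s j) n * z ^ n)) = (\<lambda>n. ?a (n + Suc j) * z ^ (n + Suc j))"
      unfolding coeff power_add by (simp add: mult_ac)
    moreover have "(\<lambda>n. ?a (n + Suc j) * z ^ (n + Suc j)) sums (\<phi> z - (\<Sum>m<Suc j. ?a m * z ^ m))"
      using sums_split_initial_segment[OF hardy2_fun_sums[OF z, of ?F], of "Suc j"] unfolding F[OF z] .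
    ultimately show ?thesis by (simp only: sums_unique2)
  qed
  have indep: "s n \<notin> complex_space.span (s ` {..<n})" for n
  proof
    assume "s n \<in> complex_space.span (s ` {..<n})"
    then obtain c where c: "s n = (\<Sum>j<n. c j *\<^sub>C s j)" by (rule span_image_lessThan)
    \<comment> \<open>Multiply the relation by \<open>z\<^bsup>n+1\<^esup>\<close> and use that \<open>z\<^bsup>j+1\<^esup> s\<^sub>j\<close> differs from \<open>\<phi>\<close> by the Taylor polynomial \<open>t j\<close>;
      the exponents \<open>n - j\<close> are positive, whence \<open>q 0 = 1\<close>.\<close>
    define t where "t j = (\<Sum>m<Suc j. monom (?a m) m)" for j
    define q where "q = 1 - (\<Sum>j<n. monom (c j) (n - j))"
    define p where "p = t n - (\<Sum>j<n. monom (c j) (n - j) * t j)"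
    have t: "poly (t j) z = (\<Sum>m<Suc j. ?a m * z ^ m)" for j z
      by (simp only: t_def poly_sum poly_monom)
    have "poly q z * \<phi> z = poly p z" if z: "norm z < 1" for z
    proof -
      have "hardy2_fun (\<Sum>j<k. c j *\<^sub>C s j) z = (\<Sum>j<k. c j * hardy2_fun (s j) z)" for k
        by (induction k) (simp_all add: hardy2_fun_simps)
      from this[of n] have "\<phi> z - poly (t n) z = z ^ Suc n * (\<Sum>j<n. c j * hardy2_fun (s j) z)"
        unfolding t split[OF z, symmetric] c[symmetric] by simp
      also have "\<dots> = (\<Sum>j<n. c j * z ^ (n - j) * (\<phi> z - poly (t j) z))"
        unfolding sum_distrib_left
      proof (rule sum.cong)
        fix j assume "j \<in> {..<n}"
        then have "z ^ Suc n = z ^ (n - j) * z ^ Suc j" by (simp only: power_add[symmetric]) simp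
        then show "z ^ Suc n * (c j * hardy2_fun (s j) z) = c j * z ^ (n - j) * (\<phi> z - poly (t j) z)"
          unfolding t split[OF z, symmetric] by (simp only: mult_ac)
      qed simp
      finally show ?thesis
        by (simp add: q_def p_def poly_sum poly_monom algebra_simps sum_subtractf sum_distrib_left)
    qed
    moreover have "poly q 0 = 1"
      by (simp add: q_def poly_sum poly_monom power_0_left)
    then have "q \<noteq> 0" by auto
    ultimately show False using rational_inner_function_imp_blaschke[OF \<phi>] nb by blast
  qed
  note gs = gram_schmidt_orthonormal[of s, OF indep]
  have "complex_space.subspace {x. hilbert_adjoint (analytic_toeplitz \<phi>) x = 0}"
  proof -
    have "norm (analytic_toeplitz \<phi> x) \<le> 1 * norm x" for x by (simp add: norm_toeplitz_inner[OF \<phi>])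
    note lin = bounded_clinearD[OF clinear_hilbert_adjoint(1)[OF clinear_toeplitz[OF bh] this]]
    show ?thesis by (rule complex_space.subspaceI) (auto simp: lin)
  qed
  then have "complex_space.span (s ` {..k}) \<subseteq> {x. hilbert_adjoint (analytic_toeplitz \<phi>) x = 0}" for k
    by (intro complex_space.span_minimal) (auto simp: ker)
  then show ?thesis using that[of "gram_schmidt s"] gs by blast
qed

section \<open>Isometric models of strongly stable contractions\<close>

lemma isometry_powers_kernel_orthogonal:
  assumes S: "bounded_clinear S" "\<And>x. norm (S x) = norm x"
    and adj: "\<And>x y. cinner (S x) y = cinner x (A y)" and u: "A u = 0" and "m < n"
  shows "cinner ((S ^^ n) v) ((S ^^ m) u) = 0"
  using \<open>m < n\<close>
proof (induction m arbitrary: n)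
  case 0
  then obtain k where "n = Suc k" by (cases n) auto
  then show ?case by (simp add: adj u)
next
  case (Suc m)
  then obtain k where "n = Suc k" "m < k" by (cases n) auto
  then show ?case using Suc.IH by (simp add: isometry_cinner[OF S])
qed

text \<open>
  The defect form of \<open>V\<close> is a sum of squares of functionals \<open>D k\<close>; placing these along the orthonormal
  sequence \<open>g\<close> gives \<open>L\<close> with values in the kernel of \<open>A\<close> and \<open>\<parallel>L x\<parallel>\<^sup>2 = \<parallel>x\<parallel>\<^sup>2 - \<parallel>V x\<parallel>\<^sup>2\<close>. The terms
  \<open>S\<^sup>n L V\<^sup>n x\<close> are pairwise orthogonal, and their squared norms telescope to \<open>\<parallel>x\<parallel>\<^sup>2\<close> because \<open>V\<^sup>n x\<close> tends to
  \<open>0\<close>. The operator \<open>A\<close> deletes the term with \<open>n = 0\<close> and shifts the others.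
\<close>
lemma contraction_model:
  fixes V :: "'a::complex_hilbert_space \<Rightarrow> 'a" and S :: "'h::complex_hilbert_space \<Rightarrow> 'h"
  assumes sep: "separable_space (euclidean :: 'a topology)"
    and V: "bounded_clinear V" "\<And>x. norm (V x) \<le> norm x" "\<And>x. (\<lambda>n. norm ((V ^^ n) x)) \<longlonglongrightarrow> 0"
    and S: "bounded_clinear S" "\<And>x. norm (S x) = norm x"
    and A: "bounded_clinear A" "\<And>x y. cinner (S x) y = cinner x (A y)"
    and g: "\<And>k. A (g k) = 0" "\<And>m n :: nat. cinner (g m) (g n) = (if m = n then 1 else 0)"
  obtains W where "bounded_clinear W" "\<And>x. norm (W x) = norm x" "\<And>x. A (W x) = W (V x)"
proof -
  define B where "B x y = cinner x y - cinner (V x) (V y)" for x y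
  note Vl = bounded_clinearD[OF V(1)] and Sl = bounded_clinearD[OF S(1)] and Al = bounded_clinearD[OF A(1)]
  have Q: "Re (B x x) = (norm x)\<^sup>2 - (norm (V x))\<^sup>2" for x
    by (simp add: B_def norm_sq_cinner)
  have Bpsd: "psd_form B"
    unfolding psd_form_def
  proof (intro conjI allI)
    show "B x y = cnj (B y x)" for x y
      unfolding B_def complex_cnj_diff by (metis cinner_commute)
    show "0 \<le> Re (B x x)" for x
      unfolding Q using power_mono[OF V(2)[of x] norm_ge_zero, of 2] by simp
  qed (simp_all add: B_def Vl cinner_simps algebra_simps)
  have Ble: "Re (B x x) \<le> (norm x)\<^sup>2" for x unfolding Q by simp
  obtain D where D: "\<And>k x y. D k (x + y) = D k x + D k y" "\<And>k c x. D k (c *\<^sub>C x) = c * D k x"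
    "\<And>x. (\<lambda>k::nat. (cmod (D k x))\<^sup>2) sums Re (B x x)"
    by (rule psd_form_sum_of_squares[OF Bpsd Ble sep]) blast
  have ng: "norm (g k) = 1" for k
  proof -
    have "(norm (g k))\<^sup>2 = 1" by (simp add: norm_sq_cinner g)
    then show ?thesis using norm_ge_zero[of "g k"] by (simp add: power2_eq_1_iff)
  qed
  define L where "L x = (\<Sum>k. D k x *\<^sub>C g k)" for x
  have Lorth: "cinner (D m x *\<^sub>C g m) (D n x *\<^sub>C g n) = 0" if "m \<noteq> n" for m n x
    using that by (simp add: cinner_simps g)
  have Lsq: "(\<lambda>k. (norm (D k x *\<^sub>C g k))\<^sup>2) sums Re (B x x)" for x
    using D(3) by (simp add: norm_scaleC ng)
  have Lsum: "summable (\<lambda>k. D k x *\<^sub>C g k)" for x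
    by (rule orthogonal_series(1)[OF Lorth Lsq])
  have nL: "(norm (L x))\<^sup>2 = (norm x)\<^sup>2 - (norm (V x))\<^sup>2" for x
    unfolding L_def Q[symmetric] by (rule orthogonal_series(2)[OF Lorth Lsq])
  have Ladd: "L (x + y) = L x + L y" for x y
    unfolding L_def by (simp add: D scaleC_add_left suminf_add[OF Lsum Lsum])
  have Lscale: "L (c *\<^sub>C x) = c *\<^sub>C L x" for c x
    unfolding L_def by (simp add: D bounded_linear.suminf[OF bounded_linear_scaleC Lsum] scaleC_scaleC)
  have AL: "A (L x) = 0" for x
    unfolding L_def by (simp add: bounded_linear.suminf[OF Al(1) Lsum] Al g)
  define w where "w x n = (S ^^ n) (L ((V ^^ n) x))" for x n
  have nS: "norm ((S ^^ n) y) = norm y" for n y by (induction n) (auto simp: S)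
  have Sn: "bounded_clinear (S ^^ n)" for n
    by (induction n) (auto simp: o_def id_def intro: bounded_clinear_ident bounded_clinear_compose S)
  have Vn: "bounded_clinear (V ^^ n)" for n
    by (induction n) (auto simp: o_def id_def intro: bounded_clinear_ident bounded_clinear_compose V)
  have worth: "cinner (w x m) (w x n) = 0" if "m \<noteq> n" for m n x
  proof (cases "m < n")
    case True
    then have "cinner (w x n) (w x m) = 0"
      unfolding w_def by (intro isometry_powers_kernel_orthogonal[OF S A(2) AL])
    then show ?thesis by (subst cinner_commute) simp
  next
    case False
    then show ?thesis
      using that unfolding w_def by (intro isometry_powers_kernel_orthogonal[OF S A(2) AL]) auto
  qed
  have wsq: "(\<lambda>n. (norm (w x n))\<^sup>2) sums (norm x)\<^sup>2" for x
  proof -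
    have "(\<lambda>n. (norm ((V ^^ n) x))\<^sup>2) \<longlonglongrightarrow> 0\<^sup>2" by (intro tendsto_power V(3))
    from telescope_sums'[OF this] show ?thesis by (simp add: w_def nS nL)
  qed
  note wsum = orthogonal_series(1)[OF worth wsq]
  define W where "W x = suminf (w x)" for x
  have nW: "norm (W x) = norm x" for x
    using orthogonal_series(2)[OF worth wsq, of x] by (simp add: W_def)
  have wlin: "w (x + y) = (\<lambda>n. w x n + w y n)" "w (c *\<^sub>C x) = (\<lambda>n. c *\<^sub>C w x n)" for x y c
    by (auto simp: w_def bounded_clinearD[OF Vn] bounded_clinearD[OF Sn] Ladd Lscale)
  have AS: "A (S y) = y" for y
  proof -
    have "A (S y) - y = 0"
      by (rule cinner_eq_0_imp_0) (simp add: cinner_simps A(2)[symmetric] isometry_cinner[OF S])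
    then show ?thesis by simp
  qed
  show ?thesis
  proof (rule that[of W])
    show "bounded_clinear W"
    proof (rule bounded_clinearI[of _ 1])
      show "W (x + y) = W x + W y" for x y
        by (simp add: W_def wlin suminf_add[OF wsum wsum])
      show "W (c *\<^sub>C x) = c *\<^sub>C W x" for c x
        by (simp add: W_def wlin bounded_linear.suminf[OF bounded_linear_scaleC wsum])
    qed (simp add: nW)
    show "A (W x) = W (V x)" for x
    proof -
      have "A (W x) = (\<Sum>n. A (w x n))"
        unfolding W_def by (rule bounded_linear.suminf[OF Al(1) wsum])
      also have "\<dots> = (\<Sum>n. A (w x (Suc n)))"
        using suminf_split_head[OF bounded_linear.summable[OF Al(1) wsum[of x]]] by (simp add: w_def AL)
      also have "(\<lambda>n. A (w x (Suc n))) = w (V x)"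
      proof
        fix n
        have "(V ^^ Suc n) x = (V ^^ n) (V x)" by (simp add: funpow_swap1)
        then have "w x (Suc n) = S (w (V x) n)" unfolding w_def by simp
        then show "A (w x (Suc n)) = w (V x) n" by (simp add: AS)
      qed
      finally show ?thesis by (simp add: W_def)
    qed
  qed (rule nW)
qed

section \<open>Intertwining the Toeplitz semigroup\<close>

lemma Re_Cayley_le_0:
  assumes "cmod w \<le> 1" "w \<noteq> 1"
  shows "Re ((w + 1) / (w - 1)) \<le> 0"
proof -
  have "(w + 1) / (w - 1) = (w + 1) * cnj (w - 1) / of_real ((cmod (w - 1))\<^sup>2)"
    using assms(2) by (simp add: complex_norm_square divide_simps del: of_real_power)
  also have "Re \<dots> = ((cmod w)\<^sup>2 - 1) / (cmod (w - 1))\<^sup>2"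
    by (simp only: Re_divide_of_real) (simp add: cmod_power2 algebra_simps, simp add: power2_eq_square)
  also have "\<dots> \<le> 0"
    using assms(1) by (intro divide_nonpos_nonneg) (auto simp: abs_square_le_1)
  finally show ?thesis .
qed

lemma exp_Taylor_halfplane:
  assumes "Re a \<le> 0" "Re b \<le> 0"
  shows "cmod (exp b - exp a - (b - a) * exp a) \<le> (cmod (b - a))\<^sup>2"
proof -
  have "cmod (exp b - (\<Sum>i\<le>1. exp a * (b - a) ^ i / fact i)) \<le> 1 * cmod (b - a) ^ Suc 1 / fact 1"
  proof (rule complex_Taylor[where f = "\<lambda>_. exp" and S = "{z. Re z \<le> 0}"])
    show "convex {z. Re z \<le> 0}" by (rule convex_halfspace_Re_le)
  qed (use assms in \<open>auto intro!: derivative_eq_intros\<close>)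
  then show ?thesis by (simp add: algebra_simps power2_eq_square)
qed

lemma has_vector_derivative_quadratic:
  assumes "\<And>y. y \<in> S \<Longrightarrow> norm (f y - f x - (y - x) *\<^sub>R D) \<le> K * (y - x)\<^sup>2"
  shows "(f has_vector_derivative D) (at x within S)"
  unfolding has_vector_derivative_def has_derivative_iff_norm
proof
  show "((\<lambda>y. norm (f y - f x - (y - x) *\<^sub>R D) / norm (y - x)) \<longlongrightarrow> 0) (at x within S)"
  proof (rule tendsto_sandwich[where f = "\<lambda>_. 0" and h = "\<lambda>y. K * norm (y - x)"])
    show "\<forall>\<^sub>F y in at x within S. norm (f y - f x - (y - x) *\<^sub>R D) / norm (y - x) \<le> K * norm (y - x)"
      unfolding eventually_at_filter
    proof (rule always_eventually, intro allI impI)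
      fix y assume "y \<noteq> x" "y \<in> S"
      then show "norm (f y - f x - (y - x) *\<^sub>R D) / norm (y - x) \<le> K * norm (y - x)"
        using assms[of y] by (simp add: pos_divide_le_eq power2_eq_square[symmetric] mult.assoc)
    qed
    have "((\<lambda>y. K * norm (y - x)) \<longlongrightarrow> K * norm (x - x)) (at x within S)"
      by (intro tendsto_intros)
    then show "((\<lambda>y. K * norm (y - x)) \<longlongrightarrow> 0) (at x within S)" by simp
  qed auto
qed (rule bounded_linear_scaleR_left)

lemma toeplitz_cong:
  assumes "\<And>z. norm z < 1 \<Longrightarrow> g z = h z"
  shows "analytic_toeplitz g = analytic_toeplitz h"
proof -
  have "(\<lambda>z. if z \<in> ball 0 1 then g z * hardy2_fun f z else 0)
      = (\<lambda>z. if z \<in> ball 0 1 then h z * hardy2_fun f z else 0)" for f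
    using assms by (auto simp: fun_eq_iff)
  then show ?thesis by (auto simp: analytic_toeplitz_def fun_eq_iff)
qed

lemma adjoint_right:
  fixes A :: "hardy2 \<Rightarrow> hardy2"
  assumes "bounded_clinear A"
  shows "cinner x (A y) = cinner (hilbert_adjoint A x) y"
  using hilbert_adjoint[OF assms, of y x] by (metis cinner_commute)

locale schur_symbol =
  fixes \<phi> :: "complex \<Rightarrow> complex"
  assumes hol: "\<phi> holomorphic_on ball 0 1" and le_1: "norm z < 1 \<Longrightarrow> cmod (\<phi> z) \<le> 1"
    and ne_1: "norm z < 1 \<Longrightarrow> \<phi> z \<noteq> 1"
begin

definition cayley :: "complex \<Rightarrow> complex" where "cayley z = (\<phi> z + 1) / (\<phi> z - 1)"

definition E :: "real \<Rightarrow> hardy2 \<Rightarrow> hardy2" where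
  "E t = analytic_toeplitz (\<lambda>z. exp (of_real t * cayley z))"

text \<open>
  The adjoint of \<open>M\<close> is the resolvent at \<open>1\<close> of the Toeplitz semigroup, and \<open>M + N = 1\<close>. The symbol of \<open>M\<close>
  cancels the pole of the Cayley transform: \<open>cayley\<close> times the symbol of \<open>M\<close> is minus the symbol of \<open>N\<close>.
\<close>
definition M :: "hardy2 \<Rightarrow> hardy2" where "M = analytic_toeplitz (\<lambda>z. (1 - \<phi> z) / 2)"

definition N :: "hardy2 \<Rightarrow> hardy2" where "N = analytic_toeplitz (\<lambda>z. (1 + \<phi> z) / 2)"

lemma Re_cayley: "norm z < 1 \<Longrightarrow> Re (cayley z) \<le> 0"
  unfolding cayley_def by (intro Re_Cayley_le_0 le_1 ne_1)

lemma holomorphic_cayley: "cayley holomorphic_on ball 0 1"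
  unfolding cayley_def[abs_def] by (intro holomorphic_intros hol) (use ne_1 in auto)

lemma holomorphic_exp_cayley: "(\<lambda>z. exp (of_real t * cayley z)) holomorphic_on ball 0 1"
  by (intro holomorphic_intros holomorphic_cayley)

lemma norm_exp_cayley: "t \<ge> 0 \<Longrightarrow> norm z < 1 \<Longrightarrow> cmod (exp (of_real t * cayley z)) \<le> 1"
  using Re_cayley by (simp add: mult_nonneg_nonpos)

lemma symbols_bounded: "bounded_holomorphic \<phi>" "t \<ge> 0 \<Longrightarrow> bounded_holomorphic (\<lambda>z. exp (of_real t * cayley z))"
  "bounded_holomorphic (\<lambda>z. (1 - \<phi> z) / 2)" "bounded_holomorphic (\<lambda>z. (1 + \<phi> z) / 2)"
proof -
  show "bounded_holomorphic \<phi>" by (rule bounded_holomorphicI[OF hol le_1])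
  show "t \<ge> 0 \<Longrightarrow> bounded_holomorphic (\<lambda>z. exp (of_real t * cayley z))"
    by (rule bounded_holomorphicI[OF holomorphic_exp_cayley norm_exp_cayley])
  have b: "cmod ((1 - \<phi> z) / 2) \<le> 1" "cmod ((1 + \<phi> z) / 2) \<le> 1" if "norm z < 1" for z
    using le_1[OF that] norm_triangle_ineq4[of 1 "\<phi> z"] norm_triangle_ineq[of 1 "\<phi> z"]
    by (simp_all add: norm_divide)
  show "bounded_holomorphic (\<lambda>z. (1 - \<phi> z) / 2)" "bounded_holomorphic (\<lambda>z. (1 + \<phi> z) / 2)"
    by (rule bounded_holomorphicI[OF _ b(1)], intro holomorphic_intros hol; simp)
      (rule bounded_holomorphicI[OF _ b(2)], intro holomorphic_intros hol; simp)
qed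

lemma clinear_EMN: "t \<ge> 0 \<Longrightarrow> bounded_clinear (E t)" "bounded_clinear M" "bounded_clinear N"
  unfolding E_def M_def N_def by (intro clinear_toeplitz symbols_bounded; assumption)+

lemma apply_E: "t \<ge> 0 \<Longrightarrow> norm z < 1 \<Longrightarrow> hardy2_fun (E t f) z = exp (of_real t * cayley z) * hardy2_fun f z"
  and apply_M: "norm z < 1 \<Longrightarrow> hardy2_fun (M f) z = (1 - \<phi> z) / 2 * hardy2_fun f z"
  and apply_N: "norm z < 1 \<Longrightarrow> hardy2_fun (N f) z = (1 + \<phi> z) / 2 * hardy2_fun f z"
  unfolding E_def M_def N_def by (intro toeplitz_apply symbols_bounded; assumption)+

lemma E_0: "E 0 f = f"
  by (rule hardy2_eqI) (simp add: apply_E)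

lemma E_add: "s \<ge> 0 \<Longrightarrow> t \<ge> 0 \<Longrightarrow> E (s + t) f = E t (E s f)"
  by (rule hardy2_eqI) (simp add: apply_E algebra_simps exp_add)

lemma norm_E: "t \<ge> 0 \<Longrightarrow> norm (E t f) \<le> 1 * norm f"
  unfolding E_def by (rule norm_toeplitz_le[OF holomorphic_exp_cayley norm_exp_cayley])

text \<open>
  Strong differentiability comes from a bound on multipliers. One factor \<open>M\<close> for each factor of the
  unbounded \<open>cayley\<close> in the quadratic Taylor remainder of the exponential makes the remainder at most
  \<open>(s - t)\<^sup>2\<close> on the disc; this is why \<open>M\<close> is applied twice.
\<close>
lemma E_derivative:
  assumes t: "t \<ge> 0"
  shows "((\<lambda>t. E t (M (M f))) has_vector_derivative - E t (N (M f))) (at t within {0..})"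
proof (rule has_vector_derivative_quadratic[where K = "norm f"])
  fix s :: real assume "s \<in> {0..}"
  then have s: "s \<ge> 0" by simp
  let ?h = "\<lambda>z. (exp (of_real s * cayley z) - exp (of_real t * cayley z)
      - (of_real s * cayley z - of_real t * cayley z) * exp (of_real t * cayley z)) * ((1 - \<phi> z) / 2)\<^sup>2"
  have hh: "?h holomorphic_on ball 0 1"
    by (intro holomorphic_intros holomorphic_cayley hol) simp
  have cm: "cayley z * ((1 - \<phi> z) / 2) = - ((1 + \<phi> z) / 2)" if "norm z < 1" for z
    using ne_1[OF that] by (simp add: cayley_def divide_simps) (simp add: algebra_simps)
  have bd: "cmod (?h z) \<le> (s - t)\<^sup>2" if z: "norm z < 1" for z
  proof -
    have "cmod (?h z) \<le> (cmod (of_real s * cayley z - of_real t * cayley z))\<^sup>2 * (cmod ((1 - \<phi> z) / 2))\<^sup>2"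
      unfolding norm_mult norm_power using s t Re_cayley[OF z]
      by (intro mult_right_mono exp_Taylor_halfplane) (auto simp: mult_nonneg_nonpos)
    also have "\<dots> = (cmod (of_real (s - t) * (cayley z * ((1 - \<phi> z) / 2))))\<^sup>2"
      by (simp only: power_mult_distrib[symmetric] norm_mult[symmetric] left_diff_distrib[symmetric]
          of_real_diff[symmetric] mult.assoc)
    also have "\<dots> = (s - t)\<^sup>2 * (cmod ((1 + \<phi> z) / 2))\<^sup>2"
      unfolding cm[OF z] by (simp only: norm_mult norm_minus_cancel power_mult_distrib norm_of_real power2_abs)
    also have "cmod ((1 + \<phi> z) / 2) \<le> 1"
      using le_1[OF z] norm_triangle_ineq[of 1 "\<phi> z"] by (simp add: norm_divide)
    then have "(s - t)\<^sup>2 * (cmod ((1 + \<phi> z) / 2))\<^sup>2 \<le> (s - t)\<^sup>2 * 1"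
      by (intro mult_left_mono power_le_one) auto
    finally show ?thesis by simp
  qed
  have factor: "a * (m * (m * F)) - b * (m * (m * F)) + (x - y) * (b * (- (k * m) * (m * F)))
      = (a - b - (x * k - y * k) * b) * m\<^sup>2 * F" for a b m F x y k :: complex
    by (simp add: power2_eq_square algebra_simps)
  have "E s (M (M f)) - E t (M (M f)) - (s - t) *\<^sub>R - E t (N (M f)) = analytic_toeplitz ?h f"
  proof (rule hardy2_eqI)
    fix z :: complex assume z: "norm z < 1"
    let ?m = "(1 - \<phi> z) / 2" and ?F = "hardy2_fun f z"
    have "hardy2_fun (E s (M (M f)) - E t (M (M f)) - (s - t) *\<^sub>R - E t (N (M f))) z
        = exp (of_real s * cayley z) * (?m * (?m * ?F)) - exp (of_real t * cayley z) * (?m * (?m * ?F))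
          + of_real (s - t) * (exp (of_real t * cayley z) * ((1 + \<phi> z) / 2 * (?m * ?F)))"
      using s t z by (simp only: scaleR_minus_right diff_minus_eq_add hardy2_fun_simps apply_E apply_M apply_N)
    also have "(1 + \<phi> z) / 2 = - (cayley z * ?m)" using cm[OF z] by simp
    also have "exp (of_real s * cayley z) * (?m * (?m * ?F)) - exp (of_real t * cayley z) * (?m * (?m * ?F))
          + of_real (s - t) * (exp (of_real t * cayley z) * (- (cayley z * ?m) * (?m * ?F))) = ?h z * ?F"
      unfolding of_real_diff by (rule factor)
    finally show "hardy2_fun (E s (M (M f)) - E t (M (M f)) - (s - t) *\<^sub>R - E t (N (M f))) z
        = hardy2_fun (analytic_toeplitz ?h f) z"
      using toeplitz_apply[OF bounded_holomorphicI[OF hh bd] z, of f] by simp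
  qed
  then show "norm (E s (M (M f)) - E t (M (M f)) - (s - t) *\<^sub>R - E t (N (M f))) \<le> norm f * (s - t)\<^sup>2"
    using norm_toeplitz_le[OF hh bd, of f] by (simp only: mult.commute)
qed

text \<open>
  A vector orthogonal to the range of \<open>M\<close> is fixed by the adjoint of multiplication by \<open>\<phi>\<close>. A fixed
  vector of the adjoint of a contraction is fixed by the contraction itself, and \<open>\<phi> d = d\<close> forces \<open>d = 0\<close>.
\<close>
lemma M_range_total:
  assumes "\<And>f. cinner d (M f) = 0"
  shows "d = 0"
proof -
  let ?T = "analytic_toeplitz \<phi>"
  have "M d = (1/2) *\<^sub>R (d - ?T d)"
    by (rule hardy2_eqI) (simp add: apply_M hardy2_fun_simps toeplitz_apply[OF symbols_bounded(1)] algebra_simps diff_divide_distrib)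
  then have "cinner d d = cinner d (?T d)"
    using assms[of d] by (simp add: cinner_simps)
  then have "Re (cinner d (?T d)) = (norm d)\<^sup>2" by (simp add: norm_sq_cinner)
  then have "(norm (d - ?T d))\<^sup>2 = (norm (?T d))\<^sup>2 - (norm d)\<^sup>2"
    by (simp add: norm_diff_sq)
  also have "\<dots> \<le> 0"
    using power_mono[OF norm_toeplitz_le[OF hol le_1, of d] norm_ge_zero, of 2] by simp
  finally have "d = ?T d" by simp
  then have "hardy2_fun d z = \<phi> z * hardy2_fun d z" if "norm z < 1" for z
    using toeplitz_apply[OF symbols_bounded(1) that, of d] by simp
  note eigen = this
  show ?thesis
  proof (rule hardy2_eqI)
    show "hardy2_fun d z = hardy2_fun 0 z" if "norm z < 1" for z
      using eigen[OF that] ne_1[OF that] by (simp add: hardy2_fun_simps)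
  qed
qed

lemma M3_range_total:
  assumes "\<And>f. cinner d (M (M (M f))) = 0"
  shows "d = 0"
proof -
  note adj = adjoint_right[OF clinear_EMN(2)]
  have "hilbert_adjoint M (hilbert_adjoint M d) = 0"
    by (rule M_range_total) (use assms in \<open>simp add: adj\<close>)
  then have "hilbert_adjoint M d = 0"
    by (intro M_range_total) (simp add: adj)
  then show ?thesis
    by (intro M_range_total) (simp add: adj)
qed

definition U :: "real \<Rightarrow> hardy2 \<Rightarrow> hardy2" where "U t = hilbert_adjoint (E t)"

lemma operator_semigroup_U: "operator_semigroup U"
  unfolding operator_semigroup_def
proof (intro conjI allI impI)
  show "bounded_clinear (U t)" if "t \<ge> 0" for t
    unfolding U_def by (rule clinear_hilbert_adjoint(1)[OF clinear_EMN(1) norm_E]) (use that in auto)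
  have "E 0 = id" by (auto simp: E_0)
  then show "U 0 = id" unfolding U_def by (intro hilbert_adjoint_eqI) simp
  show "U (s + t) = U s \<circ> U t" if "s \<ge> 0" "t \<ge> 0" for s t
    unfolding U_def
  proof (rule hilbert_adjoint_eqI)
    fix x y
    show "cinner (E (s + t) x) y = cinner x ((hilbert_adjoint (E s) \<circ> hilbert_adjoint (E t)) y)"
      using that by (simp add: E_add hilbert_adjoint clinear_EMN)
  qed
qed

text \<open>
  The assumption says that \<open>W\<close> intertwines the cogenerators, hence the resolvents, which is the fact
  \<open>res\<close> below. Consequently \<open>\<langle>W R T(s) x, E (t - s) M\<^sup>2 f\<rangle>\<close> is differentiable in \<open>s\<close> with derivative zero;
  comparing its values at \<open>s = 0\<close> and \<open>s = t\<close> shows that \<open>U t (W x) - W (T t x)\<close> is orthogonal to the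
  range of \<open>M\<^sup>3\<close>.
\<close>
lemma intertwining:
  assumes T: "c0dot_semigroup T" and W: "bounded_clinear W"
    and WV: "\<And>x. hilbert_adjoint (analytic_toeplitz \<phi>) (W x) = W (c0dot_semigroup.cogenerator T x)"
    and t: "t \<ge> 0"
  shows "U t (W x) = W (T t x)"
proof -
  interpret c0dot_semigroup T by (rule T)
  note Wl = bounded_clinearD[OF W] and El = bounded_clinearD[OF clinear_EMN(1)]
    and Ml = bounded_clinearD[OF clinear_EMN(2)]
  have res: "cinner (W (resolvent y)) f = cinner (W y) (M f)" for y f
  proof -
    have "resolvent y = (1/2) *\<^sub>R (y - cogenerator y)" by (simp add: cogenerator_def)
    then have "W (resolvent y) = (1/2) *\<^sub>R (W y - hilbert_adjoint (analytic_toeplitz \<phi>) (W y))"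
      by (simp add: Wl WV)
    moreover have "M f = (1/2) *\<^sub>R (f - analytic_toeplitz \<phi> f)"
      by (rule hardy2_eqI) (simp add: apply_M hardy2_fun_simps toeplitz_apply[OF symbols_bounded(1)] algebra_simps diff_divide_distrib)
    ultimately show ?thesis
      by (simp add: cinner_simps adjoint_right[OF clinear_toeplitz[OF symbols_bounded(1)]])
  qed
  have "cinner (U t (W x) - W (T t x)) (M (M (M f))) = 0" for f
  proof -
    let ?a = "\<lambda>s. W (resolvent (T s x))" and ?b = "\<lambda>s. E (t - s) (M (M f))"
    have "((\<lambda>s. cinner (?a s) (?b s)) has_vector_derivative 0) (at s within {0..t})" if s: "s \<in> {0..t}" for s
    proof -
      have a: "(?a has_vector_derivative W (resolvent (T s x) - T s x)) (at s within {0..t})"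
        by (rule has_vector_derivative_within_subset[OF
            bounded_linear.has_vector_derivative[OF Wl(1) resolvent_derivative]]) (use s in auto)
      have "((\<lambda>t. E t (M (M f))) has_vector_derivative - E (t - s) (N (M f))) (at (t - s) within (\<lambda>s. t - s) ` {0..t})"
        by (rule has_vector_derivative_within_subset[OF E_derivative]) (use s in auto)
      moreover have "((\<lambda>s. t - s) has_vector_derivative - 1) (at s within {0..t})"
        by (auto intro!: derivative_eq_intros)
      ultimately have b: "(?b has_vector_derivative E (t - s) (N (M f))) (at s within {0..t})"
        using vector_diff_chain_within[of "\<lambda>s. t - s" "- 1" s "{0..t}"] by (fastforce simp: o_def)
      have ts: "t - s \<ge> 0" using s by simp
      have key: "M (E (t - s) (N (M f))) + M (E (t - s) (M (M f))) = E (t - s) (M (M f))"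
        by (rule hardy2_eqI)
          (simp add: hardy2_fun_simps apply_E[OF ts] apply_M apply_N field_simps)
      have "((\<lambda>s. cinner (?a s) (?b s)) has_vector_derivative
          cinner (?a s) (E (t - s) (N (M f))) + cinner (W (resolvent (T s x) - T s x)) (?b s)) (at s within {0..t})"
        by (rule bounded_bilinear.has_vector_derivative[OF bounded_bilinear_cinner a b])
      also have "cinner (?a s) (E (t - s) (N (M f))) + cinner (W (resolvent (T s x) - T s x)) (?b s)
          = cinner (W (T s x)) (M (E (t - s) (N (M f))) + M (E (t - s) (M (M f)))) - cinner (W (T s x)) (?b s)"
        by (simp add: Wl(3) cinner_simps res)
      also have "\<dots> = 0" unfolding key by simp
      finally show ?thesis .
    qed
    then have "\<exists>c. \<forall>s\<in>{0..t}. cinner (?a s) (?b s) = c"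
      by (intro has_derivative_zero_constant) (auto simp: has_vector_derivative_def)
    then obtain c where c: "\<And>s. s \<in> {0..t} \<Longrightarrow> cinner (?a s) (?b s) = c" by blast
    have "cinner (?a 0) (?b 0) = cinner (?a t) (?b t)" using c[of 0] c[of t] t by simp
    then have "cinner (W x) (M (E t (M (M f)))) = cinner (W (T t x)) (M (M (M f)))"
      by (simp add: res T_0 E_0)
    moreover have "M (E t (M (M f))) = E t (M (M (M f)))"
      by (rule hardy2_eqI) (simp add: apply_E[OF t] apply_M)
    ultimately show ?thesis
      by (simp add: cinner_simps U_def adjoint_right[OF clinear_EMN(1)[OF t]])
  qed
  then have "U t (W x) - W (T t x) = 0" by (rule M3_range_total)
  then show ?thesis by simp
qed

end

section \<open>Universality\<close>

lemma isometric_intertwiner_universal: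
  fixes W :: "'k::complex_hilbert_space \<Rightarrow> 'h::complex_hilbert_space"
  assumes W: "bounded_clinear W" "\<And>x. norm (W x) = norm x"
    and inter: "\<And>t x. t \<ge> 0 \<Longrightarrow> U t (W x) = W (T t x)"
  shows "\<exists>(M :: 'h set) (R :: 'h \<Rightarrow> 'k). closed M \<and> complex_space.subspace M \<and> (\<forall>t\<ge>0. U t ` M \<subseteq> M) \<and>
    bounded_isomorphism_on M R \<and> (\<forall>t\<ge>0. T t = R \<circ> U t \<circ> inv_into M R)"
proof -
  note Wl = bounded_clinearD[OF W(1)]
  have inj: "inj W"
  proof (rule injI)
    fix x y assume "W x = W y"
    then have "norm (W (x - y)) = 0" by (simp add: Wl(3))
    then show "x = y" by (simp add: W)
  qed
  let ?M = "range W" and ?R = "inv W"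
  have RW: "?R (W x) = x" for x by (rule inv_f_f[OF inj])
  have bij: "bij_betw ?R ?M UNIV"
    unfolding bij_betw_def by (auto intro: inj_on_inv_into simp: RW image_image)
  have invR: "inv_into ?M ?R x = W x" for x
    by (rule inv_into_f_eq) (use bij RW in \<open>auto simp: bij_betw_def\<close>)
  have "complete ?M"
  proof (rule complete_isometric_image[OF zero_less_one])
    show "complete (UNIV :: 'k set)" by (simp add: complete_UNIV)
    show "\<forall>x\<in>UNIV. norm (W x) \<ge> 1 * norm x" by (simp add: W)
  qed (use Wl in auto)
  then have "closed ?M" by (rule complete_imp_closed)
  moreover have "complex_space.subspace ?M"
  proof (rule complex_space.subspaceI)
    show "0 \<in> ?M" by (rule range_eqI[of _ _ 0]) (simp add: Wl)
  qed (auto simp flip: Wl(2,4))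
  moreover have "\<forall>t\<ge>0. U t ` ?M \<subseteq> ?M" by (auto simp: inter)
  moreover have "bounded_isomorphism_on ?M ?R"
    unfolding bounded_isomorphism_on_def invR
    using bij by (auto simp: Wl(2,4)[symmetric] RW W intro!: exI[of _ 1])
  moreover have "\<forall>t\<ge>0. T t = ?R \<circ> U t \<circ> inv_into ?M ?R"
    by (auto simp: fun_eq_iff invR inter RW)
  ultimately show ?thesis by blast
qed

lemma inner_function_ne_1:
  assumes \<phi>: "inner_function \<phi>" and nb: "\<not> finite_blaschke_product \<phi>" and z: "norm z < 1"
  shows "\<phi> z \<noteq> 1"
proof
  assume eq: "\<phi> z = 1"
  have "\<phi> constant_on ball 0 1"
  proof (rule maximum_modulus_principle[of _ _ "ball 0 1" z])
    show "\<phi> holomorphic_on ball 0 1" using \<phi> by (simp add: inner_function_def bounded_holomorphic_def)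
    show "cmod (\<phi> w) \<le> cmod (\<phi> z)" if "w \<in> ball 0 1" for w
      using inner_function_le_1[OF \<phi>, of w] that eq by simp
  qed (use z in auto)
  then have "\<phi> w = 1" if "norm w < 1" for w using eq z that unfolding constant_on_def by auto
  then have "finite_blaschke_product \<phi>"
    unfolding finite_blaschke_product_def by (intro exI[of _ 1] exI[of _ "[]"]) auto
  then show False using nb by simp
qed

lemma toeplitz_semigroup_universal:
  fixes U :: "real \<Rightarrow> hardy2 \<Rightarrow> hardy2"
  assumes \<phi>: "inner_function \<phi>" and nb: "\<not> finite_blaschke_product \<phi>"
    and U: "\<And>t. t \<ge> 0 \<Longrightarrow>
      U t = hilbert_adjoint (analytic_toeplitz (\<lambda>z. exp (complex_of_real t * ((\<phi> z + 1) / (\<phi> z - 1)))))"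
  shows "universal_for_C0dot TYPE('k::complex_hilbert_space) U"
proof -
  interpret schur_symbol \<phi>
  proof
    show "\<phi> holomorphic_on ball 0 1" using \<phi> by (simp add: inner_function_def bounded_holomorphic_def)
  qed (use inner_function_le_1[OF \<phi>] inner_function_ne_1[OF \<phi> nb] in auto)
  have UU: "U t = schur_symbol.U \<phi> t" if "t \<ge> 0" for t
    using U[OF that] by (simp add: U_def E_def cayley_def)
  have "operator_semigroup U"
    using operator_semigroup_U unfolding operator_semigroup_def by (simp add: UU)
  moreover have "\<exists>(M :: hardy2 set) (R :: hardy2 \<Rightarrow> 'k). closed M \<and> complex_space.subspace M \<and>
      (\<forall>t\<ge>0. U t ` M \<subseteq> M) \<and> bounded_isomorphism_on M R \<and> (\<forall>t\<ge>0. T t = R \<circ> U t \<circ> inv_into M R)"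
    if sep: "separable_infinite_dimensional TYPE('k)" and T: "C0dot_contraction_semigroup T"
    for T :: "real \<Rightarrow> 'k \<Rightarrow> 'k"
  proof -
    interpret T: c0dot_semigroup T by unfold_locales (rule T)
    obtain g where g: "\<And>k. hilbert_adjoint (analytic_toeplitz \<phi>) (g k) = 0"
      "\<And>m n :: nat. cinner (g m) (g n) = (if m = n then 1 else 0)"
      by (rule toeplitz_adjoint_kernel_infinite[OF \<phi> nb]) blast
    have n: "norm (analytic_toeplitz \<phi> x) \<le> 1 * norm x" for x by (simp add: norm_toeplitz_inner[OF \<phi>])
    have "separable_space (euclidean :: 'k topology)"
      using sep by (simp add: separable_infinite_dimensional_def)
    then obtain W where W: "bounded_clinear W" "\<And>x :: 'k. norm (W x) = norm x"
      "\<And>x. hilbert_adjoint (analytic_toeplitz \<phi>) (W x) = W (T.cogenerator x)"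
      by (rule contraction_model[OF _ T.clinear_cogenerator T.cogenerator_contraction T.cogenerator_power_lim
            clinear_toeplitz[OF symbols_bounded(1)] norm_toeplitz_inner[OF \<phi>]
            clinear_hilbert_adjoint(1)[OF clinear_toeplitz[OF symbols_bounded(1)] n]
            hilbert_adjoint[OF clinear_toeplitz[OF symbols_bounded(1)]] g]) blast
    have "U t (W x) = W (T t x)" if "t \<ge> 0" for t x
      unfolding UU[OF that] by (rule intertwining[OF T.c0dot_semigroup_axioms W(1,3) that])
    then show ?thesis by (rule isometric_intertwiner_universal[OF W(1,2)])
  qed
  ultimately show ?thesis unfolding universal_for_C0dot_def by blast
qed

text \<open>
  Up to a constant factor the limit is \<open>1\<close>, where the principal branch of the logarithm is continuous.
  Near the end of the path, \<open>f\<close> minus that branch is continuous with values in a translate of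
  \<open>2 \<pi> \<i> \<int>\<close>, hence constant.
\<close>
lemma tendsto_of_exp_tendsto:
  fixes f :: "real \<Rightarrow> complex"
  assumes f: "continuous_on {0<..<1} f" and lim: "((\<lambda>r. exp (f r)) \<longlongrightarrow> w) (at_left 1)" and w: "w \<noteq> 0"
  obtains l where "(f \<longlongrightarrow> l) (at_left 1)" "exp l = w"
proof -
  obtain v where v: "w = exp v" using w exp_Ln by metis
  define h where "h r = f r - v" for r
  have h1: "((\<lambda>r. exp (h r)) \<longlongrightarrow> 1) (at_left 1)"
    using tendsto_divide[OF lim tendsto_const, of "exp v"] v by (simp add: h_def exp_diff)
  have "\<forall>\<^sub>F r in at_left 1. dist (exp (h r)) 1 < 1"
    by (rule tendstoD[OF h1]) simp
  moreover have "\<forall>\<^sub>F r in at_left (1::real). r > 0"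
    using eventually_at_left_real[of 0 1] by (rule eventually_mono) auto
  ultimately have "\<forall>\<^sub>F r in at_left 1. dist (exp (h r)) 1 < 1 \<and> r > 0" by (rule eventually_conj)
  then obtain b where b: "b < 1" "\<And>r. b < r \<Longrightarrow> r < 1 \<Longrightarrow> dist (exp (h r)) 1 < 1 \<and> r > 0"
    unfolding eventually_at_left_field by blast
  have slit: "exp (h r) \<notin> \<real>\<^sub>\<le>\<^sub>0" if "r \<in> {b<..<1}" for r
  proof
    assume "exp (h r) \<in> \<real>\<^sub>\<le>\<^sub>0"
    then have "Re (exp (h r)) \<le> 0" by (auto simp: complex_nonpos_Reals_iff)
    moreover have "\<bar>Re (exp (h r) - 1)\<bar> < 1"
      using b(2)[of r] that abs_Re_le_cmod[of "exp (h r) - 1"] by (auto simp: dist_norm)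
    ultimately show False by simp
  qed
  define d where "d r = h r - Ln (exp (h r))" for r
  have "continuous_on {b<..<1} h"
    unfolding h_def by (intro continuous_intros continuous_on_subset[OF f]) (use b in auto)
  then have "continuous_on {b<..<1} d"
    unfolding d_def by (intro continuous_intros) (use slit in auto)
  moreover have ex: "exp (d r) = 1" for r by (simp add: d_def exp_diff)
  have "1 \<le> norm (d s - d r)" if "d s \<noteq> d r" for r s
  proof -
    have "exp (d s - d r) = 1" by (simp add: exp_diff ex)
    then obtain n :: int where n: "Re (d s - d r) = 0" "Im (d s - d r) = of_int (2 * n) * pi"
      unfolding exp_eq_1 by blast
    then have "n \<noteq> 0" using that by (auto simp: complex_eq_iff)
    then have "1 \<le> \<bar>real_of_int n\<bar>" by linarith
    then have "1 * 1 \<le> \<bar>real_of_int n\<bar> * (2 * pi)" using pi_gt3 by (intro mult_mono) auto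
    also have "\<dots> = \<bar>Im (d s - d r)\<bar>" unfolding n by (simp add: abs_mult)
    also have "\<dots> \<le> norm (d s - d r)" by (rule abs_Im_le_cmod)
    finally show ?thesis by simp
  qed
  ultimately have "d constant_on {b<..<1}"
    by (intro continuous_discrete_range_constant) (auto intro!: exI[of _ 1])
  then obtain c where c: "\<And>r. r \<in> {b<..<1} \<Longrightarrow> d r = c" unfolding constant_on_def by blast
  have "((\<lambda>r. c + Ln (exp (h r)) + v) \<longlongrightarrow> c + Ln 1 + v) (at_left 1)"
    by (intro tendsto_intros h1) auto
  moreover have "\<forall>\<^sub>F r in at_left 1. r \<in> {b<..<1}"
    using b by (intro eventually_at_left_real)
  then have "\<forall>\<^sub>F r in at_left 1. c + Ln (exp (h r)) + v = f r"
    by eventually_elim (use c in \<open>force simp: d_def h_def\<close>)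
  ultimately have l: "(f \<longlongrightarrow> c + v) (at_left 1)"
    by (simp add: Lim_transform_eventually)
  have "((\<lambda>r. exp (f r)) \<longlongrightarrow> exp (c + v)) (at_left 1)" by (intro tendsto_exp l)
  then have "exp (c + v) = w" using lim by (intro tendsto_unique[of "at_left (1::real)"]) auto
  with l show ?thesis by (rule that)
qed

text \<open>
  The radial limits of \<open>\<psi>\<close> are finite and purely imaginary, and the Cayley transform maps the imaginary
  axis into the unit circle.
\<close>
lemma inner_function_Cayley:
  assumes \<psi>: "\<psi> holomorphic_on ball 0 1" and inner: "inner_function (\<lambda>z. exp (\<psi> z))"
  shows "norm z < 1 \<Longrightarrow> Re (\<psi> z) \<le> 0" and "inner_function (\<lambda>z. (\<psi> z + 1) / (\<psi> z - 1))"
proof -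
  show Re: "Re (\<psi> z) \<le> 0" if "norm z < 1" for z
    using inner_function_le_1[OF inner that] by simp
  have ne: "\<psi> z \<noteq> 1" if "norm z < 1" for z using Re[OF that] by auto
  have le: "cmod ((\<psi> z + 1) / (\<psi> z - 1)) \<le> 1" if z: "norm z < 1" for z
  proof -
    have "(cmod (\<psi> z + 1))\<^sup>2 \<le> (cmod (\<psi> z - 1))\<^sup>2"
      using Re[OF z] by (simp add: cmod_power2) (simp add: power2_eq_square algebra_simps)
    then show ?thesis using ne[OF z] by (simp add: norm_divide power2_le_iff_abs_le)
  qed
  have bh: "bounded_holomorphic (\<lambda>z. (\<psi> z + 1) / (\<psi> z - 1))"
    by (rule bounded_holomorphicI[OF _ le]) (intro holomorphic_intros \<psi>, use ne in auto)
  have "\<exists>w'. ((\<lambda>r. (\<psi> (of_real r * cis \<theta>) + 1) / (\<psi> (of_real r * cis \<theta>) - 1)) \<longlongrightarrow> w') (at_left (1::real)) \<and> norm w' = 1"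
    if w: "((\<lambda>r. exp (\<psi> (of_real r * cis \<theta>))) \<longlongrightarrow> w) (at_left (1::real))" "norm w = 1" for \<theta> w
  proof -
    have "continuous_on {0<..<1} (\<lambda>r. \<psi> (of_real r * cis \<theta>))"
      by (rule continuous_on_compose2[OF holomorphic_on_imp_continuous_on[OF \<psi>]])
        (auto intro!: continuous_intros simp: norm_mult)
    moreover have "w \<noteq> 0" using w(2) by auto
    ultimately obtain l where l: "((\<lambda>r. \<psi> (of_real r * cis \<theta>)) \<longlongrightarrow> l) (at_left (1::real))" "exp l = w"
      using tendsto_of_exp_tendsto[OF _ w(1)] by blast
    have "exp (Re l) = 1" using w(2) l(2) by (metis norm_exp_eq_Re)
    then have R: "Re l = 0" by simp
    then have "l \<noteq> 1" by auto
    then have "((\<lambda>r. (\<psi> (of_real r * cis \<theta>) + 1) / (\<psi> (of_real r * cis \<theta>) - 1)) \<longlongrightarrow> (l + 1) / (l - 1)) (at_left (1::real))"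
      by (intro tendsto_intros l) auto
    moreover have "norm ((l + 1) / (l - 1)) = 1"
      using R \<open>l \<noteq> 1\<close> by (simp add: norm_divide) (simp add: cmod_def)
    ultimately show ?thesis by blast
  qed
  then show "inner_function (\<lambda>z. (\<psi> z + 1) / (\<psi> z - 1))"
    using inner bh unfolding inner_function_def by (auto elim!: eventually_mono)
qed

theorem theorem3p8:
  shows "(\<forall>\<phi>. inner_function \<phi> \<and> \<not> finite_blaschke_product \<phi> \<longrightarrow>
      universal_for_C0dot TYPE('k::complex_hilbert_space)
        (\<lambda>t. hilbert_adjoint (analytic_toeplitz
          (\<lambda>z. exp (complex_of_real t * ((\<phi> z + 1) / (\<phi> z - 1)))))))
    \<and>
    (\<forall>(\<psi> :: complex \<Rightarrow> complex) (U :: real \<Rightarrow> hardy2 \<Rightarrow> hardy2).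
      \<psi> holomorphic_on ball 0 1 \<and>
      (\<forall>t\<ge>0. singular_inner_function (\<lambda>z. exp (complex_of_real t * \<psi> z))) \<and>
      operator_semigroup U \<and>
      (\<forall>t\<ge>0. U t = hilbert_adjoint (analytic_toeplitz (\<lambda>z. exp (complex_of_real t * \<psi> z)))) \<longrightarrow>
      inner_function (\<lambda>z. (\<psi> z + 1) / (\<psi> z - 1)) \<and>
      (\<not> finite_blaschke_product (\<lambda>z. (\<psi> z + 1) / (\<psi> z - 1)) \<longrightarrow>
        universal_for_C0dot TYPE('k) U))"
proof (intro conjI allI impI)
  fix \<phi> :: "complex \<Rightarrow> complex"
  assume "inner_function \<phi> \<and> \<not> finite_blaschke_product \<phi>"
  then show "universal_for_C0dot TYPE('k) (\<lambda>t. hilbert_adjoint (analytic_toeplitz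
      (\<lambda>z. exp (complex_of_real t * ((\<phi> z + 1) / (\<phi> z - 1))))))"
    by (intro toeplitz_semigroup_universal) auto
next
  fix \<psi> :: "complex \<Rightarrow> complex" and U :: "real \<Rightarrow> hardy2 \<Rightarrow> hardy2"
  assume "\<psi> holomorphic_on ball 0 1 \<and>
      (\<forall>t\<ge>0. singular_inner_function (\<lambda>z. exp (complex_of_real t * \<psi> z))) \<and>
      operator_semigroup U \<and>
      (\<forall>t\<ge>0. U t = hilbert_adjoint (analytic_toeplitz (\<lambda>z. exp (complex_of_real t * \<psi> z))))"
  then have \<psi>: "\<psi> holomorphic_on ball 0 1"
    and s: "singular_inner_function (\<lambda>z. exp (complex_of_real 1 * \<psi> z))"
    and U: "\<And>t. t \<ge> 0 \<Longrightarrow> U t = hilbert_adjoint (analytic_toeplitz (\<lambda>z. exp (complex_of_real t * \<psi> z)))"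
    by (auto simp del: of_real_1)
  let ?\<phi> = "\<lambda>z. (\<psi> z + 1) / (\<psi> z - 1)"
  have inner: "inner_function (\<lambda>z. exp (\<psi> z))" using s by (simp add: singular_inner_function_def)
  note Cayley = inner_function_Cayley[OF \<psi> inner]
  show "inner_function ?\<phi>" by (rule Cayley(2))
  assume nb: "\<not> finite_blaschke_product ?\<phi>"
  show "universal_for_C0dot TYPE('k) U"
  proof (rule toeplitz_semigroup_universal[OF Cayley(2) nb])
    fix t :: real assume t: "t \<ge> 0"
    have "\<psi> z = (?\<phi> z + 1) / (?\<phi> z - 1)" if "norm z < 1" for z
    proof -
      have "\<psi> z \<noteq> 1" using Cayley(1)[OF that] by auto
      then show ?thesis by (simp add: field_simps)
    qed
    then have "analytic_toeplitz (\<lambda>z. exp (complex_of_real t * \<psi> z))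
        = analytic_toeplitz (\<lambda>z. exp (complex_of_real t * ((?\<phi> z + 1) / (?\<phi> z - 1))))"
      by (intro toeplitz_cong) simp
    with U[OF t] show "U t = hilbert_adjoint (analytic_toeplitz
        (\<lambda>z. exp (complex_of_real t * ((?\<phi> z + 1) / (?\<phi> z - 1)))))" by simp
  qed
qed

end
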